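(* Let $\theta$ be an inner function on the unit disc, let $\lambda\in\mathbb T$, and let $$\widetilde{\mathcal G}_\lambda=\begin{pmatrix}\overline\theta\, I_{2}&0_{2\times 2}\\ (z-\lambda)(1-\overline\theta)\,I_{2}&\theta\, I_{2}\end{pmatrix}\in(L^\infty(\mathbb T))^{4\times4},$$ where $I_2$ is the $2\times2$ identity matrix. Then $\theta$ has an angular derivative in the sense of Carathéodory at $\lambda$ if and only if $\widetilde{\mathcal G}_\lambda$ has an $L^2$-factorization.
   Context: $H^2$ is the Hardy space of the unit disc identified with its boundary values on the unit circle $\mathbb T$, and $\overline{H^2}$ is the set of complex conjugates of functions in $H^2$. An inner function $\theta$ has an angular derivative in the sense of Carathéodory (ADC) at $\lambda\in\mathbb T$ if the nontangential limit $\theta(\lambda)$ of $\theta(z)$ as $z\to\lambda$ exists with $|\theta(\lambda)|=1$ and the difference quotient $\frac{\theta(z)-\theta(\lambda)}{z-\lambda}$ has a (finite) nontangential limit at $\lambda$. An $L^2$-factorization of $G\in(L^\infty)^{n\times n}$ is a representation $G=G_-DG_+$ a.e. on $\mathbb T$ with $G_-^{\pm1}\in(\overline{H^2})^{n\times n}$, $G_+^{\pm1}\in(H^2)^{n\times n}$ and $D=\operatorname{diag}(z^{k_1},\dots,z^{k_n})$ with $k_j\in\mathbb Z$ (no boundedness of the operator $G_+^{-1}P^+G_-^{-1}$ is required, where $P^+$ is the orthogonal projection from $L^2$ onto $H^2$). *)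

theory Defs
  imports "HOL-Complex_Analysis.Complex_Analysis"
begin

text \<open>
  Functions on the unit circle are represented by total functions of type
  \<^typ>\<open>complex \<Rightarrow> complex\<close>; only their values on the circle, up to a null set for arc length,
  are relevant.
\<close>

definition ae_circle :: "(complex \<Rightarrow> bool) \<Rightarrow> bool" where
  "ae_circle P \<longleftrightarrow> (AE t in lebesgue_on {0..2*pi}. P (cis t))"

definition Linf_circle :: "(complex \<Rightarrow> complex) set" where
  "Linf_circle = {g. (\<lambda>t. g (cis t)) \<in> borel_measurable (lebesgue_on {0..2*pi}) \<and>
                     (\<exists>C. ae_circle (\<lambda>\<zeta>. cmod (g \<zeta>) \<le> C))}"

definition H2_disc :: "(complex \<Rightarrow> complex) set" where
  "H2_disc = {f. f holomorphic_on ball 0 1 \<and>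
     bdd_above ((\<lambda>r. 1 / (2*pi) * integral {0..2*pi} (\<lambda>t. (cmod (f (of_real r * cis t)))\<^sup>2)) ` {0..<1})}"

definition has_radial_limit :: "(complex \<Rightarrow> complex) \<Rightarrow> complex \<Rightarrow> complex \<Rightarrow> bool" where
  "has_radial_limit f \<zeta> w \<longleftrightarrow> ((\<lambda>r. f (of_real r * \<zeta>)) \<longlongrightarrow> w) (at_left (1::real))"

definition H2_circle :: "(complex \<Rightarrow> complex) set" where
  "H2_circle = {g. \<exists>f\<in>H2_disc. ae_circle (\<lambda>\<zeta>. has_radial_limit f \<zeta> (g \<zeta>))}"

definition conj_H2_circle :: "(complex \<Rightarrow> complex) set" where
  "conj_H2_circle = (\<lambda>g \<zeta>. cnj (g \<zeta>)) ` H2_circle"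

definition inner_function :: "(complex \<Rightarrow> complex) \<Rightarrow> bool" where
  "inner_function \<theta> \<longleftrightarrow> \<theta> holomorphic_on ball 0 1 \<and> bounded (\<theta> ` ball 0 1) \<and>
     ae_circle (\<lambda>\<zeta>. \<exists>w. cmod w = 1 \<and> has_radial_limit \<theta> \<zeta> w)"

text \<open>For an inner function the limit exists almost everywhere; elsewhere the value is arbitrary.\<close>

definition boundary_value :: "(complex \<Rightarrow> complex) \<Rightarrow> complex \<Rightarrow> complex" where
  "boundary_value f \<zeta> = Lim (at_left (1::real)) (\<lambda>r. f (of_real r * \<zeta>))"

text \<open>For \<open>M \<le> 1\<close> the region is empty.\<close>

definition stolz_region :: "complex \<Rightarrow> real \<Rightarrow> complex set" where
  "stolz_region lam M = {z \<in> ball 0 1. cmod (z - lam) < M * (1 - cmod z)}"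

definition has_nontangential_limit ::
    "(complex \<Rightarrow> complex) \<Rightarrow> complex \<Rightarrow> complex \<Rightarrow> bool" where
  "has_nontangential_limit f lam w \<longleftrightarrow> (\<forall>M>1. (f \<longlongrightarrow> w) (at lam within stolz_region lam M))"

definition has_ADC :: "(complex \<Rightarrow> complex) \<Rightarrow> complex \<Rightarrow> bool" where
  "has_ADC \<theta> lam \<longleftrightarrow>
     (\<exists>w. has_nontangential_limit \<theta> lam w \<and> cmod w = 1 \<and>
        (\<exists>d. has_nontangential_limit (\<lambda>z. (\<theta> z - w) / (z - lam)) lam d))"

definition entries_in ::
    "(complex \<Rightarrow> complex^'n^'n) \<Rightarrow> (complex \<Rightarrow> complex) set \<Rightarrow> bool" where
  "entries_in G S \<longleftrightarrow> (\<forall>i j. (\<lambda>\<zeta>. G \<zeta> $ i $ j) \<in> S)"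

definition diag_powers :: "('n \<Rightarrow> int) \<Rightarrow> complex \<Rightarrow> complex^'n^'n" where
  "diag_powers k \<zeta> = (\<chi> i j. if i = j then \<zeta> powi k i else 0)"

text \<open>
  \<^const>\<open>matrix_inv\<close> is only meaningful for invertible arguments, hence the explicit
  invertibility conditions.
\<close>

definition has_L2_factorization :: "(complex \<Rightarrow> complex^'n^'n) \<Rightarrow> bool" where
  "has_L2_factorization G \<longleftrightarrow>
     (\<exists>Gm Gp k.
        ae_circle (\<lambda>\<zeta>. invertible (Gm \<zeta>)) \<and>
        entries_in Gm conj_H2_circle \<and> entries_in (\<lambda>\<zeta>. matrix_inv (Gm \<zeta>)) conj_H2_circle \<and>
        ae_circle (\<lambda>\<zeta>. invertible (Gp \<zeta>)) \<and>
        entries_in Gp H2_circle \<and> entries_in (\<lambda>\<zeta>. matrix_inv (Gp \<zeta>)) H2_circle \<and>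
        ae_circle (\<lambda>\<zeta>. G \<zeta> = Gm \<zeta> ** diag_powers k \<zeta> ** Gp \<zeta>))"

definition G_tilde :: "(complex \<Rightarrow> complex) \<Rightarrow> complex \<Rightarrow> complex \<Rightarrow> complex^4^4" where
  "G_tilde \<theta> lam \<zeta> =
     (let u = boundary_value \<theta> \<zeta>; g = (\<zeta> - lam) * (1 - cnj u) in
      vector [vector [cnj u, 0,     0, 0],
              vector [0,     cnj u, 0, 0],
              vector [g,     0,     u, 0],
              vector [0,     g,     0, u]])"

end

theory Submission
  imports Defs
begin

text \<open>
  Write \<open>u\<close> for the boundary values of \<open>\<theta>\<close>. Both properties are equivalent to
  \<open>(\<theta> - w) / (z - \<lambda>) \<in> H\<^sup>2\<close> for some constant \<open>w\<close>, which is then unimodular.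

  For the angular derivative this is the Julia--Caratheodory argument: the reproducing kernels
  \<open>k\<^sub>v = (1 - cnj (\<theta> v) \<theta>) / (1 - cnj v z)\<close> of the model space have squared norm
  \<open>(1 - |\<theta> v|\<^sup>2) / (1 - |v|\<^sup>2)\<close>, and they stay bounded as \<open>v\<close> tends to \<open>\<lambda>\<close>
  nontangentially exactly when the difference quotient, a multiple of \<open>k\<^sub>\<lambda>\<close>, is in \<open>H\<^sup>2\<close>.

  For the factorization, the symbol consists of two copies of a \<open>2 \<times> 2\<close> block, and if that block maps
  \<open>(a, b) \<in> H\<^sup>2\<close> into the conjugate of \<open>H\<^sup>2\<close>, then \<open>(z - \<lambda>) a = p - \<theta> q\<close> and \<open>b = q\<close>
  with polynomials \<open>p\<close>, \<open>q\<close> of degree at most one. If \<open>p\<close> or \<open>q\<close> does not vanish at \<open>\<lambda>\<close>,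
  the difference quotient is in \<open>H\<^sup>2\<close>; otherwise \<open>(a, b)\<close> lies in a fixed one-dimensional space.
  In the latter case a nonzero partial index would give a nonzero solution \<open>(a, b)\<close> together with
  \<open>(z a, z b)\<close>, and vanishing indices would give four pointwise independent columns in a space of
  pointwise rank two. Positive indices are reduced to negative ones, without determinants, because the
  inverse transpose of a \<open>2 \<times> 2\<close> matrix of determinant one is conjugate to the matrix itself.
  Conversely, the same description of \<open>(a, b)\<close> yields explicit factors.
\<close>

subsection \<open>Square integrable limits on the circle\<close>

abbreviation circ :: "real measure" where
  "circ \<equiv> lebesgue_on {0..2*pi}"

lemma finite_measure_circ [simp]: "finite_measure circ"
  by (intro finite_measureI) (simp add: emeasure_restrict_space)

lemma integrable_const_circ [simp]: "integrable circ (\<lambda>_. c :: 'b::euclidean_space)"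
  by (rule finite_measure.integrable_const) simp

lemma measure_circ [simp]: "measure circ {0..2*pi} = 2 * pi"
  by (simp add: measure_restrict_space)

lemma
  fixes f :: "real \<Rightarrow> 'b::euclidean_space"
  assumes "continuous_on {0..2*pi} f"
  shows integrable_circ_continuous: "integrable circ f"
    and integral_circ_continuous: "integral\<^sup>L circ f = integral {0..2*pi} f"
    and measurable_circ_continuous: "f \<in> borel_measurable circ"
proof -
  show i: "integrable circ f" by (rule continuous_imp_integrable_real [OF assms])
  show "integral\<^sup>L circ f = integral {0..2*pi} f"
    by (rule lebesgue_integral_eq_integral [OF i]) simp
  show "f \<in> borel_measurable circ" using i by simp
qed

text \<open>Lebesgue measure is complete, so a change on a null set keeps measurability; extension
  by zero moves the question to the whole line. This matters because boundary values are fixed only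
  almost everywhere.\<close>

lemma borel_measurable_circ_AE_cong:
  fixes f g :: "real \<Rightarrow> complex"
  assumes "f \<in> borel_measurable circ" "AE t in circ. f t = g t"
  shows "g \<in> borel_measurable circ"
proof -
  have "(\<lambda>t. if t \<in> {0..2*pi} then f t else 0) \<in> borel_measurable lebesgue"
    using assms(1) by (intro borel_measurable_if_I) auto
  moreover have "AE t in lebesgue. (if t \<in> {0..2*pi} then f t else 0) = (if t \<in> {0..2*pi} then g t else 0)"
    using assms(2) by (subst (asm) AE_restrict_space_iff) auto
  ultimately have "(\<lambda>t. if t \<in> {0..2*pi} then g t else 0) \<in> borel_measurable lebesgue"
    by (rule borel_measurable_AE)
  then show ?thesis by (rule borel_measurable_if_D)
qed

text \<open>The pointwise bound \<open>|u h| \<le> min (|u h|) (K |u|\<^sup>2) + |h|\<^sup>2 / K\<close> reduces the claim to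
  dominated convergence.\<close>

lemma tendsto_integral_mult_of_AE_of_L2_bounded:
  fixes u :: "'a \<Rightarrow> complex" and h :: "nat \<Rightarrow> 'a \<Rightarrow> complex"
  assumes [measurable]: "u \<in> borel_measurable M" "\<And>n. h n \<in> borel_measurable M"
    and u2: "integrable M (\<lambda>x. (cmod (u x))\<^sup>2)"
    and h2: "\<And>n. integrable M (\<lambda>x. (cmod (h n x))\<^sup>2)"
    and C: "\<And>n. (\<integral>x. (cmod (h n x))\<^sup>2 \<partial>M) \<le> C"
    and lim: "AE x in M. (\<lambda>n. h n x) \<longlonglongrightarrow> 0"
  shows "(\<lambda>n. \<integral>x. u x * h n x \<partial>M) \<longlonglongrightarrow> 0"
proof (rule LIMSEQ_I)
  fix e :: real assume e: "0 < e"
  \<comment> \<open>With this choice (|C| + 1) / K = e / 2, which controls the second summand of the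
    pointwise bound; the added 1 keeps K positive.\<close>
  define K where "K = 2 * (\<bar>C\<bar> + 1) / e"
  have K: "K > 0" using e by (simp add: K_def)
  define m where "m n x = min (cmod (u x) * cmod (h n x)) (K * (cmod (u x))\<^sup>2)" for n x
  have [measurable]: "m n \<in> borel_measurable M" for n unfolding m_def by measurable
  have m0: "0 \<le> m n x" for n x using K by (simp add: m_def)
  have mi: "integrable M (m n)" for n
    by (rule Bochner_Integration.integrable_bound [OF integrable_mult_right [OF u2, of K]])
       (use m0 K in \<open>auto simp: m_def abs_mult\<close>)
  have "(\<lambda>n. \<integral>x. m n x \<partial>M) \<longlonglongrightarrow> (\<integral>x. 0 \<partial>M)"
  proof (rule integral_dominated_convergence [where w="\<lambda>x. K * (cmod (u x))\<^sup>2"])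
    show "integrable M (\<lambda>x. K * (cmod (u x))\<^sup>2)" using u2 by simp
    show "AE x in M. (\<lambda>n. m n x) \<longlonglongrightarrow> 0"
      using lim
    proof eventually_elim
      case (elim x)
      then have "(\<lambda>n. cmod (u x) * cmod (h n x)) \<longlonglongrightarrow> cmod (u x) * cmod 0"
        by (intro tendsto_intros)
      then have *: "(\<lambda>n. cmod (u x) * cmod (h n x)) \<longlonglongrightarrow> 0" by simp
      show ?case
        by (rule Lim_null_comparison [OF always_eventually *]) (use m0 in \<open>auto simp: m_def\<close>)
    qed
    show "AE x in M. norm (m n x) \<le> K * (cmod (u x))\<^sup>2" for n
      using K by (auto simp: m_def)
  qed auto
  then have "(\<lambda>n. \<integral>x. m n x \<partial>M) \<longlonglongrightarrow> 0" by simp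
  then obtain N where N: "\<And>n. n \<ge> N \<Longrightarrow> (\<integral>x. m n x \<partial>M) < e / 2"
    using e by (metis (no_types, lifting) LIMSEQ_D abs_less_iff diff_zero half_gt_zero real_norm_def)
  have pw: "cmod (u x * h n x) \<le> m n x + (cmod (h n x))\<^sup>2 / K" for n x
  proof (cases "cmod (h n x) \<le> K * cmod (u x)")
    case True
    then have "cmod (u x) * cmod (h n x) \<le> cmod (u x) * (K * cmod (u x))"
      by (intro mult_left_mono) auto
    then show ?thesis using K by (simp add: m_def norm_mult power2_eq_square algebra_simps)
  next
    case False
    then have "cmod (u x) * K * cmod (h n x) \<le> cmod (h n x) * cmod (h n x)"
      by (intro mult_right_mono) (auto simp: algebra_simps)
    then have "cmod (u x) * cmod (h n x) \<le> (cmod (h n x))\<^sup>2 / K"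
      using K by (simp add: field_simps power2_eq_square)
    then show ?thesis using m0[of n x] by (simp add: norm_mult)
  qed
  show "\<exists>no. \<forall>n\<ge>no. norm ((\<integral>x. u x * h n x \<partial>M) - 0) < e"
  proof (intro exI allI impI)
    fix n assume n: "n \<ge> N"
    have i: "integrable M (\<lambda>x. m n x + (cmod (h n x))\<^sup>2 / K)" using mi h2 by auto
    have ui: "integrable M (\<lambda>x. u x * h n x)"
      by (rule Bochner_Integration.integrable_bound [OF i]) (use pw in \<open>auto intro!: AE_I2 order_trans [OF pw abs_ge_self]\<close>)
    have "cmod (\<integral>x. u x * h n x \<partial>M) \<le> (\<integral>x. cmod (u x * h n x) \<partial>M)"
      by (rule integral_norm_bound)
    also have "\<dots> \<le> (\<integral>x. m n x + (cmod (h n x))\<^sup>2 / K \<partial>M)"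
      using ui i pw by (intro integral_mono) auto
    also have "\<dots> = (\<integral>x. m n x \<partial>M) + (\<integral>x. (cmod (h n x))\<^sup>2 \<partial>M) / K"
      using mi h2 by simp
    also have "\<dots> < e / 2 + C / K"
      using N[OF n] C[of n] K by (intro add_less_le_mono divide_right_mono) auto
    also have "C / K \<le> e / 2"
    proof -
      have "C / K \<le> (\<bar>C\<bar> + 1) / K" using K by (intro divide_right_mono) auto
      also have "\<dots> = e / 2" using e by (simp add: K_def field_simps)
      finally show ?thesis .
    qed
    finally show "norm ((\<integral>x. u x * h n x \<partial>M) - 0) < e" by simp
  qed
qed

text \<open>Fatou's lemma for the squared moduli, whose liminf is the squared modulus of the
  limit.\<close>

lemma L2_bounded_AE_limit:
  fixes h :: "nat \<Rightarrow> 'a \<Rightarrow> complex" and g :: "'a \<Rightarrow> complex"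
  assumes [measurable]: "g \<in> borel_measurable M" "\<And>n. h n \<in> borel_measurable M"
    and h2: "\<And>n. integrable M (\<lambda>x. (cmod (h n x))\<^sup>2)"
    and C: "\<And>n. (\<integral>x. (cmod (h n x))\<^sup>2 \<partial>M) \<le> C"
    and lim: "AE x in M. (\<lambda>n. h n x) \<longlonglongrightarrow> g x"
  shows "integrable M (\<lambda>x. (cmod (g x))\<^sup>2)" and "(\<integral>x. (cmod (g x))\<^sup>2 \<partial>M) \<le> C"
proof -
  have C0: "0 \<le> C"
    using order_trans[OF Bochner_Integration.integral_nonneg C[of 0]] by simp
  have "(\<integral>\<^sup>+x. ennreal ((cmod (g x))\<^sup>2) \<partial>M) = (\<integral>\<^sup>+x. liminf (\<lambda>n. ennreal ((cmod (h n x))\<^sup>2)) \<partial>M)"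
    using lim
  proof (intro nn_integral_cong_AE, eventually_elim)
    case (elim x)
    then have "(\<lambda>n. ennreal ((cmod (h n x))\<^sup>2)) \<longlonglongrightarrow> ennreal ((cmod (g x))\<^sup>2)"
      by (intro tendsto_intros)
    from lim_imp_Liminf [OF sequentially_bot this] show ?case by simp
  qed
  also have "\<dots> \<le> liminf (\<lambda>n. \<integral>\<^sup>+x. ennreal ((cmod (h n x))\<^sup>2) \<partial>M)"
    by (rule nn_integral_liminf) auto
  also have "\<dots> \<le> ennreal C"
  proof (rule Liminf_le)
    show "\<forall>\<^sub>F n in sequentially. (\<integral>\<^sup>+x. ennreal ((cmod (h n x))\<^sup>2) \<partial>M) \<le> ennreal C"
      using C C0 by (intro always_eventually allI, subst nn_integral_eq_integral[OF h2])
        (auto intro: ennreal_leI)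
  qed simp
  finally have *: "(\<integral>\<^sup>+x. ennreal ((cmod (g x))\<^sup>2) \<partial>M) \<le> ennreal C" .
  show i: "integrable M (\<lambda>x. (cmod (g x))\<^sup>2)"
    using le_less_trans[OF *, of top] by (intro integrableI_bounded) auto
  show "(\<integral>x. (cmod (g x))\<^sup>2 \<partial>M) \<le> C"
    using * C0 by (subst (asm) nn_integral_eq_integral[OF i]) auto
qed

lemma integrable_mult_L2:
  fixes u v :: "'a \<Rightarrow> complex"
  assumes [measurable]: "u \<in> borel_measurable M" "v \<in> borel_measurable M"
    and "integrable M (\<lambda>x. (cmod (u x))\<^sup>2)" "integrable M (\<lambda>x. (cmod (v x))\<^sup>2)"
  shows "integrable M (\<lambda>x. u x * v x)"
proof (rule Bochner_Integration.integrable_bound)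
  show "integrable M (\<lambda>x. (cmod (u x))\<^sup>2 + (cmod (v x))\<^sup>2)" using assms by auto
  have "a * b \<le> a\<^sup>2 + b\<^sup>2" if "0 \<le> a" "0 \<le> b" for a b :: real
  proof -
    have "2 * a * b \<le> a\<^sup>2 + b\<^sup>2" by (rule sum_squares_bound)
    moreover have "0 \<le> a * b" using that by simp
    ultimately show ?thesis by linarith
  qed
  then show "AE x in M. norm (u x * v x) \<le> norm ((cmod (u x))\<^sup>2 + (cmod (v x))\<^sup>2)"
    by (auto simp: norm_mult)
qed auto

text \<open>A fixed sequence of radii tending to 1, so that the sequential convergence theorems of
  integration apply to radial limits. The shift by 2 keeps every radius strictly between 0 and
  1.\<close>

definition rad :: "nat \<Rightarrow> real" where
  "rad n = 1 - 1 / real (n + 2)"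

lemma rad_bounds [simp]: "0 < rad n" "rad n < 1" "0 \<le> rad n" "rad n \<le> 1"
  by (auto simp: rad_def field_simps)

lemma rad_tendsto: "rad \<longlonglongrightarrow> 1"
proof -
  have "(\<lambda>n. 1 - 1 / real (n + 2)) \<longlonglongrightarrow> 1 - 0"
    by (intro tendsto_diff tendsto_const LIMSEQ_ignore_initial_segment [OF lim_1_over_n])
  then show ?thesis by (simp add: rad_def [abs_def])
qed

lemma rad_at_left: "filterlim rad (at_left 1) sequentially"
  using rad_tendsto by (auto simp: filterlim_at intro!: always_eventually less_imp_neq)

lemma has_radial_limit_rad:
  "has_radial_limit f \<zeta> w \<Longrightarrow> (\<lambda>n. f (of_real (rad n) * \<zeta>)) \<longlonglongrightarrow> w"
  unfolding has_radial_limit_def by (rule filterlim_compose [OF _ rad_at_left])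

lemma continuous_on_circle_holomorphic:
  assumes "f holomorphic_on ball 0 1" "0 \<le> r" "r < 1"
  shows "continuous_on A (\<lambda>t. f (of_real r * cis t))"
proof -
  have "continuous_on (ball 0 1) f" using assms(1) holomorphic_on_imp_continuous_on by blast
  then show ?thesis
    by (rule continuous_on_compose2 [where g = f])
       (use assms in \<open>auto intro!: continuous_intros simp: norm_mult\<close>)
qed

lemma measurable_circ_AE_limit:
  fixes h :: "nat \<Rightarrow> real \<Rightarrow> complex"
  assumes [measurable]: "\<And>n. h n \<in> borel_measurable circ" and lim: "AE t in circ. (\<lambda>n. h n t) \<longlonglongrightarrow> g t"
  shows "g \<in> borel_measurable circ"
proof -
  define g' where "g' t = lim (\<lambda>n. h n t)" for t
  have "g' \<in> borel_measurable circ" unfolding g'_def by (rule borel_measurable_lim_metric) simp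
  moreover have "AE t in circ. g' t = g t"
    using lim by eventually_elim (simp add: g'_def limI)
  ultimately show ?thesis by (rule borel_measurable_circ_AE_cong)
qed

lemma measurable_circ_radial_limit:
  assumes "f holomorphic_on ball 0 1" "ae_circle (\<lambda>\<zeta>. has_radial_limit f \<zeta> (g \<zeta>))"
  shows "(\<lambda>t. g (cis t)) \<in> borel_measurable circ"
proof (rule measurable_circ_AE_limit)
  show "(\<lambda>t. f (of_real (rad n) * cis t)) \<in> borel_measurable circ" for n
    by (intro measurable_circ_continuous continuous_on_circle_holomorphic assms(1)) auto
  show "AE t in circ. (\<lambda>n. f (of_real (rad n) * cis t)) \<longlonglongrightarrow> g (cis t)"
    using assms(2) unfolding ae_circle_def by eventually_elim (rule has_radial_limit_rad)
qed

text \<open>\<open>H2_circle\<close> hides the analytic extension behind an existential quantifier.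
  The relation keeps it next to a chosen representative of its boundary values, so that values
  inside the disc remain accessible.\<close>

definition H2_bv :: "(complex \<Rightarrow> complex) \<Rightarrow> (complex \<Rightarrow> complex) \<Rightarrow> bool" where
  "H2_bv f g \<longleftrightarrow> f \<in> H2_disc \<and> ae_circle (\<lambda>\<zeta>. has_radial_limit f \<zeta> (g \<zeta>))"

section \<open>Membership in the Hardy space of the disc\<close>

lemma H2_circle_iff: "g \<in> H2_circle \<longleftrightarrow> (\<exists>f. H2_bv f g)"
  by (auto simp: H2_circle_def H2_bv_def)

text \<open>The slices are continuous, so the gauge and Lebesgue integrals agree, and the factor 2
  pi is absorbed into the constant.\<close>

lemma H2_disc_iff:
  "f \<in> H2_disc \<longleftrightarrow> f holomorphic_on ball 0 1 \<and>
     (\<exists>C. \<forall>r. 0 \<le> r \<longrightarrow> r < 1 \<longrightarrow> (\<integral>t. (cmod (f (of_real r * cis t)))\<^sup>2 \<partial>circ) \<le> C)"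
  (is "_ \<longleftrightarrow> _ \<and> (\<exists>C. ?P C)")
proof (cases "f holomorphic_on ball 0 1")
  case True
  have eq: "integral {0..2*pi} (\<lambda>t. (cmod (f (of_real r * cis t)))\<^sup>2) = (\<integral>t. (cmod (f (of_real r * cis t)))\<^sup>2 \<partial>circ)"
    if "0 \<le> r" "r < 1" for r
    using that True
    by (intro integral_circ_continuous [symmetric] continuous_intros continuous_on_circle_holomorphic)
  have "f \<in> H2_disc \<longleftrightarrow>
      (\<exists>C. \<forall>r. 0 \<le> r \<longrightarrow> r < 1 \<longrightarrow> 1 / (2*pi) * (\<integral>t. (cmod (f (of_real r * cis t)))\<^sup>2 \<partial>circ) \<le> C)"
    using True unfolding H2_disc_def bdd_above_def by (auto simp: eq intro!: ex_cong1)
  also have "\<dots> \<longleftrightarrow> (\<exists>C. ?P C)"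
  proof safe
    fix C assume *: "\<forall>r. 0 \<le> r \<longrightarrow> r < 1 \<longrightarrow> 1 / (2*pi) * (\<integral>t. (cmod (f (of_real r * cis t)))\<^sup>2 \<partial>circ) \<le> C"
    show "\<exists>C. ?P C"
      by (rule exI[of _ "C * (2*pi)"]) (use * in \<open>auto simp: field_simps\<close>)
  next
    fix C assume *: "?P C"
    show "\<exists>C. \<forall>r. 0 \<le> r \<longrightarrow> r < 1 \<longrightarrow> 1 / (2*pi) * (\<integral>t. (cmod (f (of_real r * cis t)))\<^sup>2 \<partial>circ) \<le> C"
      by (rule exI[of _ "C / (2*pi)"]) (use * in \<open>auto simp: field_simps\<close>)
  qed
  finally show ?thesis using True by simp
qed (auto simp: H2_disc_def)

lemma H2_disc_holomorphic: "f \<in> H2_disc \<Longrightarrow> f holomorphic_on ball 0 1"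
  by (simp add: H2_disc_def)

lemma integrable_circle_norm2:
  assumes "f holomorphic_on ball 0 1" "0 \<le> r" "r < 1"
  shows "integrable circ (\<lambda>t. (cmod (f (of_real r * cis t)))\<^sup>2)"
  using assms by (intro integrable_circ_continuous continuous_intros continuous_on_circle_holomorphic)

lemma H2_disc_const: "(\<lambda>_. c) \<in> H2_disc"
  unfolding H2_disc_iff by (auto intro!: exI[of _ "2 * pi * (cmod c)\<^sup>2"] simp: space_restrict_space)

text \<open>Integrating the pointwise bound over each circle bounds the means. This one comparison
  covers bounded functions, bounded multiples and division by z.\<close>

lemma H2_discI_dominated:
  assumes "f \<in> H2_disc" "h holomorphic_on ball 0 1" "0 \<le> B"
    and le: "\<And>z. cmod z < 1 \<Longrightarrow> (cmod (h z))\<^sup>2 \<le> A + B * (cmod (f z))\<^sup>2"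
  shows "h \<in> H2_disc"
proof -
  obtain C where C: "\<And>r. 0 \<le> r \<Longrightarrow> r < 1 \<Longrightarrow> (\<integral>t. (cmod (f (of_real r * cis t)))\<^sup>2 \<partial>circ) \<le> C"
    and f: "f holomorphic_on ball 0 1"
    using assms(1) unfolding H2_disc_iff by blast
  have "(\<integral>t. (cmod (h (of_real r * cis t)))\<^sup>2 \<partial>circ) \<le> 2 * pi * A + B * C" if r: "0 \<le> r" "r < 1" for r
  proof -
    have "(\<integral>t. (cmod (h (of_real r * cis t)))\<^sup>2 \<partial>circ) \<le> (\<integral>t. A + B * (cmod (f (of_real r * cis t)))\<^sup>2 \<partial>circ)"
    proof (intro integral_mono)
      show "(cmod (h (of_real r * cis t)))\<^sup>2 \<le> A + B * (cmod (f (of_real r * cis t)))\<^sup>2" for t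
        using r by (intro le) (simp add: norm_mult)
    qed (use integrable_circle_norm2 r f assms(2) in auto)
    also have "\<dots> = 2 * pi * A + B * (\<integral>t. (cmod (f (of_real r * cis t)))\<^sup>2 \<partial>circ)"
      using integrable_circle_norm2[OF f r] by (simp add: space_restrict_space)
    also have "\<dots> \<le> 2 * pi * A + B * C" using C[OF r] \<open>0 \<le> B\<close> by (intro add_left_mono mult_left_mono) auto
    finally show ?thesis .
  qed
  then show ?thesis using assms(2) by (auto simp: H2_disc_iff)
qed

lemma H2_disc_bounded:
  assumes "h holomorphic_on ball 0 1" "\<And>z. cmod z < 1 \<Longrightarrow> cmod (h z) \<le> B"
  shows "h \<in> H2_disc"
  by (rule H2_discI_dominated [OF H2_disc_const [of 0] assms(1), of 0 "B\<^sup>2"])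
     (use assms in \<open>auto intro: power_mono\<close>)

lemma H2_disc_mult_bounded:
  assumes "f \<in> H2_disc" "h holomorphic_on ball 0 1" "\<And>z. cmod z < 1 \<Longrightarrow> cmod (h z) \<le> B"
  shows "(\<lambda>z. h z * f z) \<in> H2_disc"
  by (rule H2_discI_dominated [OF assms(1), of _ "B\<^sup>2" 0])
     (use assms H2_disc_holomorphic in \<open>auto intro!: holomorphic_intros mult_right_mono power_mono simp: norm_mult power_mult_distrib\<close>)

lemma H2_disc_add:
  assumes "f \<in> H2_disc" "h \<in> H2_disc"
  shows "(\<lambda>z. f z + h z) \<in> H2_disc"
proof -
  obtain C where C: "\<And>r. 0 \<le> r \<Longrightarrow> r < 1 \<Longrightarrow> (\<integral>t. (cmod (f (of_real r * cis t)))\<^sup>2 \<partial>circ) \<le> C"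
    and f: "f holomorphic_on ball 0 1"
    using assms(1) unfolding H2_disc_iff by blast
  obtain D where D: "\<And>r. 0 \<le> r \<Longrightarrow> r < 1 \<Longrightarrow> (\<integral>t. (cmod (h (of_real r * cis t)))\<^sup>2 \<partial>circ) \<le> D"
    and h: "h holomorphic_on ball 0 1"
    using assms(2) unfolding H2_disc_iff by blast
  have fh: "(\<lambda>z. f z + h z) holomorphic_on ball 0 1" using f h by (intro holomorphic_intros)
  have "(\<integral>t. (cmod (f (of_real r * cis t) + h (of_real r * cis t)))\<^sup>2 \<partial>circ) \<le> 2 * C + 2 * D"
    if r: "0 \<le> r" "r < 1" for r
  proof -
    have le: "(cmod (a + b))\<^sup>2 \<le> 2 * (cmod a)\<^sup>2 + 2 * (cmod b)\<^sup>2" for a b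
    proof -
      have "(cmod (a + b))\<^sup>2 \<le> (cmod a + cmod b)\<^sup>2" by (intro power_mono norm_triangle_ineq) auto
      also have "\<dots> \<le> 2 * (cmod a)\<^sup>2 + 2 * (cmod b)\<^sup>2"
        using sum_squares_bound[of "cmod a" "cmod b"] by (simp add: power2_sum)
      finally show ?thesis .
    qed
    have "(\<integral>t. (cmod (f (of_real r * cis t) + h (of_real r * cis t)))\<^sup>2 \<partial>circ)
       \<le> (\<integral>t. 2 * (cmod (f (of_real r * cis t)))\<^sup>2 + 2 * (cmod (h (of_real r * cis t)))\<^sup>2 \<partial>circ)"
      using integrable_circle_norm2[OF fh r] integrable_circle_norm2[OF f r] integrable_circle_norm2[OF h r] le
      by (intro integral_mono) auto
    also have "\<dots> = 2 * (\<integral>t. (cmod (f (of_real r * cis t)))\<^sup>2 \<partial>circ) + 2 * (\<integral>t. (cmod (h (of_real r * cis t)))\<^sup>2 \<partial>circ)"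
      using integrable_circle_norm2[OF f r] integrable_circle_norm2[OF h r] by simp
    also have "\<dots> \<le> 2 * C + 2 * D" using C[OF r] D[OF r] by simp
    finally show ?thesis .
  qed
  then show ?thesis using fh by (auto simp: H2_disc_iff)
qed

subsection \<open>Boundary values of Hardy functions\<close>

lemma cis_nonzero: "cis t \<noteq> 0"
  using norm_cis[of t] by force

lemma cis_minus_eq_divide: "cis (-t) = 1 / cis t"
  by (simp add: divide_inverse)

lemma divide_ii_mult_ii: "x / \<i> * (a * \<i> * b) = x * a * b"
proof -
  have "x / \<i> * (a * \<i> * b) = (\<i> / \<i>) * (x * a * b)" by (simp only: times_divide_eq_left times_divide_eq_right mult_ac)
  then show ?thesis by simp
qed

lemma has_integral_circlepath_iff:
  "(F has_contour_integral I) (circlepath 0 r) \<longleftrightarrow>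
     ((\<lambda>t. F (of_real r * cis t) * of_real r * \<i> * cis t) has_integral I) {0..2*pi}"
  unfolding circlepath_def using has_contour_integral_part_circlepath_iff[of 0 "2*pi" F I 0 r] by simp

text \<open>Cauchy's formula for the nth derivative, parametrised by t: the Fourier coefficients of
  the slice of radius r are r^n times the Taylor coefficients at 0.\<close>

lemma integral_circ_cauchy_deriv:
  fixes f :: "complex \<Rightarrow> complex"
  assumes f: "f holomorphic_on ball 0 1" and r: "0 < r" "r < 1"
  shows "(\<integral>t. f (of_real r * cis t) * cis (-t) ^ n \<partial>circ) = 2 * pi * (of_real r ^ n * ((deriv ^^ n) f 0 / fact n))"
proof -
  have "continuous_on (cball 0 r) f"
    by (intro holomorphic_on_imp_continuous_on holomorphic_on_subset [OF f]) (use r in auto)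
  moreover have "f holomorphic_on ball 0 r"
    by (rule holomorphic_on_subset [OF f]) (use r in auto)
  ultimately have "((\<lambda>u. f u / (u - 0) ^ Suc n) has_contour_integral ((2 * pi * \<i>) / fact n * (deriv ^^ n) f 0)) (circlepath 0 r)"
    by (rule Cauchy_has_contour_integral_higher_derivative_circlepath) (use r in auto)
  then have "((\<lambda>t. f (of_real r * cis t) / (of_real r * cis t) ^ Suc n * of_real r * \<i> * cis t)
      has_integral ((2 * pi * \<i>) / fact n * (deriv ^^ n) f 0)) {0..2*pi}"
    by (simp add: has_integral_circlepath_iff)
  from has_integral_mult_right[OF this, of "of_real r ^ n / \<i>"]
  have "((\<lambda>t. of_real r ^ n / \<i> * (f (of_real r * cis t) / (of_real r * cis t) ^ Suc n * of_real r * \<i> * cis t))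
      has_integral (2 * pi * (of_real r ^ n * ((deriv ^^ n) f 0 / fact n)))) {0..2*pi}"
    by (rule has_integral_eq_rhs) (simp add: field_simps)
  also have "(\<lambda>t. of_real r ^ n / \<i> * (f (of_real r * cis t) / (of_real r * cis t) ^ Suc n * of_real r * \<i> * cis t))
     = (\<lambda>t. f (of_real r * cis t) * cis (-t) ^ n)"
    unfolding cis_minus_eq_divide divide_ii_mult_ii using r cis_nonzero
    by (intro ext) (simp add: power_mult_distrib power_divide del: cis_divide cis_inverse)
  finally have *: "((\<lambda>t. f (of_real r * cis t) * cis (-t) ^ n) has_integral
      (2 * pi * (of_real r ^ n * ((deriv ^^ n) f 0 / fact n)))) {0..2*pi}" .
  have "(\<integral>t. f (of_real r * cis t) * cis (-t) ^ n \<partial>circ) = integral {0..2*pi} (\<lambda>t. f (of_real r * cis t) * cis (-t) ^ n)"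
    using f r by (intro integral_circ_continuous continuous_intros continuous_on_circle_holomorphic) auto
  then show ?thesis using integral_unique[OF *] by simp
qed

lemma one_minus_mult_cnj_cis_nonzero: "cmod z < 1 \<Longrightarrow> 1 - z * cis s \<noteq> 0"
  by (metis eq_iff_diff_eq_0 less_irrefl mult.right_neutral norm_cis norm_mult norm_one)

text \<open>Cauchy's formula on the circle of radius r, evaluated at r z instead of z. The scaling
  makes the kernel independent of r, so r can later tend to 1 against a fixed test function.\<close>

lemma integral_circ_cauchy:
  fixes f :: "complex \<Rightarrow> complex"
  assumes f: "f holomorphic_on ball 0 1" and r: "0 < r" "r < 1" and z: "cmod z < 1"
  shows "(\<integral>t. 1 / (1 - z * cis (-t)) * f (of_real r * cis t) \<partial>circ) = 2 * pi * f (of_real r * z)"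
proof -
  have "continuous_on (cball 0 r) f"
    by (intro holomorphic_on_imp_continuous_on holomorphic_on_subset [OF f]) (use r in auto)
  moreover have "f holomorphic_on ball 0 r"
    by (rule holomorphic_on_subset [OF f]) (use r in auto)
  ultimately have "((\<lambda>u. f u / (u - of_real r * z)) has_contour_integral (2 * of_real pi * \<i> * f (of_real r * z))) (circlepath 0 r)"
    by (rule Cauchy_integral_circlepath) (use r z in \<open>auto simp: norm_mult\<close>)
  then have "((\<lambda>t. f (of_real r * cis t) / (of_real r * cis t - of_real r * z) * of_real r * \<i> * cis t)
      has_integral (2 * pi * \<i> * f (of_real r * z))) {0..2*pi}"
    by (simp add: has_integral_circlepath_iff)
  from has_integral_mult_right[OF this, of "1 / \<i>"]
  have "((\<lambda>t. 1 / \<i> * (f (of_real r * cis t) / (of_real r * cis t - of_real r * z) * of_real r * \<i> * cis t))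
      has_integral (2 * pi * f (of_real r * z))) {0..2*pi}"
    by (rule has_integral_eq_rhs) (simp add: field_simps)
  also have "(\<lambda>t. 1 / \<i> * (f (of_real r * cis t) / (of_real r * cis t - of_real r * z) * of_real r * \<i> * cis t))
     = (\<lambda>t. 1 / (1 - z * cis (-t)) * f (of_real r * cis t))"
  proof
    fix t
    have "of_real r * cis t - of_real r * z = of_real r * cis t * (1 - z * cis (-t))"
      unfolding cis_minus_eq_divide using cis_nonzero[of t] by (simp add: field_simps del: cis_divide cis_inverse)
    then show "1 / \<i> * (f (of_real r * cis t) / (of_real r * cis t - of_real r * z) * of_real r * \<i> * cis t)
      = 1 / (1 - z * cis (-t)) * f (of_real r * cis t)"
      unfolding divide_ii_mult_ii using r cis_nonzero[of t] by simp
  qed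
  finally have *: "((\<lambda>t. 1 / (1 - z * cis (-t)) * f (of_real r * cis t)) has_integral (2 * pi * f (of_real r * z))) {0..2*pi}" .
  have "(\<integral>t. 1 / (1 - z * cis (-t)) * f (of_real r * cis t) \<partial>circ) = integral {0..2*pi} (\<lambda>t. 1 / (1 - z * cis (-t)) * f (of_real r * cis t))"
    using f r one_minus_mult_cnj_cis_nonzero[OF z]
    by (intro integral_circ_continuous continuous_intros continuous_on_circle_holomorphic) auto
  then show ?thesis using integral_unique[OF *] by simp
qed

lemma H2_bv_measurable: "H2_bv f g \<Longrightarrow> (\<lambda>t. g (cis t)) \<in> borel_measurable circ"
  unfolding H2_bv_def using H2_disc_holomorphic measurable_circ_radial_limit by blast

text \<open>The slices at the radii \<open>rad n\<close> are bounded in L^2 and converge almost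
  everywhere to g. Fatou puts g into L^2; the differences stay bounded in L^2 and tend to 0 almost
  everywhere, hence weakly. Weak convergence is all that the integral formulas below
  require.\<close>

lemma
  assumes "H2_bv f g"
  shows H2_bv_square_integrable: "integrable circ (\<lambda>t. (cmod (g (cis t)))\<^sup>2)"
    and H2_bv_integral_tendsto: "\<And>u :: real \<Rightarrow> complex. u \<in> borel_measurable circ \<Longrightarrow> integrable circ (\<lambda>t. (cmod (u t))\<^sup>2) \<Longrightarrow>
      (\<lambda>n. \<integral>t. u t * f (of_real (rad n) * cis t) \<partial>circ) \<longlonglongrightarrow> (\<integral>t. u t * g (cis t) \<partial>circ)"
proof -
  obtain C where f: "f holomorphic_on ball 0 1"
    and C: "\<And>r. 0 \<le> r \<Longrightarrow> r < 1 \<Longrightarrow> (\<integral>t. (cmod (f (of_real r * cis t)))\<^sup>2 \<partial>circ) \<le> C"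
    using assms unfolding H2_bv_def H2_disc_iff by blast
  have [measurable]: "(\<lambda>t. g (cis t)) \<in> borel_measurable circ" by (rule H2_bv_measurable [OF assms])
  have fm [measurable]: "(\<lambda>t. f (of_real (rad n) * cis t)) \<in> borel_measurable circ" for n
    by (intro measurable_circ_continuous continuous_on_circle_holomorphic f) auto
  have lim: "AE t in circ. (\<lambda>n. f (of_real (rad n) * cis t)) \<longlonglongrightarrow> g (cis t)"
    using conjunct2 [OF assms [unfolded H2_bv_def ae_circle_def]] by eventually_elim (rule has_radial_limit_rad)
  have fi: "integrable circ (\<lambda>t. (cmod (f (of_real (rad n) * cis t)))\<^sup>2)" for n
    by (rule integrable_circle_norm2 [OF f]) auto
  have Cn: "(\<integral>t. (cmod (f (of_real (rad n) * cis t)))\<^sup>2 \<partial>circ) \<le> C" for n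
    by (rule C) auto
  show gi: "integrable circ (\<lambda>t. (cmod (g (cis t)))\<^sup>2)"
    by (rule L2_bounded_AE_limit [OF _ fm fi Cn lim]) measurable
  have gC: "(\<integral>t. (cmod (g (cis t)))\<^sup>2 \<partial>circ) \<le> C"
    by (rule L2_bounded_AE_limit [OF _ fm fi Cn lim]) measurable
  fix u :: "real \<Rightarrow> complex"
  assume u [measurable]: "u \<in> borel_measurable circ" and u2: "integrable circ (\<lambda>t. (cmod (u t))\<^sup>2)"
  define h where "h n t = f (of_real (rad n) * cis t) - g (cis t)" for n t
  have [measurable]: "h n \<in> borel_measurable circ" for n unfolding h_def by measurable
  have le: "(cmod (h n t))\<^sup>2 \<le> 2 * (cmod (f (of_real (rad n) * cis t)))\<^sup>2 + 2 * (cmod (g (cis t)))\<^sup>2" for n t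
  proof -
    have "(cmod (a - b))\<^sup>2 \<le> 2 * (cmod a)\<^sup>2 + 2 * (cmod b)\<^sup>2" for a b
    proof -
      have "(cmod (a - b))\<^sup>2 \<le> (cmod a + cmod b)\<^sup>2" by (intro power_mono norm_triangle_ineq4) auto
      also have "\<dots> \<le> 2 * (cmod a)\<^sup>2 + 2 * (cmod b)\<^sup>2"
        using sum_squares_bound[of "cmod a" "cmod b"] by (simp add: power2_sum)
      finally show ?thesis .
    qed
    then show ?thesis by (simp add: h_def)
  qed
  have i2: "integrable circ (\<lambda>t. 2 * (cmod (f (of_real (rad n) * cis t)))\<^sup>2 + 2 * (cmod (g (cis t)))\<^sup>2)" for n
    using fi gi by auto
  have hi: "integrable circ (\<lambda>t. (cmod (h n t))\<^sup>2)" for n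
    by (rule Bochner_Integration.integrable_bound [OF i2[of n]]) (use le in \<open>auto intro!: AE_I2 order_trans [OF le abs_ge_self]\<close>)
  have "(\<lambda>n. \<integral>t. u t * h n t \<partial>circ) \<longlonglongrightarrow> 0"
  proof (rule tendsto_integral_mult_of_AE_of_L2_bounded [where C="2 * C + 2 * C"])
    fix n
    have "(\<integral>t. (cmod (h n t))\<^sup>2 \<partial>circ) \<le> (\<integral>t. 2 * (cmod (f (of_real (rad n) * cis t)))\<^sup>2 + 2 * (cmod (g (cis t)))\<^sup>2 \<partial>circ)"
      using hi i2 le by (intro integral_mono) auto
    also have "\<dots> \<le> 2 * C + 2 * C" using fi gi Cn[of n] gC by simp
    finally show "(\<integral>t. (cmod (h n t))\<^sup>2 \<partial>circ) \<le> 2 * C + 2 * C" .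
  next
    show "AE t in circ. (\<lambda>n. h n t) \<longlonglongrightarrow> 0"
      using lim by eventually_elim (simp add: h_def LIM_zero)
  qed (use u2 hi in auto)
  moreover have "(\<integral>t. u t * h n t \<partial>circ) = (\<integral>t. u t * f (of_real (rad n) * cis t) \<partial>circ) - (\<integral>t. u t * g (cis t) \<partial>circ)" for n
    unfolding h_def right_diff_distrib
    by (intro Bochner_Integration.integral_diff integrable_mult_L2 u2 fi gi) measurable
  ultimately show "(\<lambda>n. \<integral>t. u t * f (of_real (rad n) * cis t) \<partial>circ) \<longlonglongrightarrow> (\<integral>t. u t * g (cis t) \<partial>circ)"
    by (simp add: LIM_zero_iff)
qed

lemma cmod_one_minus_mult_ge: "cmod w = 1 \<Longrightarrow> cmod (1 - z * w) \<ge> 1 - cmod z"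
  using norm_triangle_ineq2[of 1 "z * w"] by (simp add: norm_mult)

text \<open>The limit of the scaled Cauchy formula as the radius tends to 1: the left side converges
  weakly because the kernel is in L^2, the right side because f is continuous at z.\<close>

lemma H2_bv_cauchy:
  fixes f :: "complex \<Rightarrow> complex"
  assumes "H2_bv f g" "cmod z < 1"
  shows "(\<integral>t. 1 / (1 - z * cis (-t)) * g (cis t) \<partial>circ) = 2 * pi * f z"
proof -
  have f: "f holomorphic_on ball 0 1" using assms(1) H2_disc_holomorphic by (auto simp: H2_bv_def)
  have c: "continuous_on {0..2*pi} (\<lambda>t. 1 / (1 - z * cis (-t)))"
    using one_minus_mult_cnj_cis_nonzero[OF assms(2)] by (intro continuous_intros) auto
  have *: "(\<lambda>n. \<integral>t. 1 / (1 - z * cis (-t)) * f (of_real (rad n) * cis t) \<partial>circ)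
     \<longlonglongrightarrow> (\<integral>t. 1 / (1 - z * cis (-t)) * g (cis t) \<partial>circ)"
    by (intro H2_bv_integral_tendsto assms(1) measurable_circ_continuous integrable_circ_continuous c
          continuous_on_power continuous_on_norm)
  have **: "(\<lambda>n. 2 * pi * f (of_real (rad n) * z)) \<longlonglongrightarrow> 2 * pi * f (of_real 1 * z)"
  proof -
    have "isCont f z" using f assms(2) holomorphic_on_imp_continuous_on continuous_on_interior[of "ball 0 1"] by force
    then show ?thesis using rad_tendsto
      by (intro tendsto_intros isCont_tendsto_compose[where g=f]) (auto intro!: tendsto_eq_intros)
  qed
  show ?thesis
    using LIMSEQ_unique [OF * [unfolded integral_circ_cauchy [OF f rad_bounds(1,2) assms(2)]] **] by simp
qed

lemma borel_measurable_cnj [measurable]: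
  "f \<in> borel_measurable M \<Longrightarrow> (\<lambda>x. cnj (f x)) \<in> borel_measurable M"
  by (rule measurable_compose [OF _ borel_measurable_continuous_onI]) (auto intro: continuous_intros)

lemma integral_mult_cong_AE:
  fixes e g k :: "'a \<Rightarrow> complex"
  assumes [measurable]: "e \<in> borel_measurable M" "g \<in> borel_measurable M" "k \<in> borel_measurable M"
    and ae: "AE x in M. g x = k x"
  shows "(\<integral>x. e x * g x \<partial>M) = (\<integral>x. e x * k x \<partial>M)"
  by (rule integral_cong_AE, measurable) (use ae in \<open>eventually_elim, simp\<close>)

text \<open>Both functions are the Cauchy integral of the same boundary function.\<close>

lemma H2_bv_unique:
  assumes "H2_bv f g" "H2_bv h k" "ae_circle (\<lambda>\<zeta>. g \<zeta> = k \<zeta>)" "cmod z < 1"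
  shows "f z = h z"
proof -
  have c: "(\<lambda>t. 1 / (1 - z * cis (-t))) \<in> borel_measurable circ"
    using one_minus_mult_cnj_cis_nonzero[OF assms(4)]
    by (intro measurable_circ_continuous continuous_intros) auto
  have "(\<integral>t. 1 / (1 - z * cis (-t)) * g (cis t) \<partial>circ) = (\<integral>t. 1 / (1 - z * cis (-t)) * k (cis t) \<partial>circ)"
    using assms(3) unfolding ae_circle_def
    by (intro integral_mult_cong_AE c H2_bv_measurable[OF assms(1)] H2_bv_measurable[OF assms(2)])
  then show ?thesis
    using H2_bv_cauchy[OF assms(1,4)] H2_bv_cauchy[OF assms(2,4)] by simp
qed

section \<open>Almost everywhere reasoning and bounded multipliers\<close>

lemma ae_circle_mono:
  "ae_circle P \<Longrightarrow> (\<And>t. P (cis t) \<Longrightarrow> Q (cis t)) \<Longrightarrow> ae_circle Q"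
  unfolding ae_circle_def by (rule AE_mp, assumption) (auto intro!: AE_I2)

lemma ae_circle_mono2:
  "ae_circle P \<Longrightarrow> ae_circle Q \<Longrightarrow> (\<And>t. P (cis t) \<Longrightarrow> Q (cis t) \<Longrightarrow> R (cis t)) \<Longrightarrow> ae_circle R"
  unfolding ae_circle_def by (rule AE_mp, assumption, rule AE_mp, assumption) (auto intro!: AE_I2)

lemma H2_bv_cong: "H2_bv f g \<Longrightarrow> ae_circle (\<lambda>\<zeta>. g \<zeta> = k \<zeta>) \<Longrightarrow> H2_bv f k"
  unfolding H2_bv_def by (auto elim: ae_circle_mono2)

lemma H2_bv_add: "H2_bv f g \<Longrightarrow> H2_bv h k \<Longrightarrow> H2_bv (\<lambda>z. f z + h z) (\<lambda>\<zeta>. g \<zeta> + k \<zeta>)"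
  unfolding H2_bv_def has_radial_limit_def by (auto intro: H2_disc_add tendsto_add elim: ae_circle_mono2)

text \<open>The multipliers of H^2: bounded analytic functions together with their boundary values.
  Inner functions, polynomials and Cauchy kernels are all of this kind.\<close>

definition Hinf_bv :: "(complex \<Rightarrow> complex) \<Rightarrow> (complex \<Rightarrow> complex) \<Rightarrow> bool" where
  "Hinf_bv h k \<longleftrightarrow> h holomorphic_on ball 0 1 \<and> (\<exists>B. \<forall>z. cmod z < 1 \<longrightarrow> cmod (h z) \<le> B) \<and>
     ae_circle (\<lambda>\<zeta>. has_radial_limit h \<zeta> (k \<zeta>))"

lemma Hinf_bv_H2: "Hinf_bv h k \<Longrightarrow> H2_bv h k"
  unfolding Hinf_bv_def H2_bv_def using H2_disc_bounded by blast

lemma H2_bv_mult: "Hinf_bv h k \<Longrightarrow> H2_bv f g \<Longrightarrow> H2_bv (\<lambda>z. h z * f z) (\<lambda>\<zeta>. k \<zeta> * g \<zeta>)"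
  unfolding H2_bv_def Hinf_bv_def has_radial_limit_def
  by (auto intro: H2_disc_mult_bounded tendsto_mult elim: ae_circle_mono2)

lemma Hinf_bv_const: "Hinf_bv (\<lambda>_. c) (\<lambda>_. c)"
  by (auto simp: Hinf_bv_def ae_circle_def has_radial_limit_def)

lemma has_radial_limit_isCont: "isCont f \<zeta> \<Longrightarrow> has_radial_limit f \<zeta> (f \<zeta>)"
  unfolding has_radial_limit_def
  by (rule isCont_tendsto_compose [where g = f]) (auto intro!: tendsto_eq_intros)

lemma Hinf_bv_ident: "Hinf_bv (\<lambda>z. z) (\<lambda>z. z)"
  unfolding Hinf_bv_def ae_circle_def
  by (auto intro!: has_radial_limit_isCont exI[of _ 1])

lemma Hinf_bv_mult:
  assumes "Hinf_bv f g" "Hinf_bv h k"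
  shows "Hinf_bv (\<lambda>z. f z * h z) (\<lambda>\<zeta>. g \<zeta> * k \<zeta>)"
proof -
  obtain A B where AB: "\<And>z. cmod z < 1 \<Longrightarrow> cmod (f z) \<le> A" "\<And>z. cmod z < 1 \<Longrightarrow> cmod (h z) \<le> B"
    using assms unfolding Hinf_bv_def by blast
  have "cmod (f z * h z) \<le> A * B" if "cmod z < 1" for z
    unfolding norm_mult using AB[OF that] norm_ge_zero by (meson mult_mono order_trans)
  moreover have "ae_circle (\<lambda>\<zeta>. has_radial_limit (\<lambda>z. f z * h z) \<zeta> (g \<zeta> * k \<zeta>))"
    using assms unfolding Hinf_bv_def has_radial_limit_def by (auto intro: tendsto_mult elim: ae_circle_mono2)
  ultimately show ?thesis
    using assms unfolding Hinf_bv_def by (blast intro: holomorphic_on_mult)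
qed

lemma Hinf_bv_add:
  assumes "Hinf_bv f g" "Hinf_bv h k"
  shows "Hinf_bv (\<lambda>z. f z + h z) (\<lambda>\<zeta>. g \<zeta> + k \<zeta>)"
proof -
  obtain A B where AB: "\<And>z. cmod z < 1 \<Longrightarrow> cmod (f z) \<le> A" "\<And>z. cmod z < 1 \<Longrightarrow> cmod (h z) \<le> B"
    using assms unfolding Hinf_bv_def by blast
  have "cmod (f z + h z) \<le> A + B" if "cmod z < 1" for z
    using AB[OF that] by (rule norm_triangle_mono)
  moreover have "ae_circle (\<lambda>\<zeta>. has_radial_limit (\<lambda>z. f z + h z) \<zeta> (g \<zeta> + k \<zeta>))"
    using assms unfolding Hinf_bv_def has_radial_limit_def by (auto intro: tendsto_add elim: ae_circle_mono2)
  ultimately show ?thesis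
    using assms unfolding Hinf_bv_def by (blast intro: holomorphic_on_add)
qed

lemma Hinf_bv_diff:
  assumes "Hinf_bv f g" "Hinf_bv h k"
  shows "Hinf_bv (\<lambda>z. f z - h z) (\<lambda>\<zeta>. g \<zeta> - k \<zeta>)"
  using Hinf_bv_add [OF assms(1) Hinf_bv_mult [OF Hinf_bv_const [of "-1"] assms(2)]] by simp

lemma H2_bv_diff:
  assumes "H2_bv f g" "H2_bv h k"
  shows "H2_bv (\<lambda>z. f z - h z) (\<lambda>\<zeta>. g \<zeta> - k \<zeta>)"
  using H2_bv_add [OF assms(1) H2_bv_mult [OF Hinf_bv_const [of "-1"] assms(2)]] by simp

lemma Hinf_bv_kernel:
  assumes "cmod v < 1"
  shows "Hinf_bv (\<lambda>z. 1 / (1 - v * z)) (\<lambda>z. 1 / (1 - v * z))"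
proof -
  have le: "1 - cmod v \<le> cmod (1 - v * z)" if "cmod z \<le> 1" for z
  proof -
    have "cmod v * cmod z \<le> cmod v * 1" using that by (intro mult_left_mono) auto
    then show ?thesis using norm_triangle_ineq2[of 1 "v * z"] by (simp add: norm_mult)
  qed
  have nz: "1 - v * z \<noteq> 0" if "cmod z \<le> 1" for z using le[OF that] assms by auto
  have "cmod (1 / (1 - v * z)) \<le> 1 / (1 - cmod v)" if "cmod z < 1" for z
    using le[of z] that assms by (simp add: norm_divide frac_le)
  moreover have "(\<lambda>z. 1 / (1 - v * z)) holomorphic_on ball 0 1"
    using nz by (intro holomorphic_intros) auto
  moreover have "has_radial_limit (\<lambda>z. 1 / (1 - v * z)) (cis t) (1 / (1 - v * cis t))" for t
    using nz[of "cis t"] by (intro has_radial_limit_isCont continuous_intros) auto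
  ultimately show ?thesis unfolding Hinf_bv_def ae_circle_def by auto
qed

text \<open>The Cauchy integral of a conjugate Hardy function is constant: after conjugation the
  kernel becomes an analytic multiplier with value 1 at 0, and Cauchy's formula at 0
  applies.\<close>

lemma integral_circ_cnj_cauchy:
  assumes "H2_bv h k" "cmod z < 1"
  shows "(\<integral>t. 1 / (1 - z * cis (-t)) * cnj (k (cis t)) \<partial>circ) = 2 * pi * cnj (h 0)"
proof -
  have H: "H2_bv (\<lambda>w. 1 / (1 - cnj z * w) * h w) (\<lambda>w. 1 / (1 - cnj z * w) * k w)"
    using assms by (intro H2_bv_mult Hinf_bv_kernel) auto
  have "(\<integral>t. 1 / (1 - z * cis (-t)) * cnj (k (cis t)) \<partial>circ) = (\<integral>t. cnj (1 / (1 - cnj z * cis t) * k (cis t)) \<partial>circ)"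
    by (simp add: cis_cnj)
  also have "\<dots> = cnj (\<integral>t. 1 / (1 - cnj z * cis t) * k (cis t) \<partial>circ)" by (rule Bochner_Integration.integral_cnj)
  also have "\<dots> = cnj (2 * pi * h 0)" using H2_bv_cauchy [OF H, of 0] by simp
  finally show ?thesis by simp
qed

text \<open>Division by z after the removable singularity is filled in. On |z| <= 1/2 the quotient
  is bounded by compactness, and elsewhere it is at most 2 |f z|; the comparison lemma combines the
  two.\<close>

lemma H2_bv_quotient:
  assumes "H2_bv f g" "f 0 = 0"
  shows "H2_bv (\<lambda>z. if z = 0 then deriv f 0 else f z / z) (\<lambda>\<zeta>. g \<zeta> / \<zeta>)" (is "H2_bv ?h _")
proof -
  have f: "f holomorphic_on ball 0 1" using assms(1) H2_disc_holomorphic by (auto simp: H2_bv_def)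
  then have h: "?h holomorphic_on ball 0 1"
    using pole_lemma[of f "ball 0 1" 0] assms(2) by (simp cong: if_cong)
  have "continuous_on (cball 0 (1/2)) ?h"
    by (intro holomorphic_on_imp_continuous_on holomorphic_on_subset [OF h]) auto
  then have "compact (?h ` cball 0 (1/2))" by (intro compact_continuous_image) auto
  then obtain B where B: "\<And>z. z \<in> cball 0 (1/2) \<Longrightarrow> cmod (?h z) \<le> B"
    by (meson bounded_iff compact_imp_bounded imageI)
  have B0: "0 \<le> B" using order_trans [OF norm_ge_zero B[of 0]] by simp
  have "(cmod (?h z))\<^sup>2 \<le> B\<^sup>2 + 4 * (cmod (f z))\<^sup>2" if "cmod z < 1" for z
  proof (cases "cmod z \<le> 1/2")
    case True
    then have "(cmod (?h z))\<^sup>2 \<le> B\<^sup>2" using B[of z] by (intro power_mono) auto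
    then show ?thesis by (smt (verit) zero_le_power2)
  next
    case False
    then have z: "1/2 < cmod z" "z \<noteq> 0" by auto
    then have "cmod (f z) / cmod z \<le> cmod (f z) / (1/2)" by (intro divide_left_mono) auto
    then have "cmod (?h z) \<le> 2 * cmod (f z)" using z by (simp add: norm_divide)
    then have "(cmod (?h z))\<^sup>2 \<le> (2 * cmod (f z))\<^sup>2" by (intro power_mono) auto
    then show ?thesis by (simp add: power_mult_distrib) (smt (verit) zero_le_power2)
  qed
  then have "?h \<in> H2_disc"
    using assms(1) by (intro H2_discI_dominated [OF _ h, of f 4 "B\<^sup>2"]) (auto simp: H2_bv_def)
  moreover have "has_radial_limit ?h (cis t) (g (cis t) / cis t)" if "has_radial_limit f (cis t) (g (cis t))" for t
  proof -
    have "((\<lambda>r. f (of_real r * cis t) / (of_real r * cis t)) \<longlongrightarrow> g (cis t) / (of_real 1 * cis t)) (at_left (1::real))"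
      using that cis_nonzero[of t] unfolding has_radial_limit_def by (intro tendsto_intros) auto
    moreover have "\<forall>\<^sub>F r in at_left (1::real). r \<in> {0<..<1}"
      by (rule eventually_at_left_real) simp
    then have "\<forall>\<^sub>F r in at_left (1::real). f (of_real r * cis t) / (of_real r * cis t) = ?h (of_real r * cis t)"
      by eventually_elim (use cis_nonzero in auto)
    ultimately show ?thesis unfolding has_radial_limit_def
      by (simp add: Lim_transform_eventually)
  qed
  ultimately show ?thesis
    using assms(1) unfolding H2_bv_def by (auto elim: ae_circle_mono)
qed

text \<open>Writing k = h 0 + zeta m with m in H^2 gives zeta cnj k = cnj (h 0) zeta + cnj m. The
  Cauchy kernel reproduces f minus the linear term and sends cnj m to the constant cnj (m 0). All
  polynomials of degree at most one in the analysis of the symbol come from here.\<close>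

lemma H2_inter_mult_cnj_H2:
  assumes "H2_bv f g" "H2_bv h k" "ae_circle (\<lambda>\<zeta>. g \<zeta> = \<zeta> * cnj (k \<zeta>))"
  obtains p q where "\<And>z. cmod z < 1 \<Longrightarrow> f z = p + q * z"
proof -
  have "H2_bv (\<lambda>z. h z - h 0) (\<lambda>\<zeta>. k \<zeta> - h 0)"
    by (intro H2_bv_diff assms Hinf_bv_H2 Hinf_bv_const)
  from H2_bv_quotient [OF this] obtain m where m: "H2_bv m (\<lambda>\<zeta>. (k \<zeta> - h 0) / \<zeta>)" by auto
  have F: "H2_bv (\<lambda>z. f z - cnj (h 0) * z) (\<lambda>\<zeta>. g \<zeta> - cnj (h 0) * \<zeta>)"
    by (intro H2_bv_diff assms Hinf_bv_H2 Hinf_bv_mult Hinf_bv_const Hinf_bv_ident)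
  have ae: "AE t in circ. g (cis t) - cnj (h 0) * cis t = cnj ((k (cis t) - h 0) / cis t)"
    using assms(3) unfolding ae_circle_def
  proof eventually_elim
    case (elim t)
    have "cnj ((k (cis t) - h 0) / cis t) = cnj (k (cis t) - h 0) * cis t"
      by (simp only: complex_cnj_divide complex_cnj_mult cis_cnj divide_inverse cis_inverse minus_minus)
    then show ?case by (simp add: elim algebra_simps)
  qed
  have "f z = cnj (m 0) + cnj (h 0) * z" if z: "cmod z < 1" for z
  proof -
    have c: "(\<lambda>t. 1 / (1 - z * cis (-t))) \<in> borel_measurable circ"
      using one_minus_mult_cnj_cis_nonzero[OF z]
      by (intro measurable_circ_continuous continuous_intros) auto
    have m': "(\<lambda>t. cnj ((k (cis t) - h 0) / cis t)) \<in> borel_measurable circ"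
      by (intro borel_measurable_cnj H2_bv_measurable[OF m])
    have "(\<integral>t. 1 / (1 - z * cis (-t)) * (g (cis t) - cnj (h 0) * cis t) \<partial>circ)
       = (\<integral>t. 1 / (1 - z * cis (-t)) * cnj ((k (cis t) - h 0) / cis t) \<partial>circ)"
      by (intro integral_mult_cong_AE c m' H2_bv_measurable[OF F] ae)
    then have "f z - cnj (h 0) * z = cnj (m 0)"
      using H2_bv_cauchy[OF F z] integral_circ_cnj_cauchy[OF m z] by simp
    then show ?thesis by (simp only: diff_eq_eq)
  qed
  then show ?thesis by (rule that)
qed

subsection \<open>Poisson kernels and growth\<close>

text \<open>The fibres of \<open>cis\<close> are countable, hence null. This permits division by
  zeta - lam on the circle.\<close>

lemma ae_circle_neq: "ae_circle (\<lambda>\<zeta>. \<zeta> \<noteq> c)"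
proof (cases "\<exists>s. cis s = c")
  case True
  then obtain s where s: "cis s = c" ..
  have "{t. c = cis t} \<subseteq> range (\<lambda>n::int. s + 2 * pi * n)"
  proof clarify
    fix t assume "c = cis t"
    then have "sin t = sin s \<and> cos t = cos s" using s by (simp add: complex_eq_iff)
    then show "t \<in> range (\<lambda>n::int. s + 2 * pi * n)" by (auto simp: sin_cos_eq_iff)
  qed
  then have "countable {t. c = cis t}" by (rule countable_subset) simp
  then have "{t. c = cis t} \<in> null_sets lborel" by (rule countable_imp_null_set_lborel)
  then have "{t. c = cis t} \<in> null_sets lebesgue" by (rule null_sets_completionI)
  from AE_not_in [OF this] have "AE t in lebesgue. cis t \<noteq> c" by (simp add: eq_commute)
  then show ?thesis
    unfolding ae_circle_def by (subst AE_restrict_space_iff) auto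
qed (auto simp: ae_circle_def)

lemma cmod_one_minus_mult_pos:
  assumes "cmod v < 1" "cmod w = 1" shows "0 < cmod (1 - v * w)"
  using cmod_one_minus_mult_ge[OF assms(2), of v] assms(1) by linarith

lemma kernel_norm_square:
  "1 / (1 - v * cis (-t)) * (1 / (1 - cnj v * cis t)) = of_real (1 / (cmod (1 - v * cis (-t)))\<^sup>2)"
proof -
  have "1 - cnj v * cis t = cnj (1 - v * cis (-t))" by (simp add: cis_cnj)
  then show ?thesis
    by (simp only: of_real_divide of_real_1 complex_norm_square times_divide_times_eq mult_1)
qed

text \<open>The Poisson kernel is, up to the factor 1 - |v|^2, the product of the Cauchy kernel at v
  and its conjugate. The conjugate is an analytic multiplier, so Cauchy's formula at v applies to
  its product with f.\<close>

lemma H2_bv_poisson: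
  assumes "H2_bv f g" "cmod v < 1"
  shows "(\<integral>t. of_real (1 / (cmod (1 - v * cis (-t)))\<^sup>2) * g (cis t) \<partial>circ) = of_real (2 * pi / (1 - (cmod v)\<^sup>2)) * f v"
proof -
  have H: "H2_bv (\<lambda>w. 1 / (1 - cnj v * w) * f w) (\<lambda>w. 1 / (1 - cnj v * w) * g w)"
    using assms by (intro H2_bv_mult Hinf_bv_kernel) auto
  have "(\<integral>t. of_real (1 / (cmod (1 - v * cis (-t)))\<^sup>2) * g (cis t) \<partial>circ)
     = (\<integral>t. 1 / (1 - v * cis (-t)) * (1 / (1 - cnj v * cis t) * g (cis t)) \<partial>circ)"
    by (simp only: kernel_norm_square [symmetric] mult.assoc)
  also have "\<dots> = 2 * pi * (1 / (1 - cnj v * v) * f v)" using H2_bv_cauchy [OF H assms(2)] .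
  also have "cnj v * v = of_real ((cmod v)\<^sup>2)" by (simp only: complex_norm_square mult.commute)
  finally show ?thesis by simp
qed

text \<open>The Poisson formula for the constant function 1, read in the reals.\<close>

lemma
  assumes "cmod v < 1"
  shows integrable_kernel_norm: "integrable circ (\<lambda>t. 1 / (cmod (1 - v * cis (-t)))\<^sup>2)"
    and integral_kernel_norm: "(\<integral>t. 1 / (cmod (1 - v * cis (-t)))\<^sup>2 \<partial>circ) = 2 * pi / (1 - (cmod v)\<^sup>2)"
proof -
  show "integrable circ (\<lambda>t. 1 / (cmod (1 - v * cis (-t)))\<^sup>2)"
    using one_minus_mult_cnj_cis_nonzero[OF assms]
    by (intro integrable_circ_continuous continuous_intros) auto
  have "of_real (\<integral>t. 1 / (cmod (1 - v * cis (-t)))\<^sup>2 \<partial>circ) = (\<integral>t. of_real (1 / (cmod (1 - v * cis (-t)))\<^sup>2) * (1::complex) \<partial>circ)"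
    by (simp only: mult.right_neutral integral_complex_of_real)
  also have "\<dots> = of_real (2 * pi / (1 - (cmod v)\<^sup>2)) * 1"
    by (rule H2_bv_poisson [OF Hinf_bv_H2 [OF Hinf_bv_const] assms])
  finally show "(\<integral>t. 1 / (cmod (1 - v * cis (-t)))\<^sup>2 \<partial>circ) = 2 * pi / (1 - (cmod v)\<^sup>2)"
    by (simp only: mult.right_neutral of_real_eq_iff)
qed

text \<open>The value at z is the pairing of g with the Cauchy kernel, whose squared norm is 2 pi /
  (1 - |z|^2).\<close>

lemma H2_bv_growth:
  assumes "H2_bv f g"
  obtains C where "C \<ge> 0" "\<And>z. cmod z < 1 \<Longrightarrow> cmod (f z) * sqrt (1 - (cmod z)\<^sup>2) \<le> C"
proof -
  define N where "N = (\<integral>t. (cmod (g (cis t)))\<^sup>2 \<partial>circ)"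
  have N0: "0 \<le> N" unfolding N_def by simp
  note gi = H2_bv_square_integrable[OF assms] and gm [measurable] = H2_bv_measurable[OF assms]
  have "cmod (f z) * sqrt (1 - (cmod z)\<^sup>2) \<le> (2 * pi + N) / (4 * pi)" if z: "cmod z < 1" for z
  proof -
    define s where "s = sqrt (1 - (cmod z)\<^sup>2)"
    have "(cmod z)\<^sup>2 < 1" using z by (simp add: abs_square_less_1)
    then have s: "s > 0" "s\<^sup>2 = 1 - (cmod z)\<^sup>2" by (auto simp: s_def)
    define e where "e t = 1 / (1 - z * cis (-t))" for t
    have [measurable]: "e \<in> borel_measurable circ" unfolding e_def
      using one_minus_mult_cnj_cis_nonzero[OF z] by (intro measurable_circ_continuous continuous_intros) auto
    have e2: "(cmod (e t))\<^sup>2 = 1 / (cmod (1 - z * cis (-t)))\<^sup>2" for t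
      by (simp add: e_def norm_divide power_divide)
    have ei: "integrable circ (\<lambda>t. (cmod (e t))\<^sup>2)" "(\<integral>t. (cmod (e t))\<^sup>2 \<partial>circ) = 2 * pi / s\<^sup>2"
      unfolding e2 s(2) by (rule integrable_kernel_norm [OF z], rule integral_kernel_norm [OF z])
    \<comment> \<open>The weight s balances the two terms: after integration both become constant
      multiples of 1 / s.\<close>
    have pw: "cmod (e t * g (cis t)) \<le> (s * (cmod (e t))\<^sup>2 + (cmod (g (cis t)))\<^sup>2 / s) / 2" for t
    proof -
      have "2 * (s * cmod (e t)) * cmod (g (cis t)) \<le> (s * cmod (e t))\<^sup>2 + (cmod (g (cis t)))\<^sup>2"
        by (rule sum_squares_bound)
      then show ?thesis using s(1) by (simp add: norm_mult field_simps power2_eq_square)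
    qed
    have "2 * pi * cmod (f z) = cmod (\<integral>t. e t * g (cis t) \<partial>circ)"
      using H2_bv_cauchy[OF assms z] unfolding e_def by (simp add: norm_mult)
    also have "\<dots> \<le> (\<integral>t. cmod (e t * g (cis t)) \<partial>circ)" by (rule integral_norm_bound)
    also have "\<dots> \<le> (\<integral>t. (s * (cmod (e t))\<^sup>2 + (cmod (g (cis t)))\<^sup>2 / s) / 2 \<partial>circ)"
      using pw ei gi by (intro integral_mono integrable_norm integrable_mult_L2) auto
    also have "\<dots> = (s * (2 * pi / s\<^sup>2) + N / s) / 2" using ei gi by (simp add: N_def)
    also have "\<dots> = (2 * pi + N) / (2 * s)" using s(1) by (simp add: field_simps power2_eq_square)
    finally show ?thesis using s(1) unfolding s_def [symmetric] by (simp add: field_simps)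
  qed
  then show ?thesis using N0 that[of "(2 * pi + N) / (4 * pi)"] by simp
qed

text \<open>Comparison with the Cauchy kernels at the points \<open>rad n\<close> times l: their
  squared norms are unbounded, yet a square integrable b dominating d / |zeta - l| would bound all
  of them by 4 N / d^2.\<close>

lemma inverse_distance_not_L2:
  assumes l: "cmod l = 1" and [measurable]: "b \<in> borel_measurable circ"
    and b2: "integrable circ (\<lambda>t. (cmod (b t))\<^sup>2)"
    and d: "0 < d" and le: "AE t in circ. d \<le> cmod (cis t - l) * cmod (b t)"
  shows False
proof -
  define N where "N = (\<integral>t. (cmod (b t))\<^sup>2 \<partial>circ)"
  have "2 * pi / (1 - (rad n)\<^sup>2) \<le> 4 / d\<^sup>2 * N" for n
  proof -
    have v: "cmod (of_real (rad n) * l) < 1" using l by (simp add: norm_mult)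
    have "(\<integral>t. 1 / (cmod (1 - of_real (rad n) * l * cis (-t)))\<^sup>2 \<partial>circ) \<le> (\<integral>t. 4 / d\<^sup>2 * (cmod (b t))\<^sup>2 \<partial>circ)"
    proof (rule integral_mono_AE [OF integrable_kernel_norm [OF v]])
      show "integrable circ (\<lambda>t. 4 / d\<^sup>2 * (cmod (b t))\<^sup>2)" using b2 by simp
      show "AE t in circ. 1 / (cmod (1 - of_real (rad n) * l * cis (-t)))\<^sup>2 \<le> 4 / d\<^sup>2 * (cmod (b t))\<^sup>2"
        using le
      proof eventually_elim
        case (elim t)
        have e: "cmod (1 - of_real (rad n) * l * cis (-t)) = cmod (cis t - of_real (rad n) * l)"
        proof -
          have "cis t - of_real (rad n) * l = cis t * (1 - of_real (rad n) * l * cis (-t))"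
            by (simp add: algebra_simps cis_mult)
          then show ?thesis by (simp add: norm_mult)
        qed
        \<comment> \<open>The point \<open>rad n\<close> times l is at distance 1 -
          \<open>rad n\<close> from l, which is also a lower bound for its distance to any point of
          the circle.\<close>
        have "cmod (cis t - l) \<le> 2 * cmod (cis t - of_real (rad n) * l)"
        proof -
          have "cmod (of_real (rad n) * l - l) = 1 - rad n"
          proof -
            have "of_real (rad n) * l - l = of_real (rad n - 1) * l" by (simp add: algebra_simps)
            then show ?thesis using l by (simp add: norm_mult del: of_real_diff)
          qed
          moreover have "1 - rad n \<le> cmod (cis t - of_real (rad n) * l)"
            using norm_triangle_ineq2[of "cis t" "of_real (rad n) * l"] l by (simp add: norm_mult)
          moreover have "cmod (cis t - l) \<le> cmod (cis t - of_real (rad n) * l) + cmod (of_real (rad n) * l - l)"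
            using norm_triangle_ineq[of "cis t - of_real (rad n) * l" "of_real (rad n) * l - l"] by simp
          ultimately show ?thesis by linarith
        qed
        then have "d \<le> 2 * cmod (cis t - of_real (rad n) * l) * cmod (b t)"
          using elim by (smt (verit) mult_right_mono norm_ge_zero)
        then have "d\<^sup>2 \<le> (2 * cmod (cis t - of_real (rad n) * l) * cmod (b t))\<^sup>2"
          using d by (intro power_mono) auto
        moreover have "0 < cmod (cis t - of_real (rad n) * l)"
          unfolding e [symmetric] using cmod_one_minus_mult_pos[OF v, of "cis (-t)"] by simp
        ultimately show ?case using d unfolding e by (simp add: field_simps power_mult_distrib)
      qed
    qed
    then show ?thesis unfolding integral_kernel_norm [OF v] using l b2 by (simp add: norm_mult N_def)
  qed
  moreover have "real n \<le> 2 * pi / (1 - (rad n)\<^sup>2)" for n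
  proof -
    have r: "1 - (rad n)\<^sup>2 = (1 - rad n) * (1 + rad n)" by (simp add: power2_eq_square algebra_simps)
    have "(1 - rad n) * (1 + rad n) \<le> (1 - rad n) * 2" by (intro mult_left_mono) auto
    then have a: "1 - (rad n)\<^sup>2 \<le> 2 / real (n + 2)" unfolding r by (simp add: rad_def)
    have b: "0 < 1 - (rad n)\<^sup>2" unfolding r by (intro mult_pos_pos) (auto simp: add_pos_pos)
    have "real n * (1 - (rad n)\<^sup>2) \<le> real n * (2 / real (n + 2))" by (rule mult_left_mono [OF a]) simp
    also have "\<dots> \<le> 2" by (simp add: field_simps)
    also have "\<dots> \<le> 2 * pi" using pi_gt3 by simp
    finally show ?thesis using b by (simp add: field_simps)
  qed
  ultimately have "real n \<le> 4 / d\<^sup>2 * N" for n using order_trans by blast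
  then show False using reals_Archimedean2 not_less by blast
qed

subsection \<open>Difference quotients of inner functions\<close>

locale inner_boundary =
  fixes \<theta> u :: "complex \<Rightarrow> complex" and lam :: complex
  assumes bv: "Hinf_bv \<theta> u" and unimodular: "ae_circle (\<lambda>\<zeta>. cmod (u \<zeta>) = 1)" and lam: "cmod lam = 1"
begin

lemma holomorphic: "\<theta> holomorphic_on ball 0 1"
  using bv by (simp add: Hinf_bv_def)

text \<open>A difference quotient in \<open>H\<^sup>2\<close> is, up to a constant, the reproducing kernel at the boundary point.\<close>

definition H2_quotient :: "complex \<Rightarrow> (complex \<Rightarrow> complex) \<Rightarrow> bool" where
  "H2_quotient w A \<longleftrightarrow> A \<in> H2_disc \<and> (\<forall>z. cmod z < 1 \<longrightarrow> (z - lam) * A z = \<theta> z - w)"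

lemma H2_quotient_bv:
  assumes "H2_quotient w A"
  shows "H2_bv A (\<lambda>\<zeta>. (u \<zeta> - w) / (\<zeta> - lam))"
proof -
  have "has_radial_limit A (cis t) ((u (cis t) - w) / (cis t - lam))"
    if "has_radial_limit \<theta> (cis t) (u (cis t))" "cis t \<noteq> lam" for t
  proof -
    have "((\<lambda>r. (\<theta> (of_real r * cis t) - w) / (of_real r * cis t - lam)) \<longlongrightarrow> (u (cis t) - w) / (of_real 1 * cis t - lam)) (at_left (1::real))"
      using that unfolding has_radial_limit_def by (intro tendsto_intros) auto
    moreover have "\<forall>\<^sub>F r in at_left (1::real). r \<in> {0<..<1}"
      by (rule eventually_at_left_real) simp
    then have "\<forall>\<^sub>F r in at_left (1::real). (\<theta> (of_real r * cis t) - w) / (of_real r * cis t - lam) = A (of_real r * cis t)"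
    proof eventually_elim
      case (elim r)
      then have c: "cmod (of_real r * cis t) < 1" by (simp add: norm_mult)
      then have "of_real r * cis t - lam \<noteq> 0" using lam by auto
      moreover have "(of_real r * cis t - lam) * A (of_real r * cis t) = \<theta> (of_real r * cis t) - w"
        using assms c by (simp add: H2_quotient_def)
      ultimately show ?case by (simp add: field_simps)
    qed
    ultimately show ?thesis unfolding has_radial_limit_def
      by (simp add: Lim_transform_eventually)
  qed
  moreover have "ae_circle (\<lambda>\<zeta>. has_radial_limit \<theta> \<zeta> (u \<zeta>))" using bv by (simp add: Hinf_bv_def)
  ultimately show ?thesis
    using assms ae_circle_neq[of lam] unfolding H2_bv_def H2_quotient_def by (auto elim: ae_circle_mono2)
qed

text \<open>Almost everywhere |u - w| is at least | 1 - |w| |. If this were positive, the quotient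
  would dominate a multiple of 1 / |zeta - lam| and could not be square integrable.\<close>

lemma H2_quotient_unimodular:
  assumes "H2_quotient w A"
  shows "cmod w = 1"
proof (rule ccontr)
  assume w: "cmod w \<noteq> 1"
  have A: "H2_bv A (\<lambda>\<zeta>. (u \<zeta> - w) / (\<zeta> - lam))" by (rule H2_quotient_bv [OF assms])
  have "ae_circle (\<lambda>\<zeta>. \<bar>1 - cmod w\<bar> \<le> cmod (\<zeta> - lam) * cmod ((u \<zeta> - w) / (\<zeta> - lam)))"
    using unimodular ae_circle_neq[of lam]
  proof (rule ae_circle_mono2)
    fix t assume "cmod (u (cis t)) = 1" "cis t \<noteq> lam"
    then show "\<bar>1 - cmod w\<bar> \<le> cmod (cis t - lam) * cmod ((u (cis t) - w) / (cis t - lam))"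
      using norm_triangle_ineq3[of "u (cis t)" w] by (simp add: norm_divide)
  qed
  then show False
    using w inverse_distance_not_L2 [OF lam H2_bv_measurable[OF A] H2_bv_square_integrable[OF A], of "\<bar>1 - cmod w\<bar>"]
    by (simp add: ae_circle_def)
qed

text \<open>The growth bound gives |A z|^2 (1 - |z|^2) <= C^2, and in a Stolz region |z - lam| <= M
  (1 - |z|^2). Inserting both into theta - w = (z - lam) A yields a rate of order one half, which
  also controls the kernels near lam.\<close>

lemma H2_quotient_imp_nontangential:
  assumes "H2_quotient w A"
  shows "has_nontangential_limit \<theta> lam w"
    and "\<exists>C. \<forall>M>1. \<forall>z\<in>stolz_region lam M. (cmod (\<theta> z - w))\<^sup>2 \<le> C * M * cmod (z - lam)"
proof -
  obtain C where C: "C \<ge> 0" "\<And>z. cmod z < 1 \<Longrightarrow> cmod (A z) * sqrt (1 - (cmod z)\<^sup>2) \<le> C"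
    using H2_bv_growth [OF H2_quotient_bv [OF assms]] by blast
  have le: "(cmod (\<theta> z - w))\<^sup>2 \<le> C\<^sup>2 * M * cmod (z - lam)" if M: "M > 1" and z: "z \<in> stolz_region lam M" for M z
  proof -
    have z1: "cmod z < 1" and zl: "cmod (z - lam) < M * (1 - cmod z)" using z by (auto simp: stolz_region_def)
    have p: "cmod (z - lam) \<le> M * (1 - (cmod z)\<^sup>2)"
    proof -
      have "(cmod z)\<^sup>2 \<le> cmod z" using z1 by (simp add: power2_eq_square mult_left_le)
      then have "M * (1 - cmod z) \<le> M * (1 - (cmod z)\<^sup>2)" using M by (intro mult_left_mono) auto
      then show ?thesis using zl by linarith
    qed
    have "0 \<le> 1 - (cmod z)\<^sup>2" using z1 by (simp add: abs_square_le_1)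
    then have "(cmod (A z))\<^sup>2 * (1 - (cmod z)\<^sup>2) \<le> C\<^sup>2"
      using power_mono[OF C(2)[OF z1], of 2] by (simp add: power_mult_distrib)
    moreover have "(cmod (\<theta> z - w))\<^sup>2 = cmod (z - lam) * (cmod (A z))\<^sup>2 * cmod (z - lam)"
    proof -
      have "\<theta> z - w = (z - lam) * A z" using assms z1 by (simp add: H2_quotient_def)
      then show ?thesis by (simp add: norm_mult power2_eq_square)
    qed
    moreover have "cmod (z - lam) * (cmod (A z))\<^sup>2 \<le> M * (1 - (cmod z)\<^sup>2) * (cmod (A z))\<^sup>2"
      using p by (intro mult_right_mono) auto
    ultimately have "(cmod (\<theta> z - w))\<^sup>2 \<le> (M * (1 - (cmod z)\<^sup>2) * (cmod (A z))\<^sup>2) * cmod (z - lam)"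
      by (simp add: mult_right_mono)
    also have "\<dots> = M * ((cmod (A z))\<^sup>2 * (1 - (cmod z)\<^sup>2)) * cmod (z - lam)" by simp
    also have "\<dots> \<le> M * C\<^sup>2 * cmod (z - lam)"
      using M \<open>(cmod (A z))\<^sup>2 * (1 - (cmod z)\<^sup>2) \<le> C\<^sup>2\<close> by (intro mult_right_mono mult_left_mono) auto
    finally show ?thesis by (simp add: mult_ac)
  qed
  then show "\<exists>C. \<forall>M>1. \<forall>z\<in>stolz_region lam M. (cmod (\<theta> z - w))\<^sup>2 \<le> C * M * cmod (z - lam)" by blast
  show "has_nontangential_limit \<theta> lam w"
    unfolding has_nontangential_limit_def
  proof (intro allI impI)
    fix M :: real assume M: "M > 1"
    have "((\<lambda>z. sqrt (C\<^sup>2 * M * cmod (z - lam))) \<longlongrightarrow> sqrt (C\<^sup>2 * M * cmod (lam - lam))) (at lam within stolz_region lam M)"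
      by (intro tendsto_intros)
    then have lim: "((\<lambda>z. sqrt (C\<^sup>2 * M * cmod (z - lam))) \<longlongrightarrow> 0) (at lam within stolz_region lam M)" by simp
    have "\<forall>\<^sub>F z in at lam within stolz_region lam M. norm (\<theta> z - w) \<le> sqrt (C\<^sup>2 * M * cmod (z - lam))"
      unfolding eventually_at_filter
      by (intro always_eventually allI impI real_le_rsqrt le M)
    from Lim_null_comparison [OF this lim]
    show "(\<theta> \<longlongrightarrow> w) (at lam within stolz_region lam M)" by (simp add: LIM_zero_iff)
  qed
qed

text \<open>The quotient lies in the model space, on which the kernels of the model space reproduce
  point values. Concretely, cnj u times the quotient is a constant times the conjugate of zeta A, so
  the extra term of the kernel contributes nothing.\<close>

lemma H2_quotient_reproducing:
  fixes A :: "complex \<Rightarrow> complex"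
  assumes "H2_quotient w A" "cmod z < 1"
  shows "(\<integral>t. (u (cis t) - w) / (cis t - lam) * ((1 - \<theta> z * cnj (u (cis t))) / (1 - z * cis (-t))) \<partial>circ) = 2 * pi * A z"
proof -
  define a where "a \<zeta> = (u \<zeta> - w) / (\<zeta> - lam)" for \<zeta>
  have A: "H2_bv A a" using H2_quotient_bv [OF assms(1)] by (simp add: a_def [abs_def])
  have w: "w * cnj w = 1" using H2_quotient_unimodular [OF assms(1)] by (simp add: complex_norm_square [symmetric])
  have l: "lam * cnj lam = 1" using lam by (simp add: complex_norm_square [symmetric])
  have zA: "H2_bv (\<lambda>\<zeta>. \<zeta> * A \<zeta>) (\<lambda>\<zeta>. \<zeta> * a \<zeta>)" by (intro H2_bv_mult Hinf_bv_ident A)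
  have c: "(\<lambda>t. 1 / (1 - z * cis (-t))) \<in> borel_measurable circ"
    and ci: "integrable circ (\<lambda>t. (cmod (1 / (1 - z * cis (-t))))\<^sup>2)"
    using one_minus_mult_cnj_cis_nonzero[OF assms(2)]
    by (intro measurable_circ_continuous integrable_circ_continuous continuous_intros; auto)+
  have i1: "integrable circ (\<lambda>t. 1 / (1 - z * cis (-t)) * a (cis t))"
    by (intro integrable_mult_L2 c ci H2_bv_measurable [OF A] H2_bv_square_integrable [OF A])
  have i2: "integrable circ (\<lambda>t. 1 / (1 - z * cis (-t)) * cnj (cis t * a (cis t)))"
    using H2_bv_square_integrable [OF zA]
    by (intro integrable_mult_L2 c ci borel_measurable_cnj H2_bv_measurable [OF zA]) (simp only: complex_mod_cnj)
  have um: "(\<lambda>t. u (cis t)) \<in> borel_measurable circ" by (rule H2_bv_measurable [OF Hinf_bv_H2 [OF bv]])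
  note am [measurable] = H2_bv_measurable [OF A] and um [measurable]
  define e where "e t = 1 / (1 - z * cis (-t))" for t
  have [measurable]: "e \<in> borel_measurable circ" using c by (simp add: e_def [abs_def])
  have cm [measurable]: "cis \<in> borel_measurable circ" by (intro measurable_circ_continuous continuous_intros)
  have "(\<integral>t. a (cis t) * ((1 - \<theta> z * cnj (u (cis t))) * e t) \<partial>circ)
     = (\<integral>t. e t * a (cis t) - \<theta> z * w * cnj lam * (e t * cnj (cis t * a (cis t))) \<partial>circ)"
  proof (rule integral_cong_AE)
    \<comment> \<open>After clearing denominators this follows from |u| = |zeta| = |w| = |lam| =
      1.\<close>
    have "ae_circle (\<lambda>\<zeta>. cnj (u \<zeta>) * a \<zeta> = w * cnj lam * cnj (\<zeta> * a \<zeta>))"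
      using unimodular ae_circle_neq[of lam]
    proof (rule ae_circle_mono2)
      fix t assume t: "cmod (u (cis t)) = 1" "cis t \<noteq> lam"
      define x y where "x = u (cis t)" and "y = cis t"
      have x: "x * cnj x = 1" and y: "y * cnj y = 1"
        using t(1) by (simp_all add: x_def y_def complex_norm_square [symmetric])
      have ne: "y - lam \<noteq> 0" "cnj y - cnj lam \<noteq> 0" using t(2) by (auto simp: y_def)
      have "cnj x * (x - w) * (cnj y - cnj lam) = w * cnj lam * cnj y * (cnj x - cnj w) * (y - lam)"
        using x y w l by algebra
      then show "cnj (u (cis t)) * a (cis t) = w * cnj lam * cnj (cis t * a (cis t))"
        using ne unfolding a_def x_def y_def by (simp add: field_simps)
    qed
    then show "AE t in circ. a (cis t) * ((1 - \<theta> z * cnj (u (cis t))) * e t)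
        = e t * a (cis t) - \<theta> z * w * cnj lam * (e t * cnj (cis t * a (cis t)))"
      unfolding ae_circle_def
    proof eventually_elim
      case (elim t)
      have "a (cis t) * ((1 - \<theta> z * cnj (u (cis t))) * e t) = e t * a (cis t) - \<theta> z * e t * (cnj (u (cis t)) * a (cis t))"
        by (simp add: algebra_simps)
      then show ?case unfolding elim by (simp add: mult_ac)
    qed
  qed measurable
  also have "\<dots> = (\<integral>t. e t * a (cis t) \<partial>circ) - \<theta> z * w * cnj lam * (\<integral>t. e t * cnj (cis t * a (cis t)) \<partial>circ)"
    using i1 i2 unfolding e_def [symmetric] by simp
  \<comment> \<open>The second integral is 2 pi times the conjugate of the value of zeta A at 0,
    which is zero.\<close>
  also have "\<dots> = 2 * pi * A z"
    using H2_bv_cauchy [OF A assms(2)] integral_circ_cnj_cauchy [OF zA assms(2)] unfolding e_def [symmetric] by simp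
  finally show ?thesis by (simp add: a_def e_def)
qed

lemma measurable_u: "(\<lambda>t. u (cis t)) \<in> borel_measurable circ"
  by (rule H2_bv_measurable [OF Hinf_bv_H2 [OF bv]])

lemma one_minus_mult_cis: "1 - z * cis (-t) = cis (-t) * (cis t - z)"
  by (simp add: algebra_simps cis_mult)

text \<open>In a Stolz region the kernels are bounded in \<open>L\<^sup>2\<close>, so their pointwise convergence makes the
  quotient, which they reproduce, converge.\<close>

lemma H2_quotient_imp_ADC:
  assumes Q: "H2_quotient w A"
  shows "has_ADC \<theta> lam"
proof -
  define a where "a \<zeta> = (u \<zeta> - w) / (\<zeta> - lam)" for \<zeta>
  have A: "H2_bv A a" using H2_quotient_bv [OF Q] by (simp add: a_def [abs_def])
  note ai = H2_bv_square_integrable [OF A]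
  note [measurable] = H2_bv_measurable [OF A] measurable_u
  have [measurable]: "cis \<in> borel_measurable circ" by (intro measurable_circ_continuous continuous_intros)
  define N where "N = (\<integral>t. (cmod (a (cis t)))\<^sup>2 \<partial>circ)"
  obtain C where C: "\<And>M z. M > 1 \<Longrightarrow> z \<in> stolz_region lam M \<Longrightarrow> (cmod (\<theta> z - w))\<^sup>2 \<le> C * M * cmod (z - lam)"
    using H2_quotient_imp_nontangential(2) [OF Q] by blast
  \<comment> \<open>The function a cnj u zeta is the almost everywhere limit of the conjugated
    kernels as the point tends to lam; d is what the reproducing formula becomes for this
    limit.\<close>
  define d where "d = (\<integral>t. a (cis t) * (a (cis t) * cnj (u (cis t)) * cis t) \<partial>circ) / (2 * pi)"
  have lim: "(A \<longlongrightarrow> d) (at lam within stolz_region lam M)" if M: "M > 1" for M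
    unfolding tendsto_at_iff_sequentially
  proof (intro allI impI)
    fix X assume X: "\<forall>i. X i \<in> stolz_region lam M - {lam}" and Xl: "X \<longlonglongrightarrow> lam"
    have X1: "cmod (X n) < 1" and XM: "cmod (X n - lam) \<le> M * (1 - cmod (X n))"
      and XS: "X n \<in> stolz_region lam M" for n
      using X[rule_format, of n] by (auto simp: stolz_region_def)
    have "(\<theta> \<longlongrightarrow> w) (at lam within stolz_region lam M)"
      using H2_quotient_imp_nontangential(1) [OF Q] M by (simp add: has_nontangential_limit_def)
    then have \<theta>X: "(\<lambda>n. \<theta> (X n)) \<longlonglongrightarrow> w"
      using X Xl unfolding tendsto_at_iff_sequentially comp_def by blast
    define e where "e n t = 1 / (1 - X n * cis (-t))" for n t
    have [measurable]: "e n \<in> borel_measurable circ" for n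
      unfolding e_def using one_minus_mult_cnj_cis_nonzero[OF X1]
      by (intro measurable_circ_continuous continuous_intros) auto
    have e2: "(cmod (e n t))\<^sup>2 = 1 / (cmod (1 - X n * cis (-t)))\<^sup>2" for n t
      by (simp add: e_def norm_divide power_divide)
    have ei: "integrable circ (\<lambda>t. (cmod (e n t))\<^sup>2)"
      "(\<integral>t. (cmod (e n t))\<^sup>2 \<partial>circ) = 2 * pi / (1 - (cmod (X n))\<^sup>2)" for n
      unfolding e2 by (rule integrable_kernel_norm [OF X1], rule integral_kernel_norm [OF X1])
    define h where "h n t = (1 - \<theta> (X n) * cnj (u (cis t))) * e n t - a (cis t) * cnj (u (cis t)) * cis t" for n t
    have [measurable]: "h n \<in> borel_measurable circ" for n unfolding h_def by measurable
    define D where "D n = cmod (\<theta> (X n) - w)" for n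
    \<comment> \<open>The rate of order one half, combined with the Stolz condition, compensates
      exactly the growth 1 / (1 - |X n|^2) of the squared Cauchy kernel.\<close>
    have D2: "(D n)\<^sup>2 \<le> \<bar>C\<bar> * M\<^sup>2 * (1 - (cmod (X n))\<^sup>2)" for n
    proof -
      have "(cmod (X n))\<^sup>2 \<le> cmod (X n)" using X1[of n] by (simp add: power2_eq_square mult_left_le)
      then have "cmod (X n - lam) \<le> M * (1 - (cmod (X n))\<^sup>2)"
        using XM[of n] mult_left_mono[of "1 - cmod (X n)" "1 - (cmod (X n))\<^sup>2" M] M by linarith
      then have "\<bar>C\<bar> * M * cmod (X n - lam) \<le> \<bar>C\<bar> * M * (M * (1 - (cmod (X n))\<^sup>2))"
        using M by (intro mult_left_mono) auto
      moreover have "C * M * cmod (X n - lam) \<le> \<bar>C\<bar> * M * cmod (X n - lam)"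
        using M by (intro mult_right_mono) auto
      ultimately show ?thesis using C[OF M XS[of n]] by (simp add: D_def power2_eq_square)
    qed
    \<comment> \<open>Insert w into 1 - theta (X n) cnj u. The part with u - w = (zeta - lam) a is
      bounded by (1 + M) |a| after division, because |zeta - lam| <= (1 + M) |zeta - X n|; the part
      with theta (X n) - w gives D n times the Cauchy kernel.\<close>
    have hb: "AE t in circ. (cmod (h n t))\<^sup>2 \<le> 2 * (2 + M)\<^sup>2 * (cmod (a (cis t)))\<^sup>2 + 2 * (D n)\<^sup>2 * (cmod (e n t))\<^sup>2" for n
      using unimodular[unfolded ae_circle_def] ae_circle_neq[of lam, unfolded ae_circle_def]
    proof eventually_elim
      case (elim t)
      define x y where "x = u (cis t)" and "y = cis t"
      have x: "cmod x = 1" "cmod (cnj x) = 1" "x * cnj x = 1" and y: "cmod y = 1"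
        using elim by (simp_all add: x_def y_def complex_norm_square [symmetric])
      define \<rho> where "\<rho> = cmod (y - X n)"
      have \<rho>: "1 - cmod (X n) \<le> \<rho>" using norm_triangle_ineq2[of y "X n"] y by (simp add: \<rho>_def)
      then have \<rho>0: "0 < \<rho>" using X1[of n] by linarith
      have e: "cmod (e n t) = 1 / \<rho>"
        unfolding e_def one_minus_mult_cis \<rho>_def y_def by (simp add: norm_divide norm_mult)
      have "cmod (y - lam) \<le> \<rho> + cmod (X n - lam)"
        using norm_triangle_ineq[of "y - X n" "X n - lam"] by (simp add: \<rho>_def)
      also have "\<dots> \<le> \<rho> + M * \<rho>"
        using XM[of n] \<rho> M mult_left_mono[OF \<rho>, of M] by linarith
      finally have yl: "cmod (y - lam) \<le> (1 + M) * \<rho>" by (simp add: algebra_simps)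
      have xa: "x - w = (y - lam) * a y" using elim by (simp add: a_def x_def y_def)
      have "1 - \<theta> (X n) * cnj x = cnj x * ((y - lam) * a y) - (\<theta> (X n) - w) * cnj x"
        unfolding xa [symmetric] using x(3) by (simp add: algebra_simps)
      then have "cmod (1 - \<theta> (X n) * cnj x) \<le> cmod (y - lam) * cmod (a y) + D n"
        using norm_triangle_ineq4[of "cnj x * ((y - lam) * a y)" "(\<theta> (X n) - w) * cnj x"] x(2)
        by (simp add: norm_mult D_def)
      also have "\<dots> \<le> (1 + M) * \<rho> * cmod (a y) + D n"
        using yl by (intro add_right_mono mult_right_mono) auto
      finally have "cmod (1 - \<theta> (X n) * cnj x) * (1 / \<rho>) \<le> ((1 + M) * \<rho> * cmod (a y) + D n) * (1 / \<rho>)"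
        using \<rho>0 by (intro mult_right_mono) auto
      also have "\<dots> = (1 + M) * cmod (a y) + D n * (1 / \<rho>)" using \<rho>0 by (simp add: field_simps)
      finally have k: "cmod (1 - \<theta> (X n) * cnj x) * cmod (e n t) \<le> (1 + M) * cmod (a y) + D n * cmod (e n t)"
        unfolding e .
      have "cmod (h n t) \<le> cmod (1 - \<theta> (X n) * cnj x) * cmod (e n t) + cmod (a y)"
        using norm_triangle_ineq4[of "(1 - \<theta> (X n) * cnj x) * e n t" "a y * cnj x * y"] x(2) y
        unfolding h_def x_def y_def by (simp add: norm_mult)
      also have "\<dots> \<le> (2 + M) * cmod (a y) + D n * cmod (e n t)" using k by (simp add: algebra_simps)
      finally have "(cmod (h n t))\<^sup>2 \<le> ((2 + M) * cmod (a y) + D n * cmod (e n t))\<^sup>2"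
        by (intro power_mono) auto
      also have "\<dots> \<le> 2 * ((2 + M) * cmod (a y))\<^sup>2 + 2 * (D n * cmod (e n t))\<^sup>2"
        using sum_squares_bound[of "(2 + M) * cmod (a y)" "D n * cmod (e n t)"] by (simp add: power2_sum)
      finally show ?case by (simp add: y_def power_mult_distrib)
    qed
    have bi: "integrable circ (\<lambda>t. 2 * (2 + M)\<^sup>2 * (cmod (a (cis t)))\<^sup>2 + 2 * (D n)\<^sup>2 * (cmod (e n t))\<^sup>2)" for n
      using ai ei(1) by auto
    have hi: "integrable circ (\<lambda>t. (cmod (h n t))\<^sup>2)" for n
    proof (rule Bochner_Integration.integrable_bound [OF bi])
      show "AE t in circ. norm ((cmod (h n t))\<^sup>2) \<le> norm (2 * (2 + M)\<^sup>2 * (cmod (a (cis t)))\<^sup>2 + 2 * (D n)\<^sup>2 * (cmod (e n t))\<^sup>2)"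
        using hb[of n] by eventually_elim simp
    qed measurable
    have "(\<lambda>n. \<integral>t. a (cis t) * h n t \<partial>circ) \<longlonglongrightarrow> 0"
    proof (rule tendsto_integral_mult_of_AE_of_L2_bounded [where C="2 * (2 + M)\<^sup>2 * N + 4 * pi * \<bar>C\<bar> * M\<^sup>2"])
      fix n
      have x1: "0 < 1 - (cmod (X n))\<^sup>2" using X1[of n] by (simp add: abs_square_less_1)
      have "(\<integral>t. (cmod (h n t))\<^sup>2 \<partial>circ) \<le> (\<integral>t. 2 * (2 + M)\<^sup>2 * (cmod (a (cis t)))\<^sup>2 + 2 * (D n)\<^sup>2 * (cmod (e n t))\<^sup>2 \<partial>circ)"
        by (rule integral_mono_AE [OF hi bi hb])
      also have "\<dots> = 2 * (2 + M)\<^sup>2 * N + 2 * (D n)\<^sup>2 * (2 * pi / (1 - (cmod (X n))\<^sup>2))"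
        using ai ei by (simp add: N_def)
      also have "2 * (D n)\<^sup>2 * (2 * pi / (1 - (cmod (X n))\<^sup>2)) \<le> 4 * pi * \<bar>C\<bar> * M\<^sup>2"
        using mult_left_mono [OF D2[of n], of "4 * pi"] x1 by (simp add: field_simps)
      finally show "(\<integral>t. (cmod (h n t))\<^sup>2 \<partial>circ) \<le> 2 * (2 + M)\<^sup>2 * N + 4 * pi * \<bar>C\<bar> * M\<^sup>2" by simp
    next
      show "AE t in circ. (\<lambda>n. h n t) \<longlonglongrightarrow> 0"
        using unimodular[unfolded ae_circle_def] ae_circle_neq[of lam, unfolded ae_circle_def]
      proof eventually_elim
        case (elim t)
        have nz: "1 - lam * cis (-t) \<noteq> 0" unfolding one_minus_mult_cis using elim cis_nonzero by simp
        have x: "u (cis t) * cnj (u (cis t)) = 1" using elim by (simp add: complex_norm_square [symmetric])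
        have "(1 - w * cnj (u (cis t))) * (1 / (1 - lam * cis (-t))) = a (cis t) * cnj (u (cis t)) * cis t"
        proof -
          have "1 - w * cnj (u (cis t)) = (u (cis t) - w) * cnj (u (cis t))" using x by (simp add: algebra_simps)
          then show ?thesis
            unfolding one_minus_mult_cis a_def using elim cis_nonzero[of t]
            by (simp add: cis_minus_eq_divide field_simps del: cis_divide cis_inverse)
        qed
        moreover have "(\<lambda>n. h n t) \<longlonglongrightarrow> (1 - w * cnj (u (cis t))) * (1 / (1 - lam * cis (-t))) - a (cis t) * cnj (u (cis t)) * cis t"
          unfolding h_def e_def by (intro tendsto_intros \<theta>X Xl nz)
        ultimately show ?case by simp
      qed
    qed (use ai hi in auto)
    \<comment> \<open>By the reproducing formula the weak convergence just shown is the convergence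
      of A along the sequence.\<close>
    moreover have "(\<integral>t. a (cis t) * h n t \<partial>circ) = 2 * pi * A (X n) - 2 * pi * d" for n
    proof -
      have i1: "integrable circ (\<lambda>t. a (cis t) * h n t)" by (intro integrable_mult_L2 ai hi) measurable
      have "AE t in circ. (cmod (a (cis t) * cnj (u (cis t)) * cis t))\<^sup>2 = (cmod (a (cis t)))\<^sup>2"
        using unimodular[unfolded ae_circle_def] by eventually_elim (simp add: norm_mult)
      then have "integrable circ (\<lambda>t. (cmod (a (cis t) * cnj (u (cis t)) * cis t))\<^sup>2)"
        using ai by (subst integrable_cong_AE[where g="\<lambda>t. (cmod (a (cis t)))\<^sup>2"]) auto
      then have i2: "integrable circ (\<lambda>t. a (cis t) * (a (cis t) * cnj (u (cis t)) * cis t))"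
        by (intro integrable_mult_L2 ai) measurable
      have "2 * pi * A (X n) = (\<integral>t. a (cis t) * ((1 - \<theta> (X n) * cnj (u (cis t))) * e n t) \<partial>circ)"
        using H2_quotient_reproducing [OF Q X1[of n]] by (simp add: a_def e_def)
      also have "\<dots> = (\<integral>t. a (cis t) * h n t + a (cis t) * (a (cis t) * cnj (u (cis t)) * cis t) \<partial>circ)"
        by (simp add: h_def algebra_simps)
      also have "\<dots> = (\<integral>t. a (cis t) * h n t \<partial>circ) + 2 * pi * d"
        using i1 i2 by (simp add: d_def)
      finally show ?thesis by simp
    qed
    ultimately have "(\<lambda>n. (2 * pi * A (X n) - 2 * pi * d) / (2 * pi) + d) \<longlonglongrightarrow> 0 / (2 * pi) + d"
      by (intro tendsto_intros) auto
    moreover have "(2 * pi * A (X n) - 2 * pi * d) / (2 * pi) + d = A (X n)" for n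
      by (simp add: diff_divide_distrib)
    ultimately show "(A \<circ> X) \<longlonglongrightarrow> d" by (simp add: comp_def)
  qed
  have "has_nontangential_limit (\<lambda>z. (\<theta> z - w) / (z - lam)) lam d"
    unfolding has_nontangential_limit_def
  proof (intro allI impI)
    fix M :: real assume M: "1 < M"
    have "\<forall>\<^sub>F z in at lam within stolz_region lam M. A z = (\<theta> z - w) / (z - lam)"
      unfolding eventually_at_filter
    proof (intro always_eventually allI impI)
      fix z assume "z \<noteq> lam" "z \<in> stolz_region lam M"
      then have "(z - lam) * A z = \<theta> z - w" "z - lam \<noteq> 0" using Q by (auto simp: H2_quotient_def stolz_region_def)
      then show "A z = (\<theta> z - w) / (z - lam)" by (simp add: field_simps)
    qed
    from Lim_transform_eventually [OF lim [OF M] this]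
    show "((\<lambda>z. (\<theta> z - w) / (z - lam)) \<longlongrightarrow> d) (at lam within stolz_region lam M)" .
  qed
  then show ?thesis
    unfolding has_ADC_def using H2_quotient_imp_nontangential(1) [OF Q] H2_quotient_unimodular [OF Q] by blast
qed

end

subsection \<open>From the angular derivative to the difference quotient\<close>

text \<open>Expand one factor of the squared modulus into its Taylor series and integrate term by
  term against the conjugate; each integral is a Fourier coefficient.\<close>

lemma parseval_circle:
  fixes f :: "complex \<Rightarrow> complex"
  assumes f: "f holomorphic_on ball 0 1" and r: "0 < r" "r < 1"
  shows "(\<lambda>n. 2 * pi * ((cmod ((deriv ^^ n) f 0 / fact n))\<^sup>2 * (r ^ n)\<^sup>2)) sums (\<integral>t. (cmod (f (of_real r * cis t)))\<^sup>2 \<partial>circ)"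
proof -
  define b where "b n = (deriv ^^ n) f 0 / fact n" for n
  define F where "F t = f (of_real r * cis t)" for t
  have Fc: "continuous_on {0..2*pi} F" unfolding F_def by (intro continuous_on_circle_holomorphic f) (use r in auto)
  have ps: "(\<lambda>n. b n * z ^ n) sums f z" if "cmod z < 1" for z
    using holomorphic_power_series[OF f, of z] that by (simp add: b_def)
  \<comment> \<open>Convergence at a radius strictly between r and 1 gives absolute convergence at
    r.\<close>
  define s where "s = (1 + r) / 2"
  have s: "r < s" "0 < s" "s < 1" using r by (auto simp: s_def)
  have "summable (\<lambda>n. b n * of_real s ^ n)" using ps[of "of_real s"] s by (simp add: sums_iff)
  then have "summable (\<lambda>n. norm (b n * of_real r ^ n))"
    by (rule powser_insidea) (use r s in simp)
  then have sm: "summable (\<lambda>n. cmod (b n) * r ^ n)" using r by (simp add: norm_mult norm_power)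
  define G where "G n t = b n * (of_real r * cis t) ^ n * cnj (F t)" for n t
  have Gi: "integrable circ (G n)" for n
    unfolding G_def by (intro integrable_circ_continuous continuous_intros Fc)
  have nG: "norm (G n t) = cmod (b n) * r ^ n * cmod (F t)" for n t
    using r by (simp add: G_def norm_mult norm_power power_mult_distrib)
  have Gint: "integral\<^sup>L circ (G n) = of_real (2 * pi * ((cmod (b n))\<^sup>2 * (r ^ n)\<^sup>2))" for n
  proof -
    have "G n = (\<lambda>t. b n * of_real r ^ n * cnj (F t * cis (-t) ^ n))"
      by (simp add: G_def fun_eq_iff cis_cnj power_mult_distrib mult_ac)
    then have "integral\<^sup>L circ (G n) = b n * of_real r ^ n * cnj (\<integral>t. F t * cis (-t) ^ n \<partial>circ)"
      by (simp only: integral_mult_right_zero Bochner_Integration.integral_cnj)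
    also have "(\<integral>t. F t * cis (-t) ^ n \<partial>circ) = 2 * pi * (of_real r ^ n * b n)"
      unfolding F_def b_def by (rule integral_circ_cauchy_deriv [OF f r])
    also have "b n * of_real r ^ n * cnj (2 * pi * (of_real r ^ n * b n)) = 2 * pi * ((b n * cnj (b n)) * (of_real r ^ n)\<^sup>2)"
      by (simp add: power2_eq_square mult_ac)
    finally show ?thesis unfolding complex_norm_square [symmetric] by simp
  qed
  have "(\<lambda>n. integral\<^sup>L circ (G n)) sums (\<integral>t. (\<Sum>n. G n t) \<partial>circ)"
  proof (rule sums_integral [OF Gi])
    show "AE t in circ. summable (\<lambda>n. norm (G n t))"
      unfolding nG by (intro AE_I2 summable_mult2 sm)
    show "summable (\<lambda>n. \<integral>t. norm (G n t) \<partial>circ)"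
      unfolding nG integral_mult_right_zero by (intro summable_mult2 sm)
  qed
  also have "(\<lambda>t. \<Sum>n. G n t) = (\<lambda>t. of_real ((cmod (F t))\<^sup>2))"
  proof
    fix t
    have "(\<lambda>n. G n t) sums (F t * cnj (F t))"
      unfolding G_def by (intro sums_mult2, unfold F_def, rule ps) (use r in \<open>simp add: norm_mult\<close>)
    then show "(\<Sum>n. G n t) = of_real ((cmod (F t))\<^sup>2)" by (simp only: sums_iff complex_norm_square)
  qed
  finally show ?thesis unfolding Gint integral_complex_of_real sums_of_real_iff F_def b_def .
qed

text \<open>Every term of the Parseval series increases with the radius.\<close>

lemma circle_mean_mono:
  fixes f :: "complex \<Rightarrow> complex"
  assumes "f holomorphic_on ball 0 1" "0 < r" "r \<le> s" "s < 1"
  shows "(\<integral>t. (cmod (f (of_real r * cis t)))\<^sup>2 \<partial>circ) \<le> (\<integral>t. (cmod (f (of_real s * cis t)))\<^sup>2 \<partial>circ)"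
proof (rule sums_le [OF _ parseval_circle parseval_circle])
  show "2 * pi * ((cmod ((deriv ^^ n) f 0 / fact n))\<^sup>2 * (r ^ n)\<^sup>2) \<le> 2 * pi * ((cmod ((deriv ^^ n) f 0 / fact n))\<^sup>2 * (s ^ n)\<^sup>2)" for n
    using assms by (intro mult_left_mono power_mono) auto
qed (use assms in auto)

text \<open>The means increase with the radius and, by dominated convergence, tend to the mean over
  the unit circle along \<open>rad\<close>.\<close>

lemma Hinf_bv_mean_le:
  assumes "Hinf_bv K k" "0 < r" "r < 1"
  shows "(\<integral>t. (cmod (K (of_real r * cis t)))\<^sup>2 \<partial>circ) \<le> (\<integral>t. (cmod (k (cis t)))\<^sup>2 \<partial>circ)"
proof -
  obtain B where K: "K holomorphic_on ball 0 1" and B: "\<And>z. cmod z < 1 \<Longrightarrow> cmod (K z) \<le> B"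
    using assms unfolding Hinf_bv_def by blast
  have "(\<lambda>n. \<integral>t. (cmod (K (of_real (rad n) * cis t)))\<^sup>2 \<partial>circ) \<longlonglongrightarrow> (\<integral>t. (cmod (k (cis t)))\<^sup>2 \<partial>circ)"
  proof (rule integral_dominated_convergence [where w="\<lambda>_. B\<^sup>2"])
    show "(\<lambda>t. (cmod (k (cis t)))\<^sup>2) \<in> borel_measurable circ"
      using H2_bv_square_integrable [OF Hinf_bv_H2 [OF assms(1)]] by simp
    show "(\<lambda>t. (cmod (K (of_real (rad n) * cis t)))\<^sup>2) \<in> borel_measurable circ" for n
      using integrable_circle_norm2 [OF K, of "rad n"] by simp
    show "AE t in circ. (\<lambda>n. (cmod (K (of_real (rad n) * cis t)))\<^sup>2) \<longlonglongrightarrow> (cmod (k (cis t)))\<^sup>2"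
      using conjunct2 [OF conjunct2 [OF assms(1) [unfolded Hinf_bv_def ae_circle_def]]]
      by eventually_elim (intro tendsto_intros has_radial_limit_rad)
    show "AE t in circ. norm ((cmod (K (of_real (rad n) * cis t)))\<^sup>2) \<le> B\<^sup>2" for n
      by (intro AE_I2) (auto intro!: power_mono B simp: norm_mult)
  qed simp
  moreover have "\<forall>\<^sub>F n in sequentially. rad n > r"
    using order_tendstoD(1) [OF rad_tendsto assms(3)] .
  then have "\<forall>\<^sub>F n in sequentially. (\<integral>t. (cmod (K (of_real r * cis t)))\<^sup>2 \<partial>circ) \<le> (\<integral>t. (cmod (K (of_real (rad n) * cis t)))\<^sup>2 \<partial>circ)"
    by eventually_elim (intro circle_mean_mono K assms(2), auto)
  ultimately show ?thesis by (rule tendsto_lowerbound) simp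
qed

context inner_boundary
begin

text \<open>The squared norm of the model space kernel at v. With |u| = 1 the numerator expands to 1
  + |theta v|^2 - 2 Re (cnj (theta v) u), and the Poisson formula replaces u by theta v, leaving 1 -
  |theta v|^2.\<close>

lemma integral_kernel_at_interior:
  assumes v: "cmod v < 1"
  shows "(\<integral>t. (cmod ((1 - cnj (\<theta> v) * u (cis t)) / (1 - cnj v * cis t)))\<^sup>2 \<partial>circ) = 2 * pi * (1 - (cmod (\<theta> v))\<^sup>2) / (1 - (cmod v)\<^sup>2)"
    (is "?I = _")
proof -
  define P where "P t = 1 / (cmod (1 - v * cis (-t)))\<^sup>2" for t
  have P: "integrable circ P" "integral\<^sup>L circ P = 2 * pi / (1 - (cmod v)\<^sup>2)"
    unfolding P_def by (rule integrable_kernel_norm [OF v], rule integral_kernel_norm [OF v])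
  have [measurable]: "(\<lambda>t. u (cis t)) \<in> borel_measurable circ" by (rule H2_bv_measurable [OF Hinf_bv_H2 [OF bv]])
  have [measurable]: "P \<in> borel_measurable circ" "cis \<in> borel_measurable circ"
    using P(1) by (auto intro!: measurable_circ_continuous continuous_intros)
  have [measurable]: "(\<lambda>t. 1 - cnj v * cis t) \<in> borel_measurable circ" by measurable
  have Pu: "integrable circ (\<lambda>t. of_real (P t) * u (cis t))"
  proof (rule Bochner_Integration.integrable_bound [OF P(1)])
    show "AE t in circ. norm (of_real (P t) * u (cis t)) \<le> norm (P t)"
      using unimodular unfolding ae_circle_def by eventually_elim (simp add: norm_mult)
  qed measurable
  have Pui: "(\<integral>t. of_real (P t) * u (cis t) \<partial>circ) = of_real (2 * pi / (1 - (cmod v)\<^sup>2)) * \<theta> v"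
    unfolding P_def by (rule H2_bv_poisson [OF Hinf_bv_H2 [OF bv] v])
  have "(\<integral>t. (cmod ((1 - cnj (\<theta> v) * u (cis t)) / (1 - cnj v * cis t)))\<^sup>2 \<partial>circ)
     = (\<integral>t. (1 + (cmod (\<theta> v))\<^sup>2) * P t - 2 * Re (cnj (\<theta> v) * (of_real (P t) * u (cis t))) \<partial>circ)"
  proof (rule integral_cong_AE)
    show "AE t in circ. (cmod ((1 - cnj (\<theta> v) * u (cis t)) / (1 - cnj v * cis t)))\<^sup>2
       = (1 + (cmod (\<theta> v))\<^sup>2) * P t - 2 * Re (cnj (\<theta> v) * (of_real (P t) * u (cis t)))"
      using unimodular unfolding ae_circle_def
    proof eventually_elim
      case (elim t)
      have c: "cmod (1 - cnj v * cis t) = cmod (1 - v * cis (-t))"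
        using complex_mod_cnj[of "1 - v * cis (-t)"] by (simp add: cis_cnj)
      have "(cmod (1 - cnj (\<theta> v) * u (cis t)))\<^sup>2 = 1 + (cmod (\<theta> v))\<^sup>2 - 2 * Re (cnj (\<theta> v) * u (cis t))"
      proof -
        have "(cmod (1 - z))\<^sup>2 = 1 + (cmod z)\<^sup>2 - 2 * Re z" for z
          by (simp only: cmod_power2) (simp add: power2_eq_square algebra_simps)
        from this[of "cnj (\<theta> v) * u (cis t)"] show ?thesis using elim by (simp add: norm_mult)
      qed
      then have "(cmod ((1 - cnj (\<theta> v) * u (cis t)) / (1 - cnj v * cis t)))\<^sup>2
          = (1 + (cmod (\<theta> v))\<^sup>2 - 2 * Re (cnj (\<theta> v) * u (cis t))) * P t"
        by (simp add: norm_divide power_divide c P_def)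
      moreover have "Re (cnj (\<theta> v) * (of_real (P t) * u (cis t))) = P t * Re (cnj (\<theta> v) * u (cis t))"
        by (simp add: algebra_simps)
      ultimately show ?case by (simp only: right_diff_distrib left_diff_distrib mult_ac)
    qed
  qed measurable
  also have "\<dots> = (1 + (cmod (\<theta> v))\<^sup>2) * integral\<^sup>L circ P - 2 * Re (\<integral>t. cnj (\<theta> v) * (of_real (P t) * u (cis t)) \<partial>circ)"
  proof -
    define q where "q t = cnj (\<theta> v) * (of_real (P t) * u (cis t))" for t
    have "integrable circ q" unfolding q_def using Pu by simp
    then show ?thesis unfolding q_def [symmetric] using P(1) by simp
  qed
  also have "(\<integral>t. cnj (\<theta> v) * (of_real (P t) * u (cis t)) \<partial>circ) = cnj (\<theta> v) * (\<integral>t. of_real (P t) * u (cis t) \<partial>circ)"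
    by (rule integral_mult_right_zero)
  also have "cnj (\<theta> v) * (\<integral>t. of_real (P t) * u (cis t) \<partial>circ) = of_real (2 * pi / (1 - (cmod v)\<^sup>2) * (cmod (\<theta> v))\<^sup>2)"
    unfolding Pui of_real_mult complex_norm_square by (simp add: mult_ac)
  finally have "?I = (1 + (cmod (\<theta> v))\<^sup>2) * (2 * pi / (1 - (cmod v)\<^sup>2)) - 2 * (2 * pi / (1 - (cmod v)\<^sup>2) * (cmod (\<theta> v))\<^sup>2)"
    unfolding P(2) Re_complex_of_real .
  then show ?thesis by (simp add: algebra_simps diff_divide_distrib add_divide_distrib)
qed

text \<open>Along the radius to lam the angular derivative bounds the norms of the kernels, hence
  their means on every circle inside the disc. The kernels converge pointwise in the disc to a
  unimodular multiple of the difference quotient, so Fatou on each circle transfers the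
  bound.\<close>

lemma ADC_imp_H2_quotient:
  assumes "has_ADC \<theta> lam"
  obtains w A where "H2_quotient w A"
proof -
  obtain w d where w: "cmod w = 1" and lw: "has_nontangential_limit \<theta> lam w"
    and ld: "has_nontangential_limit (\<lambda>z. (\<theta> z - w) / (z - lam)) lam d"
    using assms unfolding has_ADC_def by blast
  define X where "X n = of_real (rad n) * lam" for n
  have X1: "cmod (X n) = rad n" for n using lam by (simp add: X_def norm_mult)
  have Xd: "X n - lam = of_real (rad n - 1) * lam" for n by (simp add: X_def algebra_simps)
  have Xn: "cmod (X n - lam) = 1 - rad n" for n
    unfolding Xd norm_mult norm_of_real using lam by simp
  \<comment> \<open>Radial points satisfy |X n - lam| = 1 - |X n|, so any aperture above 1 contains
    them; 2 is used.\<close>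
  have XS: "X n \<in> stolz_region lam 2 - {lam}" for n
    using X1[of n] Xn[of n] lam rad_bounds(2)[of n] by (auto simp: stolz_region_def)
  have "(\<lambda>n. of_real (rad n) * lam) \<longlonglongrightarrow> of_real 1 * lam" by (intro tendsto_intros rad_tendsto)
  then have Xl: "X \<longlonglongrightarrow> lam" by (simp add: X_def [abs_def])
  have \<theta>X: "(\<lambda>n. \<theta> (X n)) \<longlonglongrightarrow> w" and qX: "(\<lambda>n. (\<theta> (X n) - w) / (X n - lam)) \<longlonglongrightarrow> d"
    using lw ld XS Xl unfolding has_nontangential_limit_def tendsto_at_iff_sequentially comp_def
    by (auto dest: spec [of _ 2])
  obtain B where B: "\<And>n. cmod ((\<theta> (X n) - w) / (X n - lam)) \<le> B"
    using convergent_imp_Bseq [OF convergentI [OF qX]] unfolding Bseq_def by blast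
  obtain T where T: "\<And>n. cmod (\<theta> (X n)) \<le> T"
    using convergent_imp_Bseq [OF convergentI [OF \<theta>X]] unfolding Bseq_def by blast
  have B0: "0 \<le> B" using order_trans [OF norm_ge_zero B[of 0]] .
  \<comment> \<open>From 1 - |theta|^2 <= |theta - w| (1 + |theta|) <= B (1 - \<open>rad n\<close>)
    (1 + T) and 1 - \<open>rad n\<close> <= 1 - (\<open>rad n\<close>)^2.\<close>
  define C where "C = 2 * pi * (B * (1 + T))"
  define K where "K n z = (1 - cnj (\<theta> (X n)) * \<theta> z) * (1 / (1 - cnj (X n) * z))" for n z
  have Kb: "Hinf_bv (K n) (\<lambda>\<zeta>. (1 - cnj (\<theta> (X n)) * u \<zeta>) * (1 / (1 - cnj (X n) * \<zeta>)))" for n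
    unfolding K_def by (intro Hinf_bv_mult Hinf_bv_diff Hinf_bv_const bv Hinf_bv_kernel) (simp add: X1)
  have KC: "(\<integral>t. (cmod (K n (of_real r * cis t)))\<^sup>2 \<partial>circ) \<le> C" if r: "0 < r" "r < 1" for n r
  proof -
    have r0: "0 < 1 - rad n" "1 - (rad n)\<^sup>2 = (1 - rad n) * (1 + rad n)"
      by (auto simp: power2_eq_square algebra_simps)
    have "cmod (\<theta> (X n) - w) \<le> B * (1 - rad n)"
      using B[of n] r0(1) unfolding norm_divide Xn by (simp add: field_simps)
    moreover have "1 - cmod (\<theta> (X n)) \<le> cmod (\<theta> (X n) - w)"
      using norm_triangle_ineq2[of w "\<theta> (X n)"] w by (simp add: norm_minus_commute)
    ultimately have "(1 - cmod (\<theta> (X n))) * (1 + cmod (\<theta> (X n))) \<le> (B * (1 - rad n)) * (1 + cmod (\<theta> (X n)))"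
      by (intro mult_right_mono) auto
    also have "\<dots> \<le> (B * (1 - rad n)) * (1 + T)"
      using B0 r0(1) T[of n] by (intro mult_left_mono) auto
    finally have a: "1 - (cmod (\<theta> (X n)))\<^sup>2 \<le> B * (1 + T) * (1 - rad n)"
      by (simp add: power2_eq_square algebra_simps)
    have T0: "0 \<le> T" using order_trans [OF norm_ge_zero T[of 0]] .
    have "1 - rad n \<le> 1 - (rad n)\<^sup>2"
      unfolding r0(2) using mult_left_mono[of 1 "1 + rad n" "1 - rad n"] r0(1) by simp
    then have "B * (1 + T) * (1 - rad n) \<le> B * (1 + T) * (1 - (rad n)\<^sup>2)"
      using B0 T0 by (intro mult_left_mono) auto
    with a have b: "1 - (cmod (\<theta> (X n)))\<^sup>2 \<le> B * (1 + T) * (1 - (rad n)\<^sup>2)" by linarith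
    have c: "0 < 1 - (rad n)\<^sup>2" unfolding r0(2) using r0(1) by (intro mult_pos_pos) (auto simp: add_pos_pos)
    have "(\<integral>t. (cmod (K n (of_real r * cis t)))\<^sup>2 \<partial>circ)
       \<le> (\<integral>t. (cmod ((1 - cnj (\<theta> (X n)) * u (cis t)) * (1 / (1 - cnj (X n) * cis t))))\<^sup>2 \<partial>circ)"
      by (rule Hinf_bv_mean_le [OF Kb r])
    also have "\<dots> = 2 * pi * (1 - (cmod (\<theta> (X n)))\<^sup>2) / (1 - (rad n)\<^sup>2)"
      using integral_kernel_at_interior[of "X n"] X1[of n] by simp
    also have "\<dots> \<le> 2 * pi * (B * (1 + T) * (1 - (rad n)\<^sup>2)) / (1 - (rad n)\<^sup>2)"
      using b c by (intro divide_right_mono mult_left_mono) auto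
    also have "\<dots> = C" using c by (simp add: C_def)
    finally show ?thesis .
  qed
  define A where "A z = (\<theta> z - w) / (z - lam)" for z
  have nz: "z - lam \<noteq> 0" if "cmod z < 1" for z using that lam by auto
  have Ah: "A holomorphic_on ball 0 1"
    unfolding A_def using nz by (intro holomorphic_intros holomorphic) auto
  have AC: "(\<integral>t. (cmod (A (of_real r * cis t)))\<^sup>2 \<partial>circ) \<le> C" if r: "0 < r" "r < 1" for r
  proof (rule L2_bounded_AE_limit(2) [where h = "\<lambda>n t. (w * cnj lam) * K n (of_real r * cis t)"])
    have Kh: "(\<lambda>z. (w * cnj lam) * K n z) holomorphic_on ball 0 1" for n
      using Kb[of n] by (intro holomorphic_intros) (simp add: Hinf_bv_def)
    show "(\<lambda>t. A (of_real r * cis t)) \<in> borel_measurable circ"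
      by (intro measurable_circ_continuous continuous_on_circle_holomorphic Ah) (use r in auto)
    show "(\<lambda>t. (w * cnj lam) * K n (of_real r * cis t)) \<in> borel_measurable circ" for n
      by (intro measurable_circ_continuous continuous_on_circle_holomorphic [OF Kh]) (use r in auto)
    show "integrable circ (\<lambda>t. (cmod ((w * cnj lam) * K n (of_real r * cis t)))\<^sup>2)" for n
      by (rule integrable_circle_norm2 [OF Kh]) (use r in auto)
    show "(\<integral>t. (cmod ((w * cnj lam) * K n (of_real r * cis t)))\<^sup>2 \<partial>circ) \<le> C" for n
      using KC [OF r] w lam by (simp add: norm_mult)
    show "AE t in circ. (\<lambda>n. (w * cnj lam) * K n (of_real r * cis t)) \<longlonglongrightarrow> A (of_real r * cis t)"
    proof (intro AE_I2)
      fix t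
      define z where "z = of_real r * cis t"
      have z: "cmod z < 1" using r by (simp add: z_def norm_mult)
      have ww: "w * cnj w = 1" and ll: "lam * cnj lam = 1" using w lam by (simp_all add: complex_norm_square [symmetric])
      have n1: "1 - cnj lam * z \<noteq> 0" using z lam by (metis complex_mod_cnj eq_iff_diff_eq_0 less_irrefl mult_1 norm_mult norm_one)
      have "(\<lambda>n. (w * cnj lam) * K n z) \<longlonglongrightarrow> (w * cnj lam) * ((1 - cnj w * \<theta> z) * (1 / (1 - cnj lam * z)))"
        unfolding K_def by (intro tendsto_intros \<theta>X Xl n1)
      \<comment> \<open>The factor w gives w (1 - cnj w theta) = w - theta and cnj lam gives cnj lam
        (z - lam) = cnj lam z - 1; the two signs cancel.\<close>
      moreover have "(w * cnj lam) * ((1 - cnj w * \<theta> z) * (1 / (1 - cnj lam * z))) = A z"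
      proof -
        have "(w * cnj lam) * (1 - cnj w * \<theta> z) * (z - lam) = (\<theta> z - w) * (1 - cnj lam * z)"
          using ww ll by algebra
        then show ?thesis using nz[OF z] n1 unfolding A_def by (simp add: field_simps)
      qed
      ultimately show "(\<lambda>n. (w * cnj lam) * K n (of_real r * cis t)) \<longlonglongrightarrow> A (of_real r * cis t)" by (simp add: z_def)
    qed
  qed
  \<comment> \<open>The Parseval argument concerns positive radii, so the centre is covered by the
    maximum.\<close>
  have "(\<integral>t. (cmod (A (of_real r * cis t)))\<^sup>2 \<partial>circ) \<le> max C (2 * pi * (cmod (A 0))\<^sup>2)" if "0 \<le> r" "r < 1" for r
    using AC[of r] that by (cases "r = 0") (auto simp: space_restrict_space)
  then have "A \<in> H2_disc" using Ah unfolding H2_disc_iff by blast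
  moreover have "(z - lam) * A z = \<theta> z - w" if "cmod z < 1" for z
    using nz[OF that] by (simp add: A_def)
  ultimately show ?thesis using that unfolding H2_quotient_def by blast
qed

end

subsection \<open>Solutions of the block equation\<close>

text \<open>The circle has positive measure. This turns a contradiction that holds almost everywhere
  into \<open>False\<close>.\<close>

lemma ae_circle_ex:
  assumes "ae_circle P" shows "\<exists>t. P (cis t)"
proof (rule ccontr)
  assume "\<nexists>t. P (cis t)"
  then have "AE t in circ. False" using assms by (simp add: ae_circle_def)
  then obtain N where "{t \<in> space circ. \<not> False} \<subseteq> N" "emeasure circ N = 0" "N \<in> sets circ"
    by (rule AE_E)
  then have "space circ \<subseteq> N" "emeasure circ N = 0" "N \<in> sets circ" by auto
  then have "emeasure circ (space circ) \<le> 0" using emeasure_mono by metis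
  then show False by (simp add: emeasure_restrict_space space_restrict_space)
qed

text \<open>Radial limits see only the values inside the disc. With \<open>H2_bv_unique\<close>,
  interior and boundary functions determine each other.\<close>

lemma H2_bv_radial_unique:
  assumes "H2_bv f g" "H2_bv h k" "\<And>z. cmod z < 1 \<Longrightarrow> f z = h z"
  shows "ae_circle (\<lambda>\<zeta>. g \<zeta> = k \<zeta>)"
proof -
  have "ae_circle (\<lambda>\<zeta>. has_radial_limit f \<zeta> (g \<zeta>))" "ae_circle (\<lambda>\<zeta>. has_radial_limit h \<zeta> (k \<zeta>))"
    using assms(1,2) by (auto simp: H2_bv_def)
  then show ?thesis
  proof (rule ae_circle_mono2)
    fix t assume f: "has_radial_limit f (cis t) (g (cis t))" and h: "has_radial_limit h (cis t) (k (cis t))"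
    have "(\<lambda>n. f (of_real (rad n) * cis t)) = (\<lambda>n. h (of_real (rad n) * cis t))"
      by (intro ext assms(3)) (simp add: norm_mult)
    then show "g (cis t) = k (cis t)"
      using has_radial_limit_rad[OF f] has_radial_limit_rad[OF h] LIMSEQ_unique by simp
  qed
qed

lemma conj_H2_circle_iff: "g \<in> conj_H2_circle \<longleftrightarrow> (\<exists>f. H2_bv f (\<lambda>\<zeta>. cnj (g \<zeta>)))"
proof
  assume "g \<in> conj_H2_circle"
  then show "\<exists>f. H2_bv f (\<lambda>\<zeta>. cnj (g \<zeta>))" by (auto simp: conj_H2_circle_def H2_circle_iff)
next
  assume "\<exists>f. H2_bv f (\<lambda>\<zeta>. cnj (g \<zeta>))"
  then have "(\<lambda>\<zeta>. cnj (g \<zeta>)) \<in> H2_circle" by (simp add: H2_circle_iff)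
  then have "(\<lambda>\<zeta>. cnj (cnj (g \<zeta>))) \<in> conj_H2_circle" unfolding conj_H2_circle_def by (rule image_eqI [OF refl])
  then show "g \<in> conj_H2_circle" by simp
qed

lemma cis_mult_cnj [simp]: "cis t * cnj (cis t) = 1" "cis t * (cnj (cis t) * z) = z"
  by (simp_all add: cis_cnj cis_mult flip: mult.assoc)

context inner_boundary
begin

text \<open>Vectors \<open>(a, b)\<close> in \<open>H\<^sup>2\<close> that one \<open>2 \<times> 2\<close> block of the symbol maps into the conjugate of \<open>H\<^sup>2\<close>.\<close>

definition solution :: "(complex \<Rightarrow> complex) \<Rightarrow> (complex \<Rightarrow> complex) \<Rightarrow> bool" where
  "solution a b \<longleftrightarrow> a \<in> H2_circle \<and> b \<in> H2_circle \<and> (\<lambda>\<zeta>. cnj (u \<zeta>) * a \<zeta>) \<in> conj_H2_circle \<and>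
     (\<lambda>\<zeta>. (\<zeta> - lam) * (1 - cnj (u \<zeta>)) * a \<zeta> + u \<zeta> * b \<zeta>) \<in> conj_H2_circle"

text \<open>Two applications of the intersection lemma make (z - lam) A + theta B and B polynomials
  p and q of degree at most one. Comparing values at 0 ties q1 to p1, and the absence of a
  difference quotient forces p and q to vanish at lam, so one parameter is left.\<close>

lemma solution_form:
  assumes nADC: "\<not> (\<exists>w A. H2_quotient w A)" and sol: "solution a b"
  obtains \<beta> where "ae_circle (\<lambda>\<zeta>. a \<zeta> = \<beta> * (1 - (cnj (\<theta> 0) - 1) * u \<zeta>))"
    and "ae_circle (\<lambda>\<zeta>. b \<zeta> = \<beta> * (cnj (\<theta> 0) - 1) * (\<zeta> - lam))"
proof -
  define e where "e \<zeta> = cnj (cnj (u \<zeta>) * a \<zeta>)" for \<zeta>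
  define f where "f \<zeta> = cnj ((\<zeta> - lam) * (1 - cnj (u \<zeta>)) * a \<zeta> + u \<zeta> * b \<zeta>)" for \<zeta>
  obtain A B E F where A: "H2_bv A a" and B: "H2_bv B b" and E: "H2_bv E e" and F: "H2_bv F f"
    using sol unfolding solution_def H2_circle_iff conj_H2_circle_iff e_def [symmetric] f_def [symmetric] by auto
  have llam: "lam * cnj lam = 1" using lam by (simp add: complex_norm_square [symmetric])
  note rules = H2_bv_add H2_bv_diff H2_bv_mult Hinf_bv_diff Hinf_bv_add Hinf_bv_mult Hinf_bv_ident Hinf_bv_const bv
  have unim: "ae_circle (\<lambda>\<zeta>. u \<zeta> * cnj (u \<zeta>) = 1)"
    using unimodular by (rule ae_circle_mono) (simp add: complex_norm_square [symmetric])

  \<comment> \<open>Adding zeta - lam times the first image to the second cancels the cnj u terms,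
    so this analytic combination is zeta times a conjugate Hardy function.\<close>
  have P: "H2_bv (\<lambda>z. (z - lam) * A z + \<theta> z * B z) (\<lambda>\<zeta>. (\<zeta> - lam) * a \<zeta> + u \<zeta> * b \<zeta>)"
    by (intro rules A B)
  have R: "H2_bv (\<lambda>z. (1 - cnj lam * z) * E z + z * F z) (\<lambda>\<zeta>. (1 - cnj lam * \<zeta>) * e \<zeta> + \<zeta> * f \<zeta>)"
    by (intro rules E F)
  have "ae_circle (\<lambda>\<zeta>. (\<zeta> - lam) * a \<zeta> + u \<zeta> * b \<zeta> = \<zeta> * cnj ((1 - cnj lam * \<zeta>) * e \<zeta> + \<zeta> * f \<zeta>))"
    unfolding ae_circle_def e_def f_def by (intro AE_I2) (simp add: algebra_simps)
  then obtain p0 p1 where p: "\<And>z. cmod z < 1 \<Longrightarrow> (z - lam) * A z + \<theta> z * B z = p0 + p1 * z"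
    using H2_inter_mult_cnj_H2 [OF P R] by blast
  have pbv: "H2_bv (\<lambda>z. p0 + p1 * z) (\<lambda>z. p0 + p1 * z)" by (intro rules Hinf_bv_H2)
  have aep: "ae_circle (\<lambda>\<zeta>. (\<zeta> - lam) * a \<zeta> + u \<zeta> * b \<zeta> = p0 + p1 * \<zeta>)"
    by (rule H2_bv_radial_unique [OF P pbv p])

  \<comment> \<open>Multiplying the polynomial identity by cnj u and solving for b shows that b too
    is zeta times a conjugate Hardy function.\<close>
  have S: "H2_bv (\<lambda>z. \<theta> z * (cnj p0 * z + cnj p1) - (1 - cnj lam * z) * E z)
      (\<lambda>\<zeta>. u \<zeta> * (cnj p0 * \<zeta> + cnj p1) - (1 - cnj lam * \<zeta>) * e \<zeta>)"
    by (intro H2_bv_diff Hinf_bv_H2 rules E)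
  have "ae_circle (\<lambda>\<zeta>. b \<zeta> = \<zeta> * cnj (u \<zeta> * (cnj p0 * \<zeta> + cnj p1) - (1 - cnj lam * \<zeta>) * e \<zeta>))"
    using aep unim
  proof (rule ae_circle_mono2)
    fix t assume pt: "(cis t - lam) * a (cis t) + u (cis t) * b (cis t) = p0 + p1 * cis t"
      and ut: "u (cis t) * cnj (u (cis t)) = 1"
    have ct: "cis t * cnj (cis t) = 1" by simp
    have "b (cis t) = cnj (u (cis t)) * (p0 + p1 * cis t) - (cis t - lam) * cnj (u (cis t)) * a (cis t)"
      unfolding pt [symmetric] using ut by algebra
    also have "\<dots> = cis t * (cnj (u (cis t)) * (p0 * cnj (cis t) + p1) - (1 - lam * cnj (cis t)) * (cnj (u (cis t)) * a (cis t)))"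
      using ct by algebra
    finally show "b (cis t) = cis t * cnj (u (cis t) * (cnj p0 * cis t + cnj p1) - (1 - cnj lam * cis t) * e (cis t))"
      by (simp add: e_def)
  qed
  then obtain q0 q1 where q: "\<And>z. cmod z < 1 \<Longrightarrow> B z = q0 + q1 * z"
    using H2_inter_mult_cnj_H2 [OF B S] by blast
  have qbv: "H2_bv (\<lambda>z. q0 + q1 * z) (\<lambda>z. q0 + q1 * z)" by (intro rules Hinf_bv_H2)
  have aeq: "ae_circle (\<lambda>\<zeta>. b \<zeta> = q0 + q1 * \<zeta>)" by (rule H2_bv_radial_unique [OF B qbv q])

  \<comment> \<open>Substituting p and q makes zeta f the boundary function of an explicit analytic
    function; it must vanish at 0 because z F does.\<close>
  have zF: "H2_bv (\<lambda>z. z * F z) (\<lambda>\<zeta>. \<zeta> * f \<zeta>)" by (intro rules F)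
  have W: "H2_bv (\<lambda>z. (cnj p0 + cnj q0) * z + (cnj p1 + cnj q1) - \<theta> z * (cnj p0 * z + cnj p1))
     (\<lambda>\<zeta>. (cnj p0 + cnj q0) * \<zeta> + (cnj p1 + cnj q1) - u \<zeta> * (cnj p0 * \<zeta> + cnj p1))"
    by (intro Hinf_bv_H2 rules)
  have "ae_circle (\<lambda>\<zeta>. (\<zeta> - lam) * a \<zeta> + u \<zeta> * b \<zeta> = p0 + p1 * \<zeta> \<and> u \<zeta> * cnj (u \<zeta>) = 1)"
    using aep unim by (rule ae_circle_mono2) simp
  then have "ae_circle (\<lambda>\<zeta>. \<zeta> * f \<zeta> = (cnj p0 + cnj q0) * \<zeta> + (cnj p1 + cnj q1) - u \<zeta> * (cnj p0 * \<zeta> + cnj p1))"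
    using aeq
  proof (rule ae_circle_mono2)
    fix t assume "(cis t - lam) * a (cis t) + u (cis t) * b (cis t) = p0 + p1 * cis t \<and> u (cis t) * cnj (u (cis t)) = 1"
      and qt: "b (cis t) = q0 + q1 * cis t"
    then have pt: "(cis t - lam) * a (cis t) + u (cis t) * b (cis t) = p0 + p1 * cis t"
      and ut: "u (cis t) * cnj (u (cis t)) = 1" by auto
    have ct: "cis t * cnj (cis t) = 1" by simp
    have "cnj (f (cis t)) = (p0 + p1 * cis t) + (q0 + q1 * cis t) - cnj (u (cis t)) * (p0 + p1 * cis t)"
      unfolding pt [symmetric] qt [symmetric] f_def complex_cnj_cnj using ut by algebra
    then have "cnj (cis t) * cnj (f (cis t)) = (p0 + q0) * cnj (cis t) + (p1 + q1) - cnj (u (cis t)) * (p0 * cnj (cis t) + p1)"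
      using ct by algebra
    then have "cnj (cnj (cis t) * cnj (f (cis t))) = cnj ((p0 + q0) * cnj (cis t) + (p1 + q1) - cnj (u (cis t)) * (p0 * cnj (cis t) + p1))"
      by simp
    then show "cis t * f (cis t) = (cnj p0 + cnj q0) * cis t + (cnj p1 + cnj q1) - u (cis t) * (cnj p0 * cis t + cnj p1)"
      by simp
  qed
  from H2_bv_unique [OF zF W this, of 0]
  have "cnj (cnj p1 + cnj q1 - \<theta> 0 * cnj p1) = 0" by simp
  then have q1: "q1 = (cnj (\<theta> 0) - 1) * p1" by (simp add: algebra_simps add_eq_0_iff2 eq_neg_iff_add_eq_0)

  \<comment> \<open>The values of p and q at lam. The multiples of z - lam are moved to the left
    side, which leaves pl - theta ql.\<close>
  define pl ql where "pl = p0 + p1 * lam" and "ql = q0 + q1 * lam"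
  have disc: "(z - lam) * (A z - p1 + q1 * \<theta> z) = pl - \<theta> z * ql" if "cmod z < 1" for z
    using p[OF that] unfolding q[OF that] pl_def ql_def by algebra
  have Y: "H2_bv (\<lambda>z. A z - p1 + q1 * \<theta> z) (\<lambda>\<zeta>. a \<zeta> - p1 + q1 * u \<zeta>)"
    by (intro H2_bv_add H2_bv_diff A Hinf_bv_H2 rules)
  \<comment> \<open>Otherwise division by - ql produces a difference quotient in H^2 with w = pl /
    ql.\<close>
  have ql: "ql = 0"
  proof (rule ccontr)
    assume ne: "ql \<noteq> 0"
    have "H2_bv (\<lambda>z. (- 1 / ql) * (A z - p1 + q1 * \<theta> z)) (\<lambda>\<zeta>. (- 1 / ql) * (a \<zeta> - p1 + q1 * u \<zeta>))"
      by (intro H2_bv_mult Hinf_bv_const Y)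
    moreover have "(z - lam) * ((- 1 / ql) * (A z - p1 + q1 * \<theta> z)) = \<theta> z - pl / ql" if "cmod z < 1" for z
    proof -
      have "(z - lam) * ((- 1 / ql) * (A z - p1 + q1 * \<theta> z)) = (- 1 / ql) * ((z - lam) * (A z - p1 + q1 * \<theta> z))"
        by (simp only: mult_ac)
      also have "\<dots> = \<theta> z - pl / ql" unfolding disc[OF that] using ne by (simp add: field_simps)
      finally show ?thesis .
    qed
    ultimately have "H2_quotient (pl / ql) (\<lambda>z. (- 1 / ql) * (A z - p1 + q1 * \<theta> z))"
      unfolding H2_quotient_def H2_bv_def by blast
    then show False using nADC by blast
  qed
  have bdry: "ae_circle (\<lambda>\<zeta>. (\<zeta> - lam) * (a \<zeta> - p1 + q1 * u \<zeta>) = pl)"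
    using aep aeq
  proof (rule ae_circle_mono2)
    fix t assume pt: "(cis t - lam) * a (cis t) + u (cis t) * b (cis t) = p0 + p1 * cis t"
      and qt: "b (cis t) = q0 + q1 * cis t"
    have "q0 = - q1 * lam" using ql by (simp add: ql_def add_eq_0_iff2)
    then show "(cis t - lam) * (a (cis t) - p1 + q1 * u (cis t)) = pl"
      using pt qt unfolding pl_def by algebra
  qed
  \<comment> \<open>With ql = 0, a nonzero pl would make a square integrable function equal to pl /
    (zeta - lam).\<close>
  have pl: "pl = 0"
  proof (rule ccontr)
    assume ne: "pl \<noteq> 0"
    have "ae_circle (\<lambda>\<zeta>. cmod pl \<le> cmod (\<zeta> - lam) * cmod (a \<zeta> - p1 + q1 * u \<zeta>))"
      using bdry by (rule ae_circle_mono) (simp add: norm_mult [symmetric])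
    then show False
      using ne inverse_distance_not_L2 [OF lam H2_bv_measurable[OF Y] H2_bv_square_integrable[OF Y], of "cmod pl"]
      by (simp add: ae_circle_def)
  qed
  show ?thesis
  proof
    show "ae_circle (\<lambda>\<zeta>. a \<zeta> = p1 * (1 - (cnj (\<theta> 0) - 1) * u \<zeta>))"
      using bdry ae_circle_neq[of lam]
    proof (rule ae_circle_mono2)
      fix t assume "(cis t - lam) * (a (cis t) - p1 + q1 * u (cis t)) = pl" "cis t \<noteq> lam"
      then have "a (cis t) - p1 + q1 * u (cis t) = 0" using pl by simp
      then show "a (cis t) = p1 * (1 - (cnj (\<theta> 0) - 1) * u (cis t))" using q1 by algebra
    qed
    have q0: "q0 = - q1 * lam" using ql by (simp add: ql_def add_eq_0_iff2)
    show "ae_circle (\<lambda>\<zeta>. b \<zeta> = p1 * (cnj (\<theta> 0) - 1) * (\<zeta> - lam))"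
      using aeq by (rule ae_circle_mono) (simp add: q0 q1 algebra_simps)
  qed
qed

text \<open>Both solutions are multiples, with constants beta and gamma, of one fixed vector, which
  is nonzero almost everywhere. Hence zeta beta = gamma almost everywhere, which forces beta =
  0.\<close>

lemma solution_shift_zero:
  assumes nADC: "\<not> (\<exists>w A. H2_quotient w A)" and "solution a b" "solution (\<lambda>\<zeta>. \<zeta> * a \<zeta>) (\<lambda>\<zeta>. \<zeta> * b \<zeta>)"
  shows "ae_circle (\<lambda>\<zeta>. a \<zeta> = 0 \<and> b \<zeta> = 0)"
proof -
  define c where "c = cnj (\<theta> 0) - 1"
  obtain \<beta> where \<beta>: "ae_circle (\<lambda>\<zeta>. a \<zeta> = \<beta> * (1 - c * u \<zeta>))" "ae_circle (\<lambda>\<zeta>. b \<zeta> = \<beta> * c * (\<zeta> - lam))"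
    using solution_form [OF nADC assms(2)] unfolding c_def .
  obtain \<gamma> where \<gamma>: "ae_circle (\<lambda>\<zeta>. \<zeta> * a \<zeta> = \<gamma> * (1 - c * u \<zeta>))" "ae_circle (\<lambda>\<zeta>. \<zeta> * b \<zeta> = \<gamma> * c * (\<zeta> - lam))"
    using solution_form [OF nADC assms(3)] unfolding c_def .
  have 1: "ae_circle (\<lambda>\<zeta>. (\<zeta> * \<beta> - \<gamma>) * (1 - c * u \<zeta>) = 0)"
    using \<beta>(1) \<gamma>(1) by (rule ae_circle_mono2) algebra
  have "ae_circle (\<lambda>\<zeta>. (\<zeta> * \<beta> - \<gamma>) * c * (\<zeta> - lam) = 0)"
    using \<beta>(2) \<gamma>(2) by (rule ae_circle_mono2) algebra
  then have 2: "ae_circle (\<lambda>\<zeta>. (\<zeta> * \<beta> - \<gamma>) * c = 0)"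
    using ae_circle_neq[of lam] by (rule ae_circle_mono2) auto
  have 3: "ae_circle (\<lambda>\<zeta>. \<zeta> * \<beta> = \<gamma>)"
    using 1 2 by (rule ae_circle_mono2) (auto simp: algebra_simps)
  have "\<beta> = 0"
  proof (rule ccontr)
    assume "\<beta> \<noteq> 0"
    have "ae_circle (\<lambda>\<zeta>. False)"
      using 3 ae_circle_neq[of "\<gamma> / \<beta>"] by (rule ae_circle_mono2) (use \<open>\<beta> \<noteq> 0\<close> in auto)
    then show False using ae_circle_ex by blast
  qed
  then show ?thesis using \<beta> by (auto elim: ae_circle_mono2)
qed

end

subsection \<open>Block matrices and factorizations\<close>

lemma vector_4 [simp]:
  "(vector [x, y, z, w] :: 'a::zero^4) $ 1 = x"
  "(vector [x, y, z, w] :: 'a::zero^4) $ 2 = y"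
  "(vector [x, y, z, w] :: 'a::zero^4) $ 3 = z"
  "(vector [x, y, z, w] :: 'a::zero^4) $ 4 = w"
  unfolding vector_def by simp_all

lemma matrix_inv_mult:
  assumes "invertible (A :: 'a::semiring_1^'n^'n)"
  shows "A ** matrix_inv A = mat 1" "matrix_inv A ** A = mat 1"
  using someI_ex [OF assms [unfolded invertible_def]] by (simp_all add: matrix_inv_def)

lemma matrix_inv_eqI:
  assumes "A ** B = mat 1" "B ** A = mat 1"
  shows "matrix_inv (A :: 'a::semiring_1^'n^'n) = B"
proof -
  have "invertible A" using assms invertible_def by blast
  then have "matrix_inv A = matrix_inv A ** (A ** B)" by (simp add: assms)
  also have "\<dots> = B" using matrix_inv_mult(2) [OF \<open>invertible A\<close>] by (simp add: matrix_mul_assoc)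
  finally show ?thesis .
qed

text \<open>The Kronecker product of a 2 x 2 matrix with the identity of size 2: coordinates 1, 3
  and coordinates 2, 4 carry one copy each.\<close>

definition blk :: "complex \<Rightarrow> complex \<Rightarrow> complex \<Rightarrow> complex \<Rightarrow> complex^4^4" where
  "blk a b c d = vector [vector [a, 0, b, 0], vector [0, a, 0, b], vector [c, 0, d, 0], vector [0, c, 0, d]]"

lemma blk_mult: "blk a b c d ** blk a' b' c' d' = blk (a * a' + b * c') (a * b' + b * d') (c * a' + d * c') (c * b' + d * d')"
  by (simp add: blk_def vec_eq_iff forall_4 matrix_matrix_mult_def sum_4)

lemma blk_one: "blk 1 0 0 1 = mat 1"
  by (simp add: blk_def vec_eq_iff forall_4 mat_def)

lemma G_tilde_eq_blk:
  "G_tilde \<theta> lam \<zeta> = blk (cnj (boundary_value \<theta> \<zeta>)) 0 ((\<zeta> - lam) * (1 - cnj (boundary_value \<theta> \<zeta>))) (boundary_value \<theta> \<zeta>)"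
  by (simp add: G_tilde_def blk_def Let_def)

lemma diag_powers_eq_blk:
  "diag_powers (\<lambda>i::4. if i = 1 \<or> i = 2 then k else l) \<zeta> = blk (\<zeta> powi k) 0 0 (\<zeta> powi l)"
  by (simp add: diag_powers_def blk_def vec_eq_iff forall_4)

text \<open>The adjugate formula. The entries of the inverse are written as scalars times entries,
  the form in which membership in a function space is inherited.\<close>

lemma
  assumes "a * d - b * c = \<delta>" "\<delta> \<noteq> 0"
  shows invertible_blk: "invertible (blk a b c d)"
    and matrix_inv_blk: "matrix_inv (blk a b c d) = blk (1 / \<delta> * d) (- 1 / \<delta> * b) (- 1 / \<delta> * c) (1 / \<delta> * a)"
proof -
  have d: "a * d / \<delta> - b * c / \<delta> = 1" using assms by (simp add: diff_divide_distrib [symmetric])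
  have "blk a b c d ** blk (1 / \<delta> * d) (- 1 / \<delta> * b) (- 1 / \<delta> * c) (1 / \<delta> * a) = mat 1"
    "blk (1 / \<delta> * d) (- 1 / \<delta> * b) (- 1 / \<delta> * c) (1 / \<delta> * a) ** blk a b c d = mat 1"
    unfolding blk_mult blk_one [symmetric] using d by (simp_all add: algebra_simps)
  then show "invertible (blk a b c d)"
    "matrix_inv (blk a b c d) = blk (1 / \<delta> * d) (- 1 / \<delta> * b) (- 1 / \<delta> * c) (1 / \<delta> * a)"
    using matrix_inv_eqI invertible_def by blast+
qed

section \<open>Factorizations built from doubled 2 x 2 blocks\<close>

lemma H2_circle_cong: "g \<in> H2_circle \<Longrightarrow> ae_circle (\<lambda>\<zeta>. g \<zeta> = k \<zeta>) \<Longrightarrow> k \<in> H2_circle"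
  unfolding H2_circle_iff using H2_bv_cong by blast

lemma H2_circle_scale: "g \<in> H2_circle \<Longrightarrow> (\<lambda>\<zeta>. r * g \<zeta>) \<in> H2_circle"
  unfolding H2_circle_iff using H2_bv_mult [OF Hinf_bv_const] by blast

lemma conj_H2_circle_cong:
  assumes "g \<in> conj_H2_circle" "ae_circle (\<lambda>\<zeta>. g \<zeta> = k \<zeta>)"
  shows "k \<in> conj_H2_circle"
proof -
  have "ae_circle (\<lambda>\<zeta>. cnj (g \<zeta>) = cnj (k \<zeta>))" using assms(2) by (rule ae_circle_mono) simp
  then have "H2_bv f (\<lambda>\<zeta>. cnj (g \<zeta>)) \<Longrightarrow> H2_bv f (\<lambda>\<zeta>. cnj (k \<zeta>))" for f
    by (rule H2_bv_cong [rotated])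
  then show ?thesis using assms(1) unfolding conj_H2_circle_iff by blast
qed

lemma conj_H2_circle_scale:
  assumes "g \<in> conj_H2_circle" shows "(\<lambda>\<zeta>. r * g \<zeta>) \<in> conj_H2_circle"
  using assms H2_bv_mult [OF Hinf_bv_const, of _ _ "cnj r"] unfolding conj_H2_circle_iff by auto

lemma entries_in_blk:
  assumes "a \<in> S" "b \<in> S" "c \<in> S" "d \<in> S" "(\<lambda>_. 0) \<in> S"
  shows "entries_in (\<lambda>\<zeta>. blk (a \<zeta>) (b \<zeta>) (c \<zeta>) (d \<zeta>)) S"
  using assms by (simp add: entries_in_def forall_4 blk_def)

text \<open>A constant determinant makes the inverse entries scalar multiples of the entries. The
  set S is abstract so that H^2 and its conjugate are treated at once; closure under null-set
  changes absorbs the points where \<open>matrix_inv\<close> is unspecified.\<close>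

lemma entries_in_matrix_inv_blk:
  assumes cong: "\<And>g k. g \<in> S \<Longrightarrow> ae_circle (\<lambda>\<zeta>. g \<zeta> = k \<zeta>) \<Longrightarrow> k \<in> S"
    and scale: "\<And>g r. g \<in> S \<Longrightarrow> (\<lambda>\<zeta>. r * g \<zeta>) \<in> S"
    and S: "a \<in> S" "b \<in> S" "c \<in> S" "d \<in> S"
    and det: "ae_circle (\<lambda>\<zeta>. a \<zeta> * d \<zeta> - b \<zeta> * c \<zeta> = \<delta>)" "\<delta> \<noteq> 0"
  shows "entries_in (\<lambda>\<zeta>. blk (a \<zeta>) (b \<zeta>) (c \<zeta>) (d \<zeta>)) S"
    and "entries_in (\<lambda>\<zeta>. matrix_inv (blk (a \<zeta>) (b \<zeta>) (c \<zeta>) (d \<zeta>))) S"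
    and "ae_circle (\<lambda>\<zeta>. invertible (blk (a \<zeta>) (b \<zeta>) (c \<zeta>) (d \<zeta>)))"
proof -
  have 0: "(\<lambda>_. 0) \<in> S" using scale [OF S(1), of 0] by simp
  show "entries_in (\<lambda>\<zeta>. blk (a \<zeta>) (b \<zeta>) (c \<zeta>) (d \<zeta>)) S" by (intro entries_in_blk S 0)
  show "ae_circle (\<lambda>\<zeta>. invertible (blk (a \<zeta>) (b \<zeta>) (c \<zeta>) (d \<zeta>)))"
    using det(1) by (rule ae_circle_mono) (rule invertible_blk [OF _ det(2)])
  have inv: "entries_in (\<lambda>\<zeta>. blk (1 / \<delta> * d \<zeta>) (- 1 / \<delta> * b \<zeta>) (- 1 / \<delta> * c \<zeta>) (1 / \<delta> * a \<zeta>)) S"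
    by (intro entries_in_blk scale S 0)
  have ae: "ae_circle (\<lambda>\<zeta>. blk (1 / \<delta> * d \<zeta>) (- 1 / \<delta> * b \<zeta>) (- 1 / \<delta> * c \<zeta>) (1 / \<delta> * a \<zeta>) $ i $ j
      = matrix_inv (blk (a \<zeta>) (b \<zeta>) (c \<zeta>) (d \<zeta>)) $ i $ j)" for i j
    using det(1) by (rule ae_circle_mono) (simp add: matrix_inv_blk [OF _ det(2)])
  show "entries_in (\<lambda>\<zeta>. matrix_inv (blk (a \<zeta>) (b \<zeta>) (c \<zeta>) (d \<zeta>))) S"
    unfolding entries_in_def
  proof (intro allI)
    show "(\<lambda>\<zeta>. matrix_inv (blk (a \<zeta>) (b \<zeta>) (c \<zeta>) (d \<zeta>)) $ i $ j) \<in> S" for i j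
      by (rule cong [OF inv [unfolded entries_in_def, rule_format, of i j] ae])
  qed
qed

lemma has_L2_factorizationI_blk:
  assumes "m11 \<in> conj_H2_circle" "m12 \<in> conj_H2_circle" "m21 \<in> conj_H2_circle" "m22 \<in> conj_H2_circle"
    and "p11 \<in> H2_circle" "p12 \<in> H2_circle" "p21 \<in> H2_circle" "p22 \<in> H2_circle"
    and "ae_circle (\<lambda>\<zeta>. m11 \<zeta> * m22 \<zeta> - m12 \<zeta> * m21 \<zeta> = \<mu>)" "\<mu> \<noteq> 0"
    and "ae_circle (\<lambda>\<zeta>. p11 \<zeta> * p22 \<zeta> - p12 \<zeta> * p21 \<zeta> = \<pi>)" "\<pi> \<noteq> 0"
    and "ae_circle (\<lambda>\<zeta>. G \<zeta> = blk (m11 \<zeta>) (m12 \<zeta>) (m21 \<zeta>) (m22 \<zeta>) ** blk (\<zeta> powi k) 0 0 (\<zeta> powi l)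
            ** blk (p11 \<zeta>) (p12 \<zeta>) (p21 \<zeta>) (p22 \<zeta>))"
  shows "has_L2_factorization G"
  unfolding has_L2_factorization_def
proof (intro exI conjI)
  show "ae_circle (\<lambda>\<zeta>. G \<zeta> = blk (m11 \<zeta>) (m12 \<zeta>) (m21 \<zeta>) (m22 \<zeta>)
      ** diag_powers (\<lambda>i. if i = 1 \<or> i = 2 then k else l) \<zeta> ** blk (p11 \<zeta>) (p12 \<zeta>) (p21 \<zeta>) (p22 \<zeta>))"
    using assms(13) by (simp only: diag_powers_eq_blk)
qed (rule entries_in_matrix_inv_blk [OF conj_H2_circle_cong conj_H2_circle_scale assms(1-4,9,10)]
      entries_in_matrix_inv_blk [OF H2_circle_cong H2_circle_scale assms(5-8,11,12)]; assumption)+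

lemma matrix_mult_diag_powers: "(A ** diag_powers k \<zeta>) $ i $ j = \<zeta> powi k j * A $ i $ j"
  by (simp add: matrix_matrix_mult_def diag_powers_def if_distrib cong: if_cong)

lemma diag_powers_matrix_mult: "(diag_powers k \<zeta> ** A) $ i $ j = \<zeta> powi k i * A $ i $ j"
  by (simp add: matrix_matrix_mult_def diag_powers_def if_distrib [of "\<lambda>x. x * _"] cong: if_cong)

section \<open>Partial indices and solutions\<close>

context inner_boundary
begin

text \<open>On the circle a nonpositive power of zeta is the conjugate of a nonnegative one.\<close>

lemma conj_H2_circle_powi_mult:
  assumes "m \<in> conj_H2_circle" "k \<le> 0"
  shows "(\<lambda>\<zeta>. \<zeta> powi k * m \<zeta>) \<in> conj_H2_circle"
proof -
  obtain f where f: "H2_bv f (\<lambda>\<zeta>. cnj (m \<zeta>))" using assms(1) by (auto simp: conj_H2_circle_iff)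
  have "Hinf_bv (\<lambda>z. z ^ n) (\<lambda>z. z ^ n)" for n
    by (induction n) (auto intro: Hinf_bv_const Hinf_bv_mult Hinf_bv_ident)
  from H2_bv_mult [OF this f] have g: "H2_bv (\<lambda>z. z ^ nat (- k) * f z) (\<lambda>\<zeta>. \<zeta> ^ nat (- k) * cnj (m \<zeta>))" .
  have "ae_circle (\<lambda>\<zeta>. \<zeta> ^ nat (- k) * cnj (m \<zeta>) = cnj (\<zeta> powi k * m \<zeta>))"
    unfolding ae_circle_def
  proof (intro AE_I2)
    fix t
    have "cnj (cis t powi k) = cis t ^ nat (- k)"
      using assms(2) by (cases "k = 0") (auto simp: power_int_def cis_cnj)
    then show "cis t ^ nat (- k) * cnj (m (cis t)) = cnj (cis t powi k * m (cis t))" by simp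
  qed
  from H2_bv_cong [OF g this] show ?thesis by (auto simp: conj_H2_circle_iff)
qed

text \<open>Turns half a column of the factorization identity with nonpositive index into a
  solution.\<close>

lemma solutionI:
  assumes "a \<in> H2_circle" "b \<in> H2_circle" "m \<in> conj_H2_circle" "n \<in> conj_H2_circle" "k \<le> 0"
    and "ae_circle (\<lambda>\<zeta>. \<zeta> powi k * m \<zeta> = cnj (u \<zeta>) * a \<zeta> \<and>
           \<zeta> powi k * n \<zeta> = (\<zeta> - lam) * (1 - cnj (u \<zeta>)) * a \<zeta> + u \<zeta> * b \<zeta>)"
  shows "solution a b"
  unfolding solution_def
proof (intro conjI assms(1,2))
  show "(\<lambda>\<zeta>. cnj (u \<zeta>) * a \<zeta>) \<in> conj_H2_circle"
    by (rule conj_H2_circle_cong [OF conj_H2_circle_powi_mult [OF assms(3,5)]])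
       (use assms(6) in \<open>auto elim: ae_circle_mono\<close>)
  show "(\<lambda>\<zeta>. (\<zeta> - lam) * (1 - cnj (u \<zeta>)) * a \<zeta> + u \<zeta> * b \<zeta>) \<in> conj_H2_circle"
    by (rule conj_H2_circle_cong [OF conj_H2_circle_powi_mult [OF assms(4,5)]])
       (use assms(6) in \<open>auto elim: ae_circle_mono\<close>)
qed

text \<open>A negative index leaves room for one more factor zeta, since k + 1 is still nonpositive;
  so (a, b) and its shift are both solutions.\<close>

lemma solution_negative_exponent_zero:
  assumes nADC: "\<not> (\<exists>w A. H2_quotient w A)"
    and H: "a \<in> H2_circle" "b \<in> H2_circle" "m \<in> conj_H2_circle" "n \<in> conj_H2_circle" and k: "k < 0"
    and ae: "ae_circle (\<lambda>\<zeta>. \<zeta> powi k * m \<zeta> = cnj (u \<zeta>) * a \<zeta> \<and>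
           \<zeta> powi k * n \<zeta> = (\<zeta> - lam) * (1 - cnj (u \<zeta>)) * a \<zeta> + u \<zeta> * b \<zeta>)"
  shows "ae_circle (\<lambda>\<zeta>. a \<zeta> = 0 \<and> b \<zeta> = 0)"
proof (rule solution_shift_zero [OF nADC])
  show "solution a b" using solutionI [OF H _ ae] k by simp
  show "solution (\<lambda>\<zeta>. \<zeta> * a \<zeta>) (\<lambda>\<zeta>. \<zeta> * b \<zeta>)"
  proof (rule solutionI [OF _ _ H(3,4), where k = "k + 1"])
    show "(\<lambda>\<zeta>. \<zeta> * a \<zeta>) \<in> H2_circle" "(\<lambda>\<zeta>. \<zeta> * b \<zeta>) \<in> H2_circle"
      using H(1,2) H2_bv_mult [OF Hinf_bv_ident] unfolding H2_circle_iff by blast+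
    show "ae_circle (\<lambda>\<zeta>. \<zeta> powi (k + 1) * m \<zeta> = cnj (u \<zeta>) * (\<zeta> * a \<zeta>) \<and>
           \<zeta> powi (k + 1) * n \<zeta> = (\<zeta> - lam) * (1 - cnj (u \<zeta>)) * (\<zeta> * a \<zeta>) + u \<zeta> * (\<zeta> * b \<zeta>))"
      using ae
    proof (rule ae_circle_mono)
      fix t
      assume e: "cis t powi k * m (cis t) = cnj (u (cis t)) * a (cis t) \<and>
        cis t powi k * n (cis t) = (cis t - lam) * (1 - cnj (u (cis t))) * a (cis t) + u (cis t) * b (cis t)"
      have "cis t powi (k + 1) = cis t * cis t powi k" using cis_nonzero by (intro power_int_add_1') auto
      then show "cis t powi (k + 1) * m (cis t) = cnj (u (cis t)) * (cis t * a (cis t)) \<and>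
        cis t powi (k + 1) * n (cis t) = (cis t - lam) * (1 - cnj (u (cis t))) * (cis t * a (cis t)) + u (cis t) * (cis t * b (cis t))"
        using e by (simp only: mult.assoc) (simp add: algebra_simps)
    qed
  qed (use k in simp)
qed

end

section \<open>Explicit factors from a difference quotient\<close>

lemma arg_cong4: "a = a' \<Longrightarrow> b = b' \<Longrightarrow> c = c' \<Longrightarrow> d = d' \<Longrightarrow> f a b c d = f a' b' c' d'"
  by simp

lemma conj_H2_circleI: "H2_bv f g \<Longrightarrow> ae_circle (\<lambda>\<zeta>. g \<zeta> = cnj (x \<zeta>)) \<Longrightarrow> x \<in> conj_H2_circle"
  unfolding conj_H2_circle_iff using H2_bv_cong [of f g "\<lambda>\<zeta>. cnj (x \<zeta>)"] by blast

context inner_boundary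
begin

text \<open>The quotient provides the solution (a, -1) besides (1 - c u, c (zeta - lam)). Their
  determinant is constant up to sign, namely 1 - c w. If it is nonzero, they give the columns of the
  inverse of the plus factor; if it vanishes, (a, -1) and (1, 0) serve instead, with indices -1 and
  1.\<close>

lemma H2_quotient_imp_factorization:
  assumes Q: "H2_quotient w A"
    and G: "\<And>\<zeta>. G \<zeta> = blk (cnj (u \<zeta>)) 0 ((\<zeta> - lam) * (1 - cnj (u \<zeta>))) (u \<zeta>)"
  shows "has_L2_factorization G"
proof -
  define a where "a \<zeta> = (u \<zeta> - w) / (\<zeta> - lam)" for \<zeta>
  define c where "c = cnj (\<theta> 0) - 1"
  have A: "H2_bv A a" using H2_quotient_bv [OF Q] by (simp add: a_def [abs_def])
  have w: "w * cnj w = 1" using H2_quotient_unimodular [OF Q] by (simp add: complex_norm_square [symmetric])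
  have l: "lam * cnj lam = 1" using lam by (simp add: complex_norm_square [symmetric])
  note rules = H2_bv_add H2_bv_diff H2_bv_mult Hinf_bv_diff Hinf_bv_add Hinf_bv_mult Hinf_bv_ident Hinf_bv_const bv
  have B: "ae_circle (\<lambda>\<zeta>. u \<zeta> * cnj (u \<zeta>) = 1 \<and> (\<zeta> - lam) * a \<zeta> = u \<zeta> - w)"
    using unimodular ae_circle_neq[of lam]
    by (rule ae_circle_mono2) (simp add: a_def complex_norm_square [symmetric])
  \<comment> \<open>The same symmetry of the quotient on the circle as in the reproducing formula:
    cnj u a is a conjugate Hardy function.\<close>
  have Aconj: "ae_circle (\<lambda>\<zeta>. cnj w * lam * (\<zeta> * a \<zeta>) = cnj (cnj (u \<zeta>) * a \<zeta>))"
    using B ae_circle_neq[of lam]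
  proof (rule ae_circle_mono2)
    fix t
    assume b: "u (cis t) * cnj (u (cis t)) = 1 \<and> (cis t - lam) * a (cis t) = u (cis t) - w" and "cis t \<noteq> lam"
    then have ne: "cnj (cis t - lam) \<noteq> 0" by simp
    have y: "cis t * cnj (cis t) = 1" by simp
    have b1: "u (cis t) * cnj (u (cis t)) = 1" and b2: "(cis t - lam) * a (cis t) = u (cis t) - w"
      and b3: "cnj (cis t - lam) * cnj (a (cis t)) = cnj (u (cis t)) - cnj w"
      using b by (auto simp flip: complex_cnj_mult complex_cnj_diff)
    have "cnj (cis t - lam) * (cnj w * lam * (cis t * a (cis t))) = cnj w * (lam * (cis t * cnj (cis t - lam))) * a (cis t)"
      by (simp only: mult_ac)
    also have "lam * (cis t * cnj (cis t - lam)) = - (cis t - lam)"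
      using y l unfolding complex_cnj_diff by algebra
    also have "cnj w * - (cis t - lam) * a (cis t) = u (cis t) * (cnj (u (cis t)) - cnj w)"
      using b1 b2 w by algebra
    also have "\<dots> = cnj (cis t - lam) * cnj (cnj (u (cis t)) * a (cis t))"
      unfolding b3 [symmetric] by simp
    finally show "cnj w * lam * (cis t * a (cis t)) = cnj (cnj (u (cis t)) * a (cis t))"
      using ne mult_left_cancel by blast
  qed
  have T: "H2_bv (\<lambda>z. if z = 0 then deriv (\<lambda>z. \<theta> z - \<theta> 0) 0 else (\<theta> z - \<theta> 0) / z) (\<lambda>\<zeta>. (u \<zeta> - \<theta> 0) / \<zeta>)"
    by (rule H2_bv_quotient) (intro Hinf_bv_H2 rules, simp)
  have inv: "x / cis t = cnj (cis t) * x" for x t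
    using cis_nonzero[of t] by (simp add: divide_eq_eq mult_ac)
  show ?thesis
  proof (cases "c * w = 1")
    case False
    define \<delta> where "\<delta> = 1 - c * w"
    have \<delta>: "\<delta> \<noteq> 0" using False by (simp add: \<delta>_def)
    show ?thesis
    proof (rule has_L2_factorizationI_blk)
      show "(\<lambda>\<zeta>. 1 / \<delta> * (cnj (u \<zeta>) * a \<zeta>)) \<in> conj_H2_circle"
        by (intro conj_H2_circle_scale conj_H2_circleI [OF _ Aconj, of "\<lambda>z. cnj w * lam * (z * A z)"] rules A)
      show "(\<lambda>\<zeta>. 1 / \<delta> * (cnj (u \<zeta>) - c)) \<in> conj_H2_circle"
        by (intro conj_H2_circle_scale conj_H2_circleI [of "\<lambda>z. \<theta> z - cnj c" "\<lambda>\<zeta>. u \<zeta> - cnj c"] Hinf_bv_H2 rules)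
           (simp add: ae_circle_def)
      show "(\<lambda>\<zeta>. 1 / \<delta> * (cnj (u \<zeta>) * w - 1 - w)) \<in> conj_H2_circle"
        by (intro conj_H2_circle_scale conj_H2_circleI [of "\<lambda>z. \<theta> z * cnj w - 1 - cnj w" "\<lambda>\<zeta>. u \<zeta> * cnj w - 1 - cnj w"] Hinf_bv_H2 rules)
           (simp add: ae_circle_def)
      \<comment> \<open>The entry (zeta - lam) (cnj (theta 0) - cnj u) has positive power zeta,
        which its second factor absorbs: theta - theta 0 vanishes at 0 and is divisible by z. This
        is why c contains cnj (theta 0).\<close>
      have "H2_bv (\<lambda>z. (- 1 + cnj lam * z) * (if z = 0 then deriv (\<lambda>z. \<theta> z - \<theta> 0) 0 else (\<theta> z - \<theta> 0) / z))
          (\<lambda>\<zeta>. (- 1 + cnj lam * \<zeta>) * ((u \<zeta> - \<theta> 0) / \<zeta>))"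
        by (rule H2_bv_mult [OF _ T]) (intro rules)
      then have "(\<lambda>\<zeta>. (\<zeta> - lam) * (cnj (\<theta> 0) - cnj (u \<zeta>))) \<in> conj_H2_circle"
      proof (rule conj_H2_circleI, unfold ae_circle_def, intro AE_I2)
        fix t
        have y: "cis t * cnj (cis t) = 1" by simp
        show "(- 1 + cnj lam * cis t) * ((u (cis t) - \<theta> 0) / cis t) = cnj ((cis t - lam) * (cnj (\<theta> 0) - cnj (u (cis t))))"
          unfolding inv complex_cnj_mult complex_cnj_diff complex_cnj_cnj using y by algebra
      qed
      then show "(\<lambda>\<zeta>. 1 / \<delta> * ((\<zeta> - lam) * (cnj (\<theta> 0) - cnj (u \<zeta>)))) \<in> conj_H2_circle"
        by (rule conj_H2_circle_scale)
      have "H2_bv (\<lambda>z. c * (z - lam)) (\<lambda>\<zeta>. c * (\<zeta> - lam))" "H2_bv (\<lambda>z. c * \<theta> z - 1) (\<lambda>\<zeta>. c * u \<zeta> - 1)"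
        "H2_bv (\<lambda>_. 1) (\<lambda>_. 1)"
        by (intro Hinf_bv_H2 rules)+
      then show "(\<lambda>\<zeta>. c * (\<zeta> - lam)) \<in> H2_circle" "(\<lambda>\<zeta>. c * u \<zeta> - 1) \<in> H2_circle" "(\<lambda>_. 1) \<in> H2_circle" "a \<in> H2_circle"
        unfolding H2_circle_iff using A by blast+
      show "1 / \<delta> \<noteq> 0" "\<delta> \<noteq> 0" using \<delta> by auto
      have cc: "cnj (\<theta> 0) = c + 1" by (simp add: c_def)
      show "ae_circle (\<lambda>\<zeta>. 1 / \<delta> * (cnj (u \<zeta>) * a \<zeta>) * (1 / \<delta> * ((\<zeta> - lam) * (cnj (\<theta> 0) - cnj (u \<zeta>)))) -
          1 / \<delta> * (cnj (u \<zeta>) - c) * (1 / \<delta> * (cnj (u \<zeta>) * w - 1 - w)) = 1 / \<delta>)"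
        using B
      proof (rule ae_circle_mono)
        fix t assume b: "u (cis t) * cnj (u (cis t)) = 1 \<and> (cis t - lam) * a (cis t) = u (cis t) - w"
        have "1 / \<delta> * (cnj (u (cis t)) * a (cis t)) * (1 / \<delta> * ((cis t - lam) * (cnj (\<theta> 0) - cnj (u (cis t))))) -
          1 / \<delta> * (cnj (u (cis t)) - c) * (1 / \<delta> * (cnj (u (cis t)) * w - 1 - w))
          = 1 / \<delta> * (1 / \<delta>) * (cnj (u (cis t)) * ((cis t - lam) * a (cis t)) * (c + 1 - cnj (u (cis t))) -
              (cnj (u (cis t)) - c) * (cnj (u (cis t)) * w - 1 - w))"
        proof -
          have "d * (v * b) * (d * (y * (e - v))) - d * (v - c) * (d * (v * w - 1 - w))
            = d * d * (v * (y * b) * (e - v) - (v - c) * (v * w - 1 - w))" for d v b y e :: complex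
            by algebra
          then show ?thesis unfolding cc .
        qed
        also have "cnj (u (cis t)) * ((cis t - lam) * a (cis t)) * (c + 1 - cnj (u (cis t))) -
              (cnj (u (cis t)) - c) * (cnj (u (cis t)) * w - 1 - w) = \<delta>"
          using b unfolding \<delta>_def by algebra
        finally show "1 / \<delta> * (cnj (u (cis t)) * a (cis t)) * (1 / \<delta> * ((cis t - lam) * (cnj (\<theta> 0) - cnj (u (cis t))))) -
          1 / \<delta> * (cnj (u (cis t)) - c) * (1 / \<delta> * (cnj (u (cis t)) * w - 1 - w)) = 1 / \<delta>" using \<delta> by simp
      qed
      show "ae_circle (\<lambda>\<zeta>. c * (\<zeta> - lam) * a \<zeta> - (c * u \<zeta> - 1) * 1 = \<delta>)"
        using B unfolding \<delta>_def by (rule ae_circle_mono) algebra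
      show "ae_circle (\<lambda>\<zeta>. G \<zeta> = blk (1 / \<delta> * (cnj (u \<zeta>) * a \<zeta>)) (1 / \<delta> * (cnj (u \<zeta>) - c))
           (1 / \<delta> * (cnj (u \<zeta>) * w - 1 - w)) (1 / \<delta> * ((\<zeta> - lam) * (cnj (\<theta> 0) - cnj (u \<zeta>)))) **
          blk (\<zeta> powi 0) 0 0 (\<zeta> powi 0) ** blk (c * (\<zeta> - lam)) (c * u \<zeta> - 1) 1 (a \<zeta>))"
        using B
      proof (rule ae_circle_mono)
        fix t assume b: "u (cis t) * cnj (u (cis t)) = 1 \<and> (cis t - lam) * a (cis t) = u (cis t) - w"
        define x y v b where "x = u (cis t)" and "y = cis t" and "v = cnj (u (cis t))" and "b = a (cis t)"
        have e: "x * v = 1" "(y - lam) * b = x - w" using b by (auto simp: x_def y_def v_def b_def)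
        have d: "1 / \<delta> * \<delta> = 1" using \<delta> by simp
        have "v = 1 / \<delta> * (v * b) * (c * (y - lam)) + 1 / \<delta> * (v - c) * 1"
          "0 = 1 / \<delta> * (v * b) * (c * x - 1) + 1 / \<delta> * (v - c) * b"
          "(y - lam) * (1 - v) = 1 / \<delta> * (v * w - 1 - w) * (c * (y - lam)) + 1 / \<delta> * ((y - lam) * (c + 1 - v)) * 1"
          "x = 1 / \<delta> * (v * w - 1 - w) * (c * x - 1) + 1 / \<delta> * ((y - lam) * (c + 1 - v)) * b"
          using e d \<delta>_def by algebra+
        then show "G (cis t) = blk (1 / \<delta> * (cnj (u (cis t)) * a (cis t))) (1 / \<delta> * (cnj (u (cis t)) - c))
           (1 / \<delta> * (cnj (u (cis t)) * w - 1 - w)) (1 / \<delta> * ((cis t - lam) * (cnj (\<theta> 0) - cnj (u (cis t))))) **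
          blk (cis t powi 0) 0 0 (cis t powi 0) ** blk (c * (cis t - lam)) (c * u (cis t) - 1) 1 (a (cis t))"
          unfolding G cc x_def y_def v_def b_def blk_mult power_int_0_right mult_1_right mult_zero_right add_0_left add_0_right
          by simp
      qed
    qed
  next
    case True
    then have "cnj (cnj w * (\<theta> 0 - 1)) = cnj 1" by (simp add: c_def mult.commute)
    then have cw: "cnj w * (\<theta> 0 - 1) = 1" by (simp only: complex_cnj_cancel_iff)
    show ?thesis
    proof (rule has_L2_factorizationI_blk)
      have "H2_bv (\<lambda>z. cnj w * lam * A z) (\<lambda>\<zeta>. cnj w * lam * a \<zeta>)" by (intro rules A)
      then show "(\<lambda>\<zeta>. \<zeta> * (cnj (u \<zeta>) * a \<zeta>)) \<in> conj_H2_circle"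
      proof (rule conj_H2_circleI)
        show "ae_circle (\<lambda>\<zeta>. cnj w * lam * a \<zeta> = cnj (\<zeta> * (cnj (u \<zeta>) * a \<zeta>)))"
          using Aconj
        proof (rule ae_circle_mono)
          fix t assume e: "cnj w * lam * (cis t * a (cis t)) = cnj (cnj (u (cis t)) * a (cis t))"
          have y: "cis t * cnj (cis t) = 1" by simp
          show "cnj w * lam * a (cis t) = cnj (cis t * (cnj (u (cis t)) * a (cis t)))"
            unfolding complex_cnj_mult [of "cis t"] e [symmetric] using y by algebra
        qed
      qed
      show "(\<lambda>\<zeta>. cnj \<zeta> * cnj (u \<zeta>)) \<in> conj_H2_circle"
        by (intro conj_H2_circleI [of "\<lambda>z. z * \<theta> z" "\<lambda>\<zeta>. \<zeta> * u \<zeta>"] Hinf_bv_H2 rules) (simp add: ae_circle_def)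
      \<comment> \<open>Here c w = 1 means 1 + cnj w = cnj w theta 0, so the conjugate of the entry
        is cnj w (u - theta 0) / zeta and the extra factor zeta is harmless.\<close>
      have "H2_bv (\<lambda>z. cnj w * (if z = 0 then deriv (\<lambda>z. \<theta> z - \<theta> 0) 0 else (\<theta> z - \<theta> 0) / z))
          (\<lambda>\<zeta>. cnj w * ((u \<zeta> - \<theta> 0) / \<zeta>))"
        by (rule H2_bv_mult [OF _ T]) (intro rules)
      then show "(\<lambda>\<zeta>. \<zeta> * (cnj (u \<zeta>) * w - 1 - w)) \<in> conj_H2_circle"
      proof (rule conj_H2_circleI, unfold ae_circle_def, intro AE_I2)
        fix t
        show "cnj w * ((u (cis t) - \<theta> 0) / cis t) = cnj (cis t * (cnj (u (cis t)) * w - 1 - w))"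
          unfolding inv complex_cnj_mult complex_cnj_diff complex_cnj_cnj complex_cnj_one using cw by algebra
      qed
      show "(\<lambda>\<zeta>. cnj \<zeta> * ((\<zeta> - lam) * (1 - cnj (u \<zeta>)))) \<in> conj_H2_circle"
        by (intro conj_H2_circleI [of "\<lambda>z. (1 - cnj lam * z) * (1 - \<theta> z)" "\<lambda>\<zeta>. (1 - cnj lam * \<zeta>) * (1 - u \<zeta>)"] Hinf_bv_H2 rules)
           (simp add: ae_circle_def algebra_simps)
      show "(\<lambda>_. 0) \<in> H2_circle" "(\<lambda>_. - 1) \<in> H2_circle" "(\<lambda>_. 1) \<in> H2_circle" "a \<in> H2_circle"
        unfolding H2_circle_iff using A Hinf_bv_H2 [OF Hinf_bv_const] by blast+
      show "(1::complex) \<noteq> 0" "(1::complex) \<noteq> 0" by auto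
      show "ae_circle (\<lambda>\<zeta>. 0 * a \<zeta> - - 1 * 1 = 1)" by (simp add: ae_circle_def)
      show "ae_circle (\<lambda>\<zeta>. \<zeta> * (cnj (u \<zeta>) * a \<zeta>) * (cnj \<zeta> * ((\<zeta> - lam) * (1 - cnj (u \<zeta>)))) -
          cnj \<zeta> * cnj (u \<zeta>) * (\<zeta> * (cnj (u \<zeta>) * w - 1 - w)) = 1)"
        using B
      proof (rule ae_circle_mono)
        fix t assume b: "u (cis t) * cnj (u (cis t)) = 1 \<and> (cis t - lam) * a (cis t) = u (cis t) - w"
        have y: "cis t * cnj (cis t) = 1" by simp
        show "cis t * (cnj (u (cis t)) * a (cis t)) * (cnj (cis t) * ((cis t - lam) * (1 - cnj (u (cis t))))) -
          cnj (cis t) * cnj (u (cis t)) * (cis t * (cnj (u (cis t)) * w - 1 - w)) = 1"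
          using b y by algebra
      qed
      show "ae_circle (\<lambda>\<zeta>. G \<zeta> = blk (\<zeta> * (cnj (u \<zeta>) * a \<zeta>)) (cnj \<zeta> * cnj (u \<zeta>))
           (\<zeta> * (cnj (u \<zeta>) * w - 1 - w)) (cnj \<zeta> * ((\<zeta> - lam) * (1 - cnj (u \<zeta>)))) **
          blk (\<zeta> powi (-1)) 0 0 (\<zeta> powi 1) ** blk 0 (-1) 1 (a \<zeta>))"
        using B
      proof (rule ae_circle_mono)
        fix t assume b: "u (cis t) * cnj (u (cis t)) = 1 \<and> (cis t - lam) * a (cis t) = u (cis t) - w"
        have key: "blk v 0 ((y - lam) * (1 - v)) x = blk (y * (v * b)) (y' * v) (y * (v * w - 1 - w))
            (y' * ((y - lam) * (1 - v))) ** blk y' 0 0 y ** blk 0 (-1) 1 b"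
          if e: "x * v = 1" "(y - lam) * b = x - w" "y * y' = 1" for x y y' v b
          unfolding blk_mult
          by (intro arg_cong4 [where f = blk]; insert e; (simp add: mult_ac; fail | algebra))
        have pw: "cis t powi (-1) = cnj (cis t)" by (simp add: cis_cnj power_int_minus)
        show "G (cis t) = blk (cis t * (cnj (u (cis t)) * a (cis t))) (cnj (cis t) * cnj (u (cis t)))
           (cis t * (cnj (u (cis t)) * w - 1 - w)) (cnj (cis t) * ((cis t - lam) * (1 - cnj (u (cis t))))) **
          blk (cis t powi (-1)) 0 0 (cis t powi 1) ** blk 0 (-1) 1 (a (cis t))"
          unfolding G pw power_int_1_right using b by (intro key) auto
      qed
    qed
  qed
qed

text \<open>Each column of the inverse plus factor P consists of two pairs, at coordinates 1, 3 and
  2, 4, satisfying the block equation up to a power of zeta. Without a difference quotient, negative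
  indices kill a column of P, positive ones a row of Gp, and zero indices make rows 1 and 3 of P
  dependent.\<close>

lemma factorization_imp_H2_quotient:
  assumes fact: "has_L2_factorization G"
    and G: "\<And>\<zeta>. G \<zeta> = blk (cnj (u \<zeta>)) 0 ((\<zeta> - lam) * (1 - cnj (u \<zeta>))) (u \<zeta>)"
  shows "\<exists>w A. H2_quotient w A"
proof (rule ccontr)
  assume nADC: "\<not> (\<exists>w A. H2_quotient w A)"
  obtain Gm Gp k where
    im: "ae_circle (\<lambda>\<zeta>. invertible (Gm \<zeta>))" and Gm: "entries_in Gm conj_H2_circle" and
    Nm: "entries_in (\<lambda>\<zeta>. matrix_inv (Gm \<zeta>)) conj_H2_circle" and
    ip: "ae_circle (\<lambda>\<zeta>. invertible (Gp \<zeta>))" and Gp: "entries_in Gp H2_circle" and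
    Pp: "entries_in (\<lambda>\<zeta>. matrix_inv (Gp \<zeta>)) H2_circle" and
    fac: "ae_circle (\<lambda>\<zeta>. G \<zeta> = Gm \<zeta> ** diag_powers k \<zeta> ** Gp \<zeta>)"
    using fact unfolding has_L2_factorization_def by blast
  define P where "P \<zeta> = matrix_inv (Gp \<zeta>)" for \<zeta>
  define N where "N \<zeta> = matrix_inv (Gm \<zeta>)" for \<zeta>
  have ent: "(\<lambda>\<zeta>. Gm \<zeta> $ i $ j) \<in> conj_H2_circle" "(\<lambda>\<zeta>. N \<zeta> $ i $ j) \<in> conj_H2_circle"
    "(\<lambda>\<zeta>. - (N \<zeta> $ i $ j)) \<in> conj_H2_circle"
    "(\<lambda>\<zeta>. Gp \<zeta> $ i $ j) \<in> H2_circle" "(\<lambda>\<zeta>. P \<zeta> $ i $ j) \<in> H2_circle"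
    "(\<lambda>\<zeta>. - (Gp \<zeta> $ i $ j)) \<in> H2_circle" for i j
    using Gm Nm Gp Pp conj_H2_circle_scale [of "\<lambda>\<zeta>. N \<zeta> $ i $ j" "-1"] H2_circle_scale [of "\<lambda>\<zeta>. Gp \<zeta> $ i $ j" "-1"]
    by (auto simp: entries_in_def P_def N_def)
  have inv: "ae_circle (\<lambda>\<zeta>. Gp \<zeta> ** P \<zeta> = mat 1 \<and> P \<zeta> ** Gp \<zeta> = mat 1)"
    using ip by (rule ae_circle_mono) (simp add: P_def matrix_inv_mult)
  have u1: "ae_circle (\<lambda>\<zeta>. u \<zeta> * cnj (u \<zeta>) = 1)"
    using unimodular by (rule ae_circle_mono) (simp add: complex_norm_square [symmetric])

  have "ae_circle (\<lambda>\<zeta>. G \<zeta> ** P \<zeta> = Gm \<zeta> ** diag_powers k \<zeta>)"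
    using fac inv
  proof (rule ae_circle_mono2)
    fix t assume f: "G (cis t) = Gm (cis t) ** diag_powers k (cis t) ** Gp (cis t)"
      and "Gp (cis t) ** P (cis t) = mat 1 \<and> P (cis t) ** Gp (cis t) = mat 1"
    then show "G (cis t) ** P (cis t) = Gm (cis t) ** diag_powers k (cis t)"
      unfolding f by (simp add: matrix_mul_assoc [symmetric])
  qed
  then have "ae_circle (\<lambda>\<zeta>. \<zeta> powi k j * Gm \<zeta> $ i $ j = (G \<zeta> ** P \<zeta>) $ i $ j)" for i j
    by (rule ae_circle_mono) (simp add: matrix_mult_diag_powers)
  note col = this [unfolded G blk_def matrix_matrix_mult_def]
  have col1: "ae_circle (\<lambda>\<zeta>. \<zeta> powi k j * Gm \<zeta> $ 1 $ j = cnj (u \<zeta>) * P \<zeta> $ 1 $ j \<and>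
      \<zeta> powi k j * Gm \<zeta> $ 3 $ j = (\<zeta> - lam) * (1 - cnj (u \<zeta>)) * P \<zeta> $ 1 $ j + u \<zeta> * P \<zeta> $ 3 $ j)" for j
    using col[of j 1] col[of j 3] by (rule ae_circle_mono2) (simp add: sum_4)
  have col2: "ae_circle (\<lambda>\<zeta>. \<zeta> powi k j * Gm \<zeta> $ 2 $ j = cnj (u \<zeta>) * P \<zeta> $ 2 $ j \<and>
      \<zeta> powi k j * Gm \<zeta> $ 4 $ j = (\<zeta> - lam) * (1 - cnj (u \<zeta>)) * P \<zeta> $ 2 $ j + u \<zeta> * P \<zeta> $ 4 $ j)" for j
    using col[of j 2] col[of j 4] by (rule ae_circle_mono2) (simp add: sum_4)

  have "ae_circle (\<lambda>\<zeta>. N \<zeta> ** G \<zeta> = diag_powers k \<zeta> ** Gp \<zeta>)"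
    using fac im
  proof (rule ae_circle_mono2)
    fix t assume f: "G (cis t) = Gm (cis t) ** diag_powers k (cis t) ** Gp (cis t)" and "invertible (Gm (cis t))"
    then have "N (cis t) ** Gm (cis t) = mat 1" by (simp add: N_def matrix_inv_mult)
    then show "N (cis t) ** G (cis t) = diag_powers k (cis t) ** Gp (cis t)"
      unfolding f by (simp add: matrix_mul_assoc)
  qed
  then have row: "ae_circle (\<lambda>\<zeta>. Gp \<zeta> $ j $ i = \<zeta> powi (- k j) * (N \<zeta> ** G \<zeta>) $ j $ i)" for i j
  proof (rule ae_circle_mono)
    fix t assume "N (cis t) ** G (cis t) = diag_powers k (cis t) ** Gp (cis t)"
    then show "Gp (cis t) $ j $ i = cis t powi (- k j) * (N (cis t) ** G (cis t)) $ j $ i"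
      using cis_nonzero[of t] by (simp add: diag_powers_matrix_mult power_int_minus)
  qed
  note row = row [unfolded G blk_def matrix_matrix_mult_def]
  \<comment> \<open>For a row of Gp the pair (entry r, minus entry s) solves the block equation with
    the opposite exponent: the block has determinant u cnj u = 1, so its inverse transpose is its
    conjugate by a quarter turn.\<close>
  have swap: "ae_circle (\<lambda>\<zeta>. \<zeta> powi (- k j) * N \<zeta> $ j $ r = cnj (u \<zeta>) * Gp \<zeta> $ j $ r \<and>
      \<zeta> powi (- k j) * - (N \<zeta> $ j $ s) =
        (\<zeta> - lam) * (1 - cnj (u \<zeta>)) * Gp \<zeta> $ j $ r + u \<zeta> * - (Gp \<zeta> $ j $ s))"
    if rs: "(r = 3 \<and> s = 1) \<or> (r = 4 \<and> s = 2)" for j r s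
  proof -
    have "ae_circle (\<lambda>\<zeta>. Gp \<zeta> $ j $ r = \<zeta> powi (- k j) * (N \<zeta> $ j $ r * u \<zeta>) \<and>
        Gp \<zeta> $ j $ s = \<zeta> powi (- k j) * (N \<zeta> $ j $ s * cnj (u \<zeta>) + N \<zeta> $ j $ r * ((\<zeta> - lam) * (1 - cnj (u \<zeta>)))))"
      using row[of j r] row[of j s] by (rule ae_circle_mono2) (use rs in \<open>auto simp: sum_4\<close>)
    then show ?thesis using u1
    proof (rule ae_circle_mono2)
      fix t
      define x where "x = cis t powi (- k j)"
      assume e: "Gp (cis t) $ j $ r = cis t powi (- k j) * (N (cis t) $ j $ r * u (cis t)) \<and>
        Gp (cis t) $ j $ s = cis t powi (- k j) * (N (cis t) $ j $ s * cnj (u (cis t)) + N (cis t) $ j $ r * ((cis t - lam) * (1 - cnj (u (cis t)))))"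
        and "u (cis t) * cnj (u (cis t)) = 1"
      then show "cis t powi (- k j) * N (cis t) $ j $ r = cnj (u (cis t)) * Gp (cis t) $ j $ r \<and>
        cis t powi (- k j) * - (N (cis t) $ j $ s) =
        (cis t - lam) * (1 - cnj (u (cis t))) * Gp (cis t) $ j $ r + u (cis t) * - (Gp (cis t) $ j $ s)"
        unfolding x_def [symmetric] by algebra
    qed
  qed

  have k0: "k j = 0" for j
  proof (rule ccontr)
    assume "k j \<noteq> 0"
    then consider "k j < 0" | "- k j < 0" by linarith
    \<comment> \<open>Either column j of P or row j of Gp vanishes, so the diagonal entry of the
      product cannot be 1.\<close>
    then have "ae_circle (\<lambda>\<zeta>. (Gp \<zeta> ** P \<zeta>) $ j $ j = 0)"
    proof cases
      case 1
      show ?thesis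
        using solution_negative_exponent_zero [OF nADC ent(5,5,1,1) 1 col1]
          solution_negative_exponent_zero [OF nADC ent(5,5,1,1) 1 col2]
        by (rule ae_circle_mono2) (simp add: matrix_matrix_mult_def sum_4)
    next
      case 2
      have "ae_circle (\<lambda>\<zeta>. Gp \<zeta> $ j $ 3 = 0 \<and> - (Gp \<zeta> $ j $ 1) = 0)"
        by (rule solution_negative_exponent_zero [OF nADC ent(4,6,2,3) 2 swap]) simp
      moreover have "ae_circle (\<lambda>\<zeta>. Gp \<zeta> $ j $ 4 = 0 \<and> - (Gp \<zeta> $ j $ 2) = 0)"
        by (rule solution_negative_exponent_zero [OF nADC ent(4,6,2,3) 2 swap]) simp
      ultimately show ?thesis
        by (rule ae_circle_mono2) (simp add: matrix_matrix_mult_def sum_4)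
    qed
    then have "ae_circle (\<lambda>\<zeta>. False)"
      using inv by (rule ae_circle_mono2) (simp add: mat_def)
    then show False using ae_circle_ex by blast
  qed

  define c where "c = cnj (\<theta> 0) - 1"
  \<comment> \<open>With all indices zero, coordinates 1 and 3 of every column are proportional to
    (1 - c u, c (zeta - lam)), which gives a linear relation whose coefficients do not depend on
    j.\<close>
  have par: "ae_circle (\<lambda>\<zeta>. c * (\<zeta> - lam) * P \<zeta> $ 1 $ j = (1 - c * u \<zeta>) * P \<zeta> $ 3 $ j)" for j
  proof -
    have "solution (\<lambda>\<zeta>. P \<zeta> $ 1 $ j) (\<lambda>\<zeta>. P \<zeta> $ 3 $ j)"
      by (rule solutionI [OF ent(5,5,1,1) _ col1]) (simp add: k0)
    from solution_form [OF nADC this] obtain \<beta>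
      where "ae_circle (\<lambda>\<zeta>. P \<zeta> $ 1 $ j = \<beta> * (1 - c * u \<zeta>))" "ae_circle (\<lambda>\<zeta>. P \<zeta> $ 3 $ j = \<beta> * c * (\<zeta> - lam))"
      unfolding c_def .
    then show ?thesis by (rule ae_circle_mono2) simp
  qed
  have "ae_circle (\<lambda>\<zeta>. \<forall>j. c * (\<zeta> - lam) * P \<zeta> $ 1 $ j = (1 - c * u \<zeta>) * P \<zeta> $ 3 $ j)"
    using par unfolding ae_circle_def by (simp add: AE_all_countable)
  then have "ae_circle (\<lambda>\<zeta>. c * (\<zeta> - lam) = 0 \<and> 1 - c * u \<zeta> = 0)"
    using inv
  proof (rule ae_circle_mono2)
    fix t
    assume p: "\<forall>j. c * (cis t - lam) * P (cis t) $ 1 $ j = (1 - c * u (cis t)) * P (cis t) $ 3 $ j"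
      and i: "Gp (cis t) ** P (cis t) = mat 1 \<and> P (cis t) ** Gp (cis t) = mat 1"
    \<comment> \<open>Multiplying by Gp from the right carries the relation over to rows 1 and 3 of
      the identity matrix, so both coefficients vanish.\<close>
    have "c * (cis t - lam) * (P (cis t) ** Gp (cis t)) $ 1 $ l = (1 - c * u (cis t)) * (P (cis t) ** Gp (cis t)) $ 3 $ l" for l
      unfolding matrix_matrix_mult_def using p by (simp add: sum_distrib_left mult.assoc [symmetric])
    from this [of 1] this [of 3] show "c * (cis t - lam) = 0 \<and> 1 - c * u (cis t) = 0"
      using i by (simp add: mat_def)
  qed
  \<comment> \<open>Off lam the first equation gives c = 0, and the second then reads 1 = 0.\<close>
  then have "ae_circle (\<lambda>\<zeta>. False)"
    using ae_circle_neq[of lam] by (rule ae_circle_mono2) auto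
  then show False using ae_circle_ex by blast
qed

end

section \<open>Application to the symbol of an inner function\<close>

lemma inner_boundary_boundary_value:
  assumes "inner_function \<theta>" "cmod lam = 1"
  shows "inner_boundary \<theta> (boundary_value \<theta>) lam"
proof
  have bv: "ae_circle (\<lambda>\<zeta>. has_radial_limit \<theta> \<zeta> (boundary_value \<theta> \<zeta>) \<and> cmod (boundary_value \<theta> \<zeta>) = 1)"
    using conjunct2 [OF conjunct2 [OF assms(1) [unfolded inner_function_def]]]
  proof (rule ae_circle_mono)
    fix t assume "\<exists>w. cmod w = 1 \<and> has_radial_limit \<theta> (cis t) w"
    then obtain w where w: "cmod w = 1" "has_radial_limit \<theta> (cis t) w" by blast
    then have "boundary_value \<theta> (cis t) = w"
      unfolding boundary_value_def has_radial_limit_def by (intro tendsto_Lim) auto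
    then show "has_radial_limit \<theta> (cis t) (boundary_value \<theta> (cis t)) \<and> cmod (boundary_value \<theta> (cis t)) = 1"
      using w by simp
  qed
  obtain B where "\<And>z. cmod z < 1 \<Longrightarrow> cmod (\<theta> z) \<le> B"
    using assms(1) unfolding inner_function_def bounded_iff by force
  then show "Hinf_bv \<theta> (boundary_value \<theta>)"
    using assms(1) bv unfolding Hinf_bv_def inner_function_def by (auto elim: ae_circle_mono)
  show "ae_circle (\<lambda>\<zeta>. cmod (boundary_value \<theta> \<zeta>) = 1)" using bv by (rule ae_circle_mono) simp
qed (rule assms(2))

lemma (in inner_boundary) entries_in_Linf:
  "entries_in (\<lambda>\<zeta>. blk (cnj (u \<zeta>)) 0 ((\<zeta> - lam) * (1 - cnj (u \<zeta>))) (u \<zeta>)) Linf_circle"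
proof (rule entries_in_blk)
  have [measurable]: "cis \<in> borel_measurable circ" by (intro measurable_circ_continuous continuous_intros)
  note [measurable] = measurable_u
  show "u \<in> Linf_circle" "(\<lambda>\<zeta>. cnj (u \<zeta>)) \<in> Linf_circle"
    unfolding Linf_circle_def using unimodular
    by (auto intro!: exI[of _ 1] elim: ae_circle_mono)
  have "ae_circle (\<lambda>\<zeta>. cmod ((\<zeta> - lam) * (1 - cnj (u \<zeta>))) \<le> 4)"
    using unimodular
  proof (rule ae_circle_mono)
    fix t assume "cmod (u (cis t)) = 1"
    then have "cmod (cis t - lam) \<le> 2" "cmod (1 - cnj (u (cis t))) \<le> 2"
      using norm_triangle_ineq4[of "cis t" lam] norm_triangle_ineq4[of 1 "cnj (u (cis t))"] lam by auto
    then have "cmod (cis t - lam) * cmod (1 - cnj (u (cis t))) \<le> 2 * 2" by (intro mult_mono) auto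
    then show "cmod ((cis t - lam) * (1 - cnj (u (cis t)))) \<le> 4" by (simp add: norm_mult)
  qed
  then show "(\<lambda>\<zeta>. (\<zeta> - lam) * (1 - cnj (u \<zeta>))) \<in> Linf_circle"
    unfolding Linf_circle_def by auto
  show "(\<lambda>_. 0) \<in> Linf_circle" "(\<lambda>_. 0) \<in> Linf_circle"
    unfolding Linf_circle_def by (auto simp: ae_circle_def)
qed

theorem theorem7p1:
  fixes \<theta> :: "complex \<Rightarrow> complex" and lam :: complex
  assumes "inner_function \<theta>" and "cmod lam = 1"
  shows "entries_in (G_tilde \<theta> lam) Linf_circle \<and>
         (has_ADC \<theta> lam \<longleftrightarrow> has_L2_factorization (G_tilde \<theta> lam))"
proof -
  interpret inner_boundary \<theta> "boundary_value \<theta>" lam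
    by (rule inner_boundary_boundary_value [OF assms])
  have "entries_in (G_tilde \<theta> lam) Linf_circle"
    using entries_in_Linf by (simp add: G_tilde_eq_blk [abs_def])
  moreover have "has_ADC \<theta> lam \<longleftrightarrow> (\<exists>w A. H2_quotient w A)"
    using ADC_imp_H2_quotient H2_quotient_imp_ADC by metis
  moreover have "(\<exists>w A. H2_quotient w A) \<longleftrightarrow> has_L2_factorization (G_tilde \<theta> lam)"
    using H2_quotient_imp_factorization factorization_imp_H2_quotient G_tilde_eq_blk by blast
  ultimately show ?thesis by blast
qed

end
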